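(* Let $Q$ be a finite symmetric quiver, with a chosen total ordering of its vertex set $Q_0$. Order the generators of the algebra $\mathcal A_Q$ by $a_{i,k}<a_{j,l}$ if $k<l$, or if $k=l$ and $i<j$, and order the (noncommutative) monomials in these generators by the corresponding graded lexicographic ordering (compare lengths first, then compare lexicographically, letter by letter). For this ordering, the algebra $\mathcal A_Q$ has a noncommutative quadratic Gröbner basis of relations if and only if the quiver $Q$ is almost $N$-regular (for some positive integer $N$). In particular, for each almost $N$-regular quiver $Q$, the algebra $\mathcal A_Q$ is Koszul.
   Context: $Q$ is a finite quiver with vertex set $Q_0$; $m_{i,j}$ is the number of arrows from $i$ to $j$; symmetric means $m_{i,j}=m_{j,i}$. For a positive integer $N$, $Q$ is called almost $N$-regular if $m_{i,j}=N$ for all $i\ne j\in Q_0$, and for each $i\in Q_0$ either $m_{i,i}=N$ or $m_{i,i}=N+1$. The algebra $\mathcal A_Q$ is the associative $\mathbb{Q}$-algebra with generators $a_{i,k}$ ($i\in Q_0$, $k\ge0$) and relations $a_{i,k_1}a_{j,k_2}=(-1)^{m_{i,i}m_{j,j}}a_{j,k_2}a_{i,k_1}$ for all $i,j,k_1,k_2$, and $\sum_{k_1+k_2=k}\binom{k_2}{p}a_{i,k_1}a_{j,k_2}=0$ for all $i,j\in Q_0$, $k\ge0$, $0\le p<m_{i,j}$. It is a quadratic algebra (all $a_{i,k}$ have weight 1), and Koszulness is understood in the usual sense for quadratic algebras. A subset $G$ of an ideal $I$ of a free associative algebra is a (noncommutative) Gröbner basis of $I$ if the leading (largest) monomial of every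 nonzero element of $I$ is divisible by (contains as a subword) the leading monomial of an element of $G$. A quadratic Gröbner basis of relations of $\mathcal A_Q$ is a Gröbner basis, consisting of elements of weight 2, of the ideal of relations of $\mathcal A_Q$ in the free associative algebra on the $a_{i,k}$.
   Formalization: N may also be 0 (the English asks for a positive integer N): with N positive the "only if" fails, e.g. for one vertex without arrows, where A_Q is a polynomial ring whose commutators form a quadratic Gröbner basis although Q is not almost N-regular for any N ≥ 1. *)

theory Defs
  imports
    "Graph_Theory.Digraph"
    "HOL-Library.Poly_Mapping"
    "HOL-Library.Sublist"
    "HOL-Algebra.Ideal"
begin

section \<open>Free associative algebras over the rationals\<close>

text \<open>
  Lists form the free monoid, so \<^typ>\<open>'x list \<Rightarrow>\<^sub>0 rat\<close> with the convolution product of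
  \<^theory>\<open>HOL-Library.Poly_Mapping\<close> is the free associative algebra on the elements of \<^typ>\<open>'x\<close>.
\<close>

instantiation list :: (type) monoid_add
begin
definition zero_list :: "'a list" where "zero_list = []"
definition plus_list :: "'a list \<Rightarrow> 'a list \<Rightarrow> 'a list" where "plus_list = (@)"
instance by standard (simp_all add: zero_list_def plus_list_def)
end

definition free_alg :: "'x set \<Rightarrow> ('x list \<Rightarrow>\<^sub>0 rat) ring" where
  "free_alg X = \<lparr>carrier = {f. \<forall>w \<in> Poly_Mapping.keys f. set w \<subseteq> X},
     monoid.mult = (*), one = 1, zero = 0, add = (+)\<rparr>"

definition letter :: "'x \<Rightarrow> ('x list \<Rightarrow>\<^sub>0 rat)" where
  "letter x = Poly_Mapping.single [x] 1"

definition homogeneous :: "nat \<Rightarrow> ('x list \<Rightarrow>\<^sub>0 rat) \<Rightarrow> bool" where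
  "homogeneous d f \<longleftrightarrow> (\<forall>w \<in> Poly_Mapping.keys f. length w = d)"

lemma ring_free_alg: "ring (free_alg X)"
proof (rule ringI)
  show "abelian_group (free_alg X)"
  proof (rule abelian_groupI)
    fix f assume f: "f \<in> carrier (free_alg X)"
    show "\<exists>g \<in> carrier (free_alg X). g \<oplus>\<^bsub>free_alg X\<^esub> f = \<zero>\<^bsub>free_alg X\<^esub>"
      using f by (intro bexI[of _ "- f"]) (auto simp: free_alg_def)
  next
    fix f g assume "f \<in> carrier (free_alg X)" "g \<in> carrier (free_alg X)"
    then show "f \<oplus>\<^bsub>free_alg X\<^esub> g \<in> carrier (free_alg X)"
      using Poly_Mapping.keys_add[of f g] by (auto simp: free_alg_def)
  qed (auto simp: free_alg_def algebra_simps)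
  show "Group.monoid (free_alg X)"
  proof (rule Group.monoidI)
    fix f g assume "f \<in> carrier (free_alg X)" "g \<in> carrier (free_alg X)"
    then show "f \<otimes>\<^bsub>free_alg X\<^esub> g \<in> carrier (free_alg X)"
      using keys_mult[of f g] by (fastforce simp: free_alg_def plus_list_def)
  qed (auto simp: free_alg_def zero_list_def algebra_simps)
qed (auto simp: free_alg_def algebra_simps)


section \<open>Noncommutative Groebner bases\<close>

text \<open>
  For a strict total order \<open>ord\<close> of the letters, \<^term>\<open>lenlex ord\<close> is the graded lexicographic
  order of words.
\<close>

definition is_leading_monomial ::
    "('x \<times> 'x) set \<Rightarrow> ('x list \<Rightarrow>\<^sub>0 rat) \<Rightarrow> 'x list \<Rightarrow> bool" where
  "is_leading_monomial ord f w \<longleftrightarrow>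
     w \<in> Poly_Mapping.keys f \<and> (\<forall>v \<in> Poly_Mapping.keys f - {w}. (v, w) \<in> lenlex ord)"

definition groebner_basis ::
    "('x \<times> 'x) set \<Rightarrow> ('x list \<Rightarrow>\<^sub>0 rat) set \<Rightarrow> ('x list \<Rightarrow>\<^sub>0 rat) set \<Rightarrow> bool" where
  "groebner_basis ord I G \<longleftrightarrow> G \<subseteq> I \<and>
     (\<forall>f \<in> I. f \<noteq> 0 \<longrightarrow>
        (\<exists>g \<in> G. \<exists>v w. is_leading_monomial ord g v \<and> is_leading_monomial ord f w \<and> sublist v w))"

definition has_quadratic_groebner_basis ::
    "('x \<times> 'x) set \<Rightarrow> ('x list \<Rightarrow>\<^sub>0 rat) set \<Rightarrow> bool" where
  "has_quadratic_groebner_basis ord I \<longleftrightarrow> (\<exists>G. groebner_basis ord I G \<and> (\<forall>g \<in> G. homogeneous 2 g))"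


section \<open>Koszul property\<close>

text \<open>
  Let \<open>F = free_alg X\<close>, let \<open>I\<close> be an ideal of \<open>F\<close> generated by homogeneous elements of positive
  weight, let \<open>A = F / I\<close>, and write \<open>F\<^sub>+\<close>, \<open>A\<^sub>+\<close> for the augmentation ideals. The weight \<open>j\<close>
  part of \<open>Tor\<^sub>n\<close> over \<open>A\<close> of the trivial module with itself is the weight \<open>j\<close> homology at place
  \<open>n\<close> of the reduced bar complex, whose term at \<open>n\<close> is the \<open>n\<close>-fold tensor power (over the
  rationals) of \<open>A\<^sub>+\<close>, with
  \<open>d [a\<^sub>1|...|a\<^sub>n] = (\<Sum>i = 1..n-1. (-1)^i [a\<^sub>1|...|a\<^sub>i a\<^sub>i\<^sub>+\<^sub>1|...|a\<^sub>n])\<close>.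

  The sum over \<open>n\<close> of the tensor powers of \<open>F\<^sub>+\<close> has the basis \<open>[w\<^sub>1|...|w\<^sub>n]\<close> with \<open>w\<^sub>i\<close>
  nonempty words over \<open>X\<close>; it is the free algebra on the set \<open>lists X - {[]}\<close> of nonempty words,
  its multiplication being the tensor product. The corresponding sum for \<open>A\<^sub>+\<close> is its quotient by
  the two-sided ideal generated by the copy of \<open>I\<close> in tensor degree one.
\<close>

definition bar_single :: "('x list \<Rightarrow>\<^sub>0 rat) \<Rightarrow> ('x list list \<Rightarrow>\<^sub>0 rat)" where
  "bar_single f = (\<Sum>w \<in> Poly_Mapping.keys f. Poly_Mapping.single [w] (Poly_Mapping.lookup f w))"

definition bar_ideal :: "'x set \<Rightarrow> ('x list \<Rightarrow>\<^sub>0 rat) set \<Rightarrow> ('x list list \<Rightarrow>\<^sub>0 rat) set" where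
  "bar_ideal X I = Idl\<^bsub>free_alg (lists X - {[]})\<^esub> (bar_single ` I)"

definition bar_chains :: "'x set \<Rightarrow> nat \<Rightarrow> nat \<Rightarrow> ('x list list \<Rightarrow>\<^sub>0 rat) set" where
  "bar_chains X n j = {z \<in> carrier (free_alg (lists X - {[]})).
     \<forall>ws \<in> Poly_Mapping.keys z. length ws = n \<and> length (concat ws) = j}"

text \<open>List positions start at 0, hence the sign \<open>(-1) ^ Suc i\<close>.\<close>

definition bar_diff :: "('x list list \<Rightarrow>\<^sub>0 rat) \<Rightarrow> ('x list list \<Rightarrow>\<^sub>0 rat)" where
  "bar_diff z = (\<Sum>ws \<in> Poly_Mapping.keys z. \<Sum>i | Suc i < length ws.
     Poly_Mapping.single (take i ws @ [ws ! i @ ws ! Suc i] @ drop (i + 2) ws)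
       ((-1) ^ Suc i * Poly_Mapping.lookup z ws))"

definition Tor_vanishes :: "'x set \<Rightarrow> ('x list \<Rightarrow>\<^sub>0 rat) set \<Rightarrow> nat \<Rightarrow> nat \<Rightarrow> bool" where
  "Tor_vanishes X I n j \<longleftrightarrow>
     (\<forall>z \<in> bar_chains X n j. bar_diff z \<in> bar_ideal X I \<longrightarrow>
        (\<exists>y \<in> bar_chains X (Suc n) j. z - bar_diff y \<in> bar_ideal X I))"

text \<open>The algebra with generators \<open>X\<close> and relations \<open>R\<close> is quadratic and Koszul:\<close>

definition koszul :: "'x set \<Rightarrow> ('x list \<Rightarrow>\<^sub>0 rat) set \<Rightarrow> bool" where
  "koszul X R \<longleftrightarrow> R \<subseteq> carrier (free_alg X) \<and> (\<forall>f \<in> R. homogeneous 2 f) \<and>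
     (\<forall>n j. n \<noteq> j \<longrightarrow> Tor_vanishes X (Idl\<^bsub>free_alg X\<^esub> R) n j)"


section \<open>Quivers and the algebra of a quiver\<close>

text \<open>
  A finite quiver is a \<^const>\<open>fin_digraph\<close>, which may have loops and parallel arcs. The library's
  \<^const>\<open>symmetric\<close> ignores multiplicities.
\<close>

definition arrows :: "('v, 'e) pre_digraph \<Rightarrow> 'v \<Rightarrow> 'v \<Rightarrow> nat" where
  "arrows Q i j = card {e \<in> arcs Q. tail Q e = i \<and> head Q e = j}"

definition symmetric_quiver :: "('v, 'e) pre_digraph \<Rightarrow> bool" where
  "symmetric_quiver Q \<longleftrightarrow> (\<forall>i \<in> verts Q. \<forall>j \<in> verts Q. arrows Q i j = arrows Q j i)"

text \<open>
  The value \<open>N = 0\<close> is allowed. For an almost 0-regular quiver, such as one vertex without loops,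
  the algebra below is a free supercommutative algebra, and the (anti)commutators of its generators
  are a quadratic Groebner basis.
\<close>

definition almost_regular :: "nat \<Rightarrow> ('v, 'e) pre_digraph \<Rightarrow> bool" where
  "almost_regular N Q \<longleftrightarrow>
     (\<forall>i \<in> verts Q. \<forall>j \<in> verts Q. i \<noteq> j \<longrightarrow> arrows Q i j = N) \<and>
     (\<forall>i \<in> verts Q. arrows Q i i = N \<or> arrows Q i i = N + 1)"

text \<open>The letter \<open>(i, k)\<close> stands for the generator \<open>a\<^sub>i\<^sub>,\<^sub>k\<close>.\<close>

definition quiver_gens :: "('v, 'e) pre_digraph \<Rightarrow> ('v \<times> nat) set" where
  "quiver_gens Q = verts Q \<times> UNIV"

definition quiver_rels :: "('v, 'e) pre_digraph \<Rightarrow> (('v \<times> nat) list \<Rightarrow>\<^sub>0 rat) set" where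
  "quiver_rels Q =
     {letter (i, k1) * letter (j, k2)
        - (-1) ^ (arrows Q i i * arrows Q j j) * (letter (j, k2) * letter (i, k1))
      | i j k1 k2. i \<in> verts Q \<and> j \<in> verts Q}
   \<union> {(\<Sum>(k1, k2) | k1 + k2 = k. of_nat (k2 choose p) * (letter (i, k1) * letter (j, k2)))
      | i j k p. i \<in> verts Q \<and> j \<in> verts Q \<and> p < arrows Q i j}"

definition quiver_ideal :: "('v, 'e) pre_digraph \<Rightarrow> (('v \<times> nat) list \<Rightarrow>\<^sub>0 rat) set" where
  "quiver_ideal Q = Idl\<^bsub>free_alg (quiver_gens Q)\<^esub> (quiver_rels Q)"

text \<open>The relation \<open>r\<close> is the (reflexive) order of the vertices; the result is strict.\<close>

definition gen_order :: "('v \<times> 'v) set \<Rightarrow> (('v \<times> nat) \<times> ('v \<times> nat)) set" where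
  "gen_order r = {((i, k), (j, l)). k < l \<or> (k = l \<and> i \<noteq> j \<and> (i, j) \<in> r)}"

end

theory Submission
  imports Defs "HOL-Combinatorics.Permutations"
begin

text \<open>
  Call a pair of letters normal if it is not the leading monomial of a quadratic relation; by
  interpolation the pair \<open>(i, k) (j, l)\<close> is normal iff \<open>k + m\<^sub>i\<^sub>j + [i > j] \<le> l\<close>. There is a quadratic
  Groebner basis iff the words all of whose consecutive pairs are normal are independent in the algebra.

  The graded dual of the algebra consists of (signed) symmetric polynomials in variables labelled by
  vertices that are divisible by \<open>(z\<^sub>s - z\<^sub>t) ^ m\<close>, where \<open>m\<close> is the number of arrows between the two
  labels. In the almost \<open>N\<close>-regular case these are the \<open>N\<close>-th power of the Vandermonde determinant
  times symmetric or antisymmetric polynomials, and lowest exponents give for each normal word a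
  functional that sees no smaller word.

  Conversely, three labels with mutual multiplicities \<open>x, y, z\<close> give a component of the algebra in
  degree \<open>x + y + z + d\<close> of dimension at most that of polynomials of degree \<open>d\<close> in three variables. If the
  quiver is not almost regular, there are too many normal words of length 3 for some labels and
  \<open>d \<le> 1\<close>.

  For Koszulness, filter the bar complex by the concatenation of its entries. On the associated
  graded complex, splitting the first normal consecutive pair is a contracting homotopy
  off the diagonal.
\<close>

section \<open>Linear algebra in free algebras\<close>

text \<open>Normality of a pair is a numerical formula, so it must be shown that normal pairs are
  never leading. For two letters this holds in every symmetric quiver: two labels involve a single
  multiplicity, and the Vandermonde construction applies with \<open>N\<close> equal to it. Hence a
  quadratic Groebner basis forces every normal word, of any length, to be non-leading.

  The shape \<open>N\<close> or \<open>N + 1\<close> is a matter of parity. After division by the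
  \<open>N\<close>-th power of the Vandermonde determinant, exchanging two variables at a vertex
  with \<open>m\<close> loops multiplies by (-1) to the power m * m + N. This is 1 for m = N. For m
  = N + 1 it is -1, and antisymmetry supplies the one missing factor.

  For the converse, the words to test start with exponent 0 and then grow as little as normality
  permits, one for each order of the labels. A contradiction arises from one such word in degree
  below x + y + z, from two words in degree x + y + z, or from four in degree x + y + z + 1. The
  tie-breaking terms [i > j] decide which label orders reach these degrees.\<close>

abbreviation keys where "keys \<equiv> Poly_Mapping.keys"
abbreviation lkp where "lkp \<equiv> Poly_Mapping.lookup"
abbreviation mon :: "'a \<Rightarrow> ('a \<Rightarrow>\<^sub>0 rat)" where "mon w \<equiv> Poly_Mapping.single w 1"

definition scale_pm :: "rat \<Rightarrow> ('a \<Rightarrow>\<^sub>0 rat) \<Rightarrow> ('a \<Rightarrow>\<^sub>0 rat)" where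
  "scale_pm c f = Poly_Mapping.map ((*) c) f"

lemma lookup_scale_pm [simp]: "lkp (scale_pm c f) w = c * lkp f w"
  by (simp add: scale_pm_def Poly_Mapping.map.rep_eq when_def)

lemma scale_pm_single [simp]: "scale_pm c (Poly_Mapping.single w a) = Poly_Mapping.single w (c * a)"
  by (rule poly_mapping_eqI) (simp add: lookup_single when_def)

lemma keys_scale_pm: "keys (scale_pm c f) \<subseteq> keys f"
  by (auto simp: in_keys_iff)

lemma scale_pm_conv_mult:
  fixes f :: "'a::monoid_add \<Rightarrow>\<^sub>0 rat"
  shows "scale_pm c f = Poly_Mapping.single 0 c * f"
  by (simp add: scale_pm_def mult_map_scale_conv_mult)

interpretation pm: vector_space scale_pm
  by unfold_locales (auto intro!: poly_mapping_eqI simp: lookup_add algebra_simps)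

lemma poly_mapping_sum_keys: "f = (\<Sum>w\<in>keys f. scale_pm (lkp f w) (mon w))"
  by (rule poly_mapping_eqI) (auto simp: lookup_sum lookup_single when_def in_keys_iff)

lemma in_subspaceI:
  assumes "pm.subspace S" "\<And>w. w \<in> keys f \<Longrightarrow> mon w \<in> S"
  shows "f \<in> S"
proof -
  have "(\<Sum>w\<in>keys f. scale_pm (lkp f w) (mon w)) \<in> S"
    using assms by (intro pm.subspace_sum pm.subspace_scale) auto
  then show ?thesis using poly_mapping_sum_keys[of f] by simp
qed

lemma subspace_keys: "pm.subspace {f. keys f \<subseteq> A}"
  unfolding pm.subspace_def
  by (simp add: order_trans[OF Poly_Mapping.keys_add] order_trans[OF keys_scale_pm])

lemma scale_pm_mult_left:
  fixes f :: "'a::monoid_add \<Rightarrow>\<^sub>0 rat"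
  shows "scale_pm c f * g = scale_pm c (f * g)"
  by (simp add: scale_pm_conv_mult mult.assoc)

lemma single_0_commute:
  fixes f :: "'a::monoid_add \<Rightarrow>\<^sub>0 rat"
  shows "f * Poly_Mapping.single 0 c = Poly_Mapping.single 0 c * f"
proof -
  have "pm.subspace {g :: 'a \<Rightarrow>\<^sub>0 rat. g * Poly_Mapping.single 0 c = Poly_Mapping.single 0 c * g}"
    unfolding pm.subspace_def 
  proof (intro conjI ballI allI)
    fix a and x :: "'a \<Rightarrow>\<^sub>0 rat" assume x: "x \<in> {g. g * Poly_Mapping.single 0 c = Poly_Mapping.single 0 c * g}"
    have "scale_pm a x * Poly_Mapping.single 0 c = scale_pm a (Poly_Mapping.single 0 c * x)"
      using x by (simp add: scale_pm_mult_left)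
    also have "\<dots> = Poly_Mapping.single 0 c * scale_pm a x"
      by (simp add: scale_pm_conv_mult mult.assoc[symmetric] mult_single mult.commute)
    finally show "scale_pm a x \<in> {g. g * Poly_Mapping.single 0 c = Poly_Mapping.single 0 c * g}" by simp
  qed (auto simp: algebra_simps)
  then have "f \<in> {g. g * Poly_Mapping.single 0 c = Poly_Mapping.single 0 c * g}"
    by (rule in_subspaceI) (simp add: mult_single)
  then show ?thesis by simp
qed

lemma scale_pm_mult_right:
  fixes f :: "'a::monoid_add \<Rightarrow>\<^sub>0 rat"
  shows "f * scale_pm c g = scale_pm c (f * g)"
  by (metis scale_pm_conv_mult mult.assoc single_0_commute)

lemma mon_mult_mon [simp]: "mon (u::'x list) * mon v = mon (u @ v)"
  by (simp add: mult_single plus_list_def)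

lemma mon_Nil_mult [simp]: "mon ([]::'x list) * f = f" "f * mon ([]::'x list) = f"
  by (simp_all add: zero_list_def[symmetric])

section \<open>Linear extension of maps and functionals given on words\<close>

definition lin :: "('a \<Rightarrow> ('b \<Rightarrow>\<^sub>0 rat)) \<Rightarrow> ('a \<Rightarrow>\<^sub>0 rat) \<Rightarrow> ('b \<Rightarrow>\<^sub>0 rat)" where
  "lin g f = (\<Sum>w\<in>keys f. scale_pm (lkp f w) (g w))"

lemma lin_superset:
  assumes "finite A" "keys f \<subseteq> A"
  shows "lin g f = (\<Sum>w\<in>A. scale_pm (lkp f w) (g w))"
  unfolding lin_def by (rule sum.mono_neutral_left) (use assms in \<open>auto simp: in_keys_iff\<close>)

lemma lin_add: "lin g (a + b) = lin g a + lin g b"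
proof -
  have "keys (a + b) \<subseteq> keys a \<union> keys b" by (rule Poly_Mapping.keys_add)
  then show ?thesis
    by (simp add: lin_superset[of "keys a \<union> keys b"] lookup_add pm.scale_left_distrib sum.distrib)
qed

lemma lin_scale_pm: "lin g (scale_pm c a) = scale_pm c (lin g a)"
  by (simp add: lin_superset[OF _ keys_scale_pm] lin_def[of g a] pm.scale_sum_right)

lemma linear_lin: "Vector_Spaces.linear scale_pm scale_pm (lin g)"
  by unfold_locales (simp_all add: lin_add lin_scale_pm)

interpretation lin: Vector_Spaces.linear scale_pm scale_pm "lin g" for g
  by (rule linear_lin)

lemma lin_single [simp]: "lin g (Poly_Mapping.single w c) = scale_pm c (g w)"
  by (simp add: lin_superset[of "{w}"])

lemma lin_id: "lin mon f = f"
  unfolding lin_def by (rule poly_mapping_sum_keys[symmetric])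

lemma linear_eqI:
  assumes "Vector_Spaces.linear scale_pm scale_pm F" "Vector_Spaces.linear scale_pm scale_pm G"
    and "\<And>w. w \<in> keys f \<Longrightarrow> F (mon w) = G (mon w)"
  shows "F f = G f"
proof -
  interpret F: Vector_Spaces.linear scale_pm scale_pm F by fact
  interpret G: Vector_Spaces.linear scale_pm scale_pm G by fact
  have "pm.subspace {f. F f = G f}"
    by (simp add: pm.subspace_def F.add G.add F.scale G.scale F.zero G.zero)
  then have "f \<in> {f. F f = G f}"
    by (rule in_subspaceI) (use assms in auto)
  then show ?thesis by simp
qed

lemma lin_in_subspace:
  assumes "pm.subspace S" "\<And>w. w \<in> keys f \<Longrightarrow> g w \<in> S"
  shows "lin g f \<in> S"
  unfolding lin_def using assms by (intro pm.subspace_sum pm.subspace_scale) auto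

lemma lin_cong: "(\<And>w. w \<in> keys f \<Longrightarrow> g w = h w) \<Longrightarrow> lin g f = lin h f"
  by (simp add: lin_def)

lemma linear_mult_left: "Vector_Spaces.linear scale_pm scale_pm (\<lambda>f::'a::monoid_add \<Rightarrow>\<^sub>0 rat. a * f)"
  by unfold_locales (simp_all add: algebra_simps scale_pm_mult_right)

lemma linear_mult_right: "Vector_Spaces.linear scale_pm scale_pm (\<lambda>f::'a::monoid_add \<Rightarrow>\<^sub>0 rat. f * a)"
  by unfold_locales (simp_all add: algebra_simps scale_pm_mult_left)

lemma keys_mon_mult:
  fixes f :: "'x list \<Rightarrow>\<^sub>0 rat"
  shows "keys (mon u * f * mon v) = (\<lambda>w. u @ w @ v) ` keys f"
proof -
  have *: "mon u * f * mon v = lin (\<lambda>w. mon (u @ w @ v)) f"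
  proof (rule linear_eqI[OF _ linear_lin])
    show "Vector_Spaces.linear scale_pm scale_pm (\<lambda>f. mon u * f * mon v)"
      by unfold_locales (simp_all add: algebra_simps scale_pm_mult_left scale_pm_mult_right)
  qed simp
  have "lkp (lin (\<lambda>w. mon (u @ w @ v)) f) (u @ w @ v) = lkp f w" for w
    by (simp add: lin_def lookup_sum lookup_single when_def in_keys_iff if_distrib cong: if_cong)
  moreover have "keys (lin (\<lambda>w. mon (u @ w @ v)) f) \<subseteq> (\<lambda>w. u @ w @ v) ` keys f"
    using lin_in_subspace[OF subspace_keys, of f "\<lambda>w. mon (u @ w @ v)" "(\<lambda>w. u @ w @ v) ` keys f"] by auto
  ultimately show ?thesis
    unfolding * by (fastforce simp: in_keys_iff)
qed

definition ev :: "('a \<Rightarrow> rat) \<Rightarrow> ('a \<Rightarrow>\<^sub>0 rat) \<Rightarrow> rat" where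
  "ev \<phi> f = (\<Sum>w\<in>keys f. lkp f w * \<phi> w)"

lemma ev_superset:
  assumes "finite A" "keys f \<subseteq> A"
  shows "ev \<phi> f = (\<Sum>w\<in>A. lkp f w * \<phi> w)"
  unfolding ev_def by (rule sum.mono_neutral_left) (use assms in \<open>auto simp: in_keys_iff\<close>)

lemma ev_add: "ev \<phi> (a + b) = ev \<phi> a + ev \<phi> b"
proof -
  have "keys (a + b) \<subseteq> keys a \<union> keys b" by (rule Poly_Mapping.keys_add)
  then show ?thesis
    by (simp add: ev_superset[of "keys a \<union> keys b"] lookup_add distrib_right sum.distrib)
qed

lemma ev_scale_pm: "ev \<phi> (scale_pm c a) = c * ev \<phi> a"
  by (simp add: ev_superset[OF _ keys_scale_pm] ev_def[of \<phi> a] sum_distrib_left mult.assoc)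

lemma ev_zero [simp]: "ev \<phi> 0 = 0" by (simp add: ev_def)

lemma ev_diff: "ev \<phi> (a - b) = ev \<phi> a - ev \<phi> b"
  using ev_add[of \<phi> "a - b" b] by simp

lemma ev_sum: "ev \<phi> (sum f A) = (\<Sum>x\<in>A. ev \<phi> (f x))"
  by (induct A rule: infinite_finite_induct) (simp_all add: ev_add)

lemma ev_single [simp]: "ev \<phi> (Poly_Mapping.single w c) = c * \<phi> w"
  by (simp add: ev_superset[of "{w}"])

lemma subspace_ev: "pm.subspace {f. ev \<phi> f = 0}"
  by (simp add: pm.subspace_def ev_add ev_scale_pm)


section \<open>Ideals of the free algebra as subspaces\<close>

lemma carrier_free_alg: "f \<in> carrier (free_alg X) \<longleftrightarrow> keys f \<subseteq> lists X"
  by (auto simp: free_alg_def)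

lemma subspace_carrier: "pm.subspace (carrier (free_alg X))"
  using subspace_keys[of "lists X"] by (simp add: carrier_free_alg[symmetric])

lemma mon_carrier [simp]: "mon w \<in> carrier (free_alg X) \<longleftrightarrow> set w \<subseteq> X"
  by (auto simp: free_alg_def)

lemma free_alg_simps [simp]:
  "f \<oplus>\<^bsub>free_alg X\<^esub> g = f + g" "f \<otimes>\<^bsub>free_alg X\<^esub> g = f * g" "\<zero>\<^bsub>free_alg X\<^esub> = 0"
  by (simp_all add: free_alg_def)

lemma mon_mult_carrier:
  assumes "f \<in> carrier (free_alg X)" "set u \<subseteq> X" "set v \<subseteq> X"
  shows "mon u * f * mon v \<in> carrier (free_alg X)"
  using assms unfolding free_alg_def by (auto simp: keys_mon_mult)

lemma ideal_subspace:
  assumes "ideal I (free_alg X)"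
  shows "pm.subspace I"
proof -
  interpret ideal I "free_alg X" by fact
  show ?thesis unfolding pm.subspace_def
  proof (intro conjI ballI allI)
    show "0 \<in> I" using additive_subgroup.zero_closed[OF is_additive_subgroup] by simp
    fix x y assume "x \<in> I" "y \<in> I"
    then show "x + y \<in> I" using additive_subgroup.a_closed[OF is_additive_subgroup, of x y] by simp
  next
    fix c x assume x: "x \<in> I"
    have "Poly_Mapping.single 0 c \<in> carrier (free_alg X)"
      by (simp add: free_alg_def zero_list_def)
    then show "scale_pm c x \<in> I" using I_l_closed[OF x, of "Poly_Mapping.single 0 c"]
      by (simp add: scale_pm_conv_mult)
  qed
qed

lemma ideal_mon_mult:
  assumes "ideal I (free_alg X)" "f \<in> I" "set u \<subseteq> X" "set v \<subseteq> X"
  shows "mon u * f * mon v \<in> I"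
proof -
  interpret ideal I "free_alg X" by fact
  show ?thesis
    using I_l_closed[OF assms(2), of "mon u"] I_r_closed[of "mon u * f" "mon v"] assms by simp
qed

lemma free_alg_Idl:
  assumes "R \<subseteq> carrier (free_alg X)"
  shows "ideal (Idl\<^bsub>free_alg X\<^esub> R) (free_alg X)" "R \<subseteq> Idl\<^bsub>free_alg X\<^esub> R"
    "Idl\<^bsub>free_alg X\<^esub> R \<subseteq> carrier (free_alg X)"
  using ring.genideal_ideal[OF ring_free_alg assms] ring.genideal_self[OF ring_free_alg assms]
  by (auto dest: ideal.Icarr)

text \<open>\<open>P\<close> need not be an ideal, so the proof passes to the elements
  \<open>K\<close> all of whose multiples by words on both sides lie in \<open>P\<close>. By
  linearity, words may be replaced by arbitrary elements, so \<open>K\<close> is an ideal; it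
  contains \<open>R\<close>, and taking both words empty shows that it lies in \<open>P\<close>.
  Every later inclusion of a generated ideal is reduced by this to generators placed between two
  words.\<close>

lemma Idl_subset_subspace:
  assumes R: "R \<subseteq> carrier (free_alg X)" and P: "pm.subspace P"
    and gen: "\<And>u v f. set u \<subseteq> X \<Longrightarrow> set v \<subseteq> X \<Longrightarrow> f \<in> R \<Longrightarrow> mon u * f * mon v \<in> P"
  shows "Idl\<^bsub>free_alg X\<^esub> R \<subseteq> P"
proof -
  define K where "K = {f \<in> carrier (free_alg X). \<forall>u v. set u \<subseteq> X \<longrightarrow> set v \<subseteq> X \<longrightarrow> mon u * f * mon v \<in> P}"
  have sub: "pm.subspace K"
    using P subspace_carrier[of X] unfolding K_def pm.subspace_def
    by (auto simp: distrib_left distrib_right scale_pm_mult_left scale_pm_mult_right)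
  have l: "a * f \<in> K" if f: "f \<in> K" and a: "a \<in> carrier (free_alg X)" for a f
  proof -
    interpret Vector_Spaces.linear scale_pm scale_pm "\<lambda>a. a * f" by (rule linear_mult_right)
    have "a \<in> {a. a * f \<in> K}"
    proof (rule in_subspaceI)
      show "pm.subspace {a. a * f \<in> K}" by (rule subspace_linear_preimage[OF sub])
      fix w assume "w \<in> keys a"
      then have w: "set w \<subseteq> X" using a by (auto simp: free_alg_def)
      have "mon w * f \<in> carrier (free_alg X)"
        using f w mon_mult_carrier[of f X w "[]"] by (simp add: K_def)
      moreover have "mon u * (mon w * f) * mon v \<in> P" if "set u \<subseteq> X" "set v \<subseteq> X" for u v
        using f w that by (simp add: K_def mult.assoc[symmetric])
      ultimately show "mon w \<in> {a. a * f \<in> K}" by (auto simp: K_def)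
    qed
    then show ?thesis by simp
  qed
  have r: "f * a \<in> K" if f: "f \<in> K" and a: "a \<in> carrier (free_alg X)" for a f
  proof -
    interpret Vector_Spaces.linear scale_pm scale_pm "\<lambda>a. f * a" by (rule linear_mult_left)
    have "a \<in> {a. f * a \<in> K}"
    proof (rule in_subspaceI)
      show "pm.subspace {a. f * a \<in> K}" by (rule subspace_linear_preimage[OF sub])
      fix w assume "w \<in> keys a"
      then have w: "set w \<subseteq> X" using a by (auto simp: free_alg_def)
      have "f * mon w \<in> carrier (free_alg X)"
        using f w mon_mult_carrier[of f X "[]" w] by (simp add: K_def)
      moreover have "mon u * (f * mon w) * mon v \<in> P" if "set u \<subseteq> X" "set v \<subseteq> X" for u v
        using f w that by (simp add: K_def mult.assoc)
      ultimately show "mon w \<in> {a. f * a \<in> K}" by (auto simp: K_def)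
    qed
    then show ?thesis by simp
  qed
  have "ideal K (free_alg X)"
  proof (rule idealI[OF ring_free_alg])
    show "subgroup K (add_monoid (free_alg X))"
    proof
      show "K \<subseteq> carrier (add_monoid (free_alg X))" by (auto simp: K_def)
      show "x \<otimes>\<^bsub>add_monoid (free_alg X)\<^esub> y \<in> K" if "x \<in> K" "y \<in> K" for x y
        using pm.subspace_add[OF sub that] by simp
      show "\<one>\<^bsub>add_monoid (free_alg X)\<^esub> \<in> K" using pm.subspace_0[OF sub] by simp
      show "inv\<^bsub>add_monoid (free_alg X)\<^esub> x \<in> K" if x: "x \<in> K" for x
      proof -
        interpret ring "free_alg X" by (rule ring_free_alg)
        have x': "- x \<in> K" by (rule pm.subspace_neg[OF sub x])
        have "\<ominus>\<^bsub>free_alg X\<^esub> x = - x"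
          using x x' by (intro minus_equality) (auto simp: K_def)
        then show ?thesis using x' by (simp add: a_inv_def)
      qed
    qed
  qed (use l r in auto)
  moreover have "R \<subseteq> K" using R gen by (auto simp: K_def)
  ultimately have "Idl\<^bsub>free_alg X\<^esub> R \<subseteq> K"
    by (rule ring.genideal_minimal[OF ring_free_alg])
  also have "K \<subseteq> P"
  proof
    fix f assume "f \<in> K"
    then have "mon [] * f * mon [] \<in> P" unfolding K_def by (metis (mono_tags, lifting) mem_Collect_eq empty_subsetI list.set(1))
    then show "f \<in> P" by simp
  qed
  finally show ?thesis .
qed

section \<open>Functionals with prescribed least word\<close>

text \<open>Division of a monomial by the product of the powers with exponents
  \<open>\<rho> s\<close>. The counter \<open>n\<close> is the position of the first letter, so that
  a suffix is treated as within its word. Subtraction truncates; \<open>lowerable\<close> records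
  that the division is exact.\<close>

primrec lower :: "(nat \<Rightarrow> nat) \<Rightarrow> nat \<Rightarrow> ('v \<times> nat) list \<Rightarrow> ('v \<times> nat) list" where
  "lower \<rho> n [] = []"
| "lower \<rho> n (x # w) = (fst x, snd x - \<rho> n) # lower \<rho> (Suc n) w"

primrec lowerable :: "(nat \<Rightarrow> nat) \<Rightarrow> nat \<Rightarrow> ('v \<times> nat) list \<Rightarrow> bool" where
  "lowerable \<rho> n [] = True"
| "lowerable \<rho> n (x # w) \<longleftrightarrow> \<rho> n \<le> snd x \<and> lowerable \<rho> (Suc n) w"

primrec raise_word :: "(nat \<Rightarrow> nat) \<Rightarrow> nat \<Rightarrow> ('v \<times> nat) list \<Rightarrow> ('v \<times> nat) list" where
  "raise_word \<rho> n [] = []"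
| "raise_word \<rho> n (x # w) = (fst x, snd x + \<rho> n) # raise_word \<rho> (Suc n) w"

lemma length_lower [simp]: "length (lower \<rho> n w) = length w"
  by (induct w arbitrary: n) auto

lemma length_raise_word [simp]: "length (raise_word \<rho> n w) = length w"
  by (induct w arbitrary: n) auto

lemma lower_append: "lower \<rho> n (u @ v) = lower \<rho> n u @ lower \<rho> (n + length u) v"
  by (induct u arbitrary: n) auto

lemma lowerable_append: "lowerable \<rho> n (u @ v) \<longleftrightarrow> lowerable \<rho> n u \<and> lowerable \<rho> (n + length u) v"
  by (induct u arbitrary: n) auto

lemma lower_cong:
  "(\<And>s. n \<le> s \<Longrightarrow> s < n + length w \<Longrightarrow> \<rho> s = \<rho>' s) \<Longrightarrow> lower \<rho> n w = lower \<rho>' n w \<and> lowerable \<rho> n w = lowerable \<rho>' n w"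
proof (induct w arbitrary: n)
  case (Cons x w)
  have "lower \<rho> (Suc n) w = lower \<rho>' (Suc n) w \<and> lowerable \<rho> (Suc n) w = lowerable \<rho>' (Suc n) w"
    by (rule Cons.hyps) (use Cons.prems in auto)
  moreover have "\<rho> n = \<rho>' n" using Cons.prems by auto
  ultimately show ?case by simp
qed simp

lemma lower_raise_word [simp]: "lower \<rho> n (raise_word \<rho> n w) = w" "lowerable \<rho> n (raise_word \<rho> n w)"
  by (induct w arbitrary: n) auto

lemma raise_word_lower: "lowerable \<rho> n w \<Longrightarrow> raise_word \<rho> n (lower \<rho> n w) = w"
  by (induct w arbitrary: n) auto

lemma raise_word_raise_word: "raise_word \<rho> n (raise_word \<rho>' n w) = raise_word (\<lambda>s. \<rho> s + \<rho>' s) n w"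
  by (induct w arbitrary: n) auto

lemma raise_word_zero: "raise_word (\<lambda>s. 0) n w = w"
  by (induct w arbitrary: n) auto

lemma raise_word_funpow: "(raise_word (\<lambda>s. s) n ^^ N) w = raise_word (\<lambda>s. N * s) n w"
  by (induct N) (simp_all add: raise_word_zero raise_word_raise_word add.commute)

text \<open>
  A functional on words is read as a family of polynomials: its value at \<open>(c\<^sub>1, k\<^sub>1) \<dots> (c\<^sub>n, k\<^sub>n)\<close> is the
  coefficient of \<open>z\<^sub>1 ^ k\<^sub>1 \<dots> z\<^sub>n ^ k\<^sub>n\<close> in the polynomial with label sequence \<open>c\<^sub>1 \<dots> c\<^sub>n\<close>. Then \<open>vandermonde\<close> is
  multiplication by the Vandermonde determinant, and \<open>kills_binomial_sums M\<close> is divisibility by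
  \<open>(z\<^sub>p - z\<^sub>p\<^sub>+\<^sub>1) ^ M\<close> for every position \<open>p\<close>.
\<close>

definition vandermonde :: "(('v \<times> nat) list \<Rightarrow> rat) \<Rightarrow> ('v \<times> nat) list \<Rightarrow> rat" where
  "vandermonde \<phi> w = (\<Sum>\<pi> | \<pi> permutes {..<length w}.
     of_int (sign \<pi>) * (if lowerable \<pi> 0 w then \<phi> (lower \<pi> 0 w) else 0))"

definition swap_covariant :: "('v \<Rightarrow> 'v \<Rightarrow> rat) \<Rightarrow> (('v \<times> nat) list \<Rightarrow> rat) \<Rightarrow> bool" where
  "swap_covariant \<beta> \<phi> \<longleftrightarrow> (\<forall>u v x y. \<phi> (u @ [x, y] @ v) = \<beta> (fst x) (fst y) * \<phi> (u @ [y, x] @ v))"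

definition kills_binomial_sums :: "('v \<Rightarrow> 'v \<Rightarrow> nat) \<Rightarrow> (('v \<times> nat) list \<Rightarrow> rat) \<Rightarrow> bool" where
  "kills_binomial_sums M \<phi> \<longleftrightarrow> (\<forall>u v i j K q. q < M i j \<longrightarrow>
     (\<Sum>k\<le>K. of_nat (k choose q) * \<phi> (u @ [(i, K - k), (j, k)] @ v)) = 0)"

lemma swap_covariantD: "swap_covariant \<beta> \<phi> \<Longrightarrow> \<phi> (u @ [x, y] @ v) = \<beta> (fst x) (fst y) * \<phi> (u @ [y, x] @ v)"
  unfolding swap_covariant_def by blast

lemma kills_binomial_sumsD: "kills_binomial_sums M \<phi> \<Longrightarrow> q < M i j \<Longrightarrow>
    (\<Sum>k\<le>K. of_nat (k choose q) * \<phi> (u @ [(i, K - k), (j, k)] @ v)) = 0"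
  by (simp add: kills_binomial_sums_def)

text \<open>Dual to a leading monomial: on an element with leading monomial \<open>w\<close> such a
  functional sees only the leading term. An ideal on which it vanishes therefore has no element with
  leading monomial \<open>w\<close>.\<close>

definition least_in_support :: "('x \<times> 'x) set \<Rightarrow> ('x list \<Rightarrow> rat) \<Rightarrow> 'x list \<Rightarrow> bool" where
  "least_in_support ord \<phi> w \<longleftrightarrow> \<phi> w \<noteq> 0 \<and>
     (\<forall>v. \<phi> v \<noteq> 0 \<longrightarrow> length v = length w \<and> (v = w \<or> (w, v) \<in> lenlex ord))"

lemma least_in_supportD: "least_in_support ord \<phi> w \<Longrightarrow> \<phi> v \<noteq> 0 \<Longrightarrow> length v = length w \<and> (v = w \<or> (w, v) \<in> lenlex ord)"
  unfolding least_in_support_def by blast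

lemma lower_append_pair:
  "lower \<rho> 0 (u @ [x, y] @ v) = lower \<rho> 0 u @ [(fst x, snd x - \<rho> (length u)), (fst y, snd y - \<rho> (Suc (length u)))]
     @ lower \<rho> (Suc (Suc (length u))) v"
  "lowerable \<rho> 0 (u @ [x, y] @ v) \<longleftrightarrow> lowerable \<rho> 0 u \<and> \<rho> (length u) \<le> snd x \<and> \<rho> (Suc (length u)) \<le> snd y
     \<and> lowerable \<rho> (Suc (Suc (length u))) v"
  by (simp_all add: lower_append lowerable_append)

lemma lower_transpose:
  fixes u v :: "('v \<times> nat) list"
  defines "p \<equiv> length u"
  shows "lower (\<pi> \<circ> transpose p (Suc p)) 0 u = lower \<pi> 0 u"
    "lowerable (\<pi> \<circ> transpose p (Suc p)) 0 u = lowerable \<pi> 0 u"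
    "lower (\<pi> \<circ> transpose p (Suc p)) (Suc (Suc p)) v = lower \<pi> (Suc (Suc p)) v"
    "lowerable (\<pi> \<circ> transpose p (Suc p)) (Suc (Suc p)) v = lowerable \<pi> (Suc (Suc p)) v"
proof -
  have "lower (\<pi> \<circ> transpose p (Suc p)) 0 u = lower \<pi> 0 u \<and> lowerable (\<pi> \<circ> transpose p (Suc p)) 0 u = lowerable \<pi> 0 u"
    by (rule lower_cong) (auto simp: p_def transpose_def)
  moreover have "lower (\<pi> \<circ> transpose p (Suc p)) (Suc (Suc p)) v = lower \<pi> (Suc (Suc p)) v \<and>
      lowerable (\<pi> \<circ> transpose p (Suc p)) (Suc (Suc p)) v = lowerable \<pi> (Suc (Suc p)) v"
    by (rule lower_cong) (auto simp: p_def transpose_def)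
  ultimately show "lower (\<pi> \<circ> transpose p (Suc p)) 0 u = lower \<pi> 0 u"
    "lowerable (\<pi> \<circ> transpose p (Suc p)) 0 u = lowerable \<pi> 0 u"
    "lower (\<pi> \<circ> transpose p (Suc p)) (Suc (Suc p)) v = lower \<pi> (Suc (Suc p)) v"
    "lowerable (\<pi> \<circ> transpose p (Suc p)) (Suc (Suc p)) v = lowerable \<pi> (Suc (Suc p)) v" by blast+
qed

text \<open>Composition with an adjacent transposition permutes the index set and flips every sign.
  In this form the antisymmetry of the Vandermonde determinant enters, both for the exchange of
  letters and for the additional order of vanishing.\<close>

lemma sum_sign_transpose:
  fixes B :: "(nat \<Rightarrow> nat) \<Rightarrow> rat"
  assumes "Suc p < n"
  shows "(\<Sum>\<pi> | \<pi> permutes {..<n}. of_int (sign \<pi>) * B \<pi>) =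
    - (\<Sum>\<pi> | \<pi> permutes {..<n}. of_int (sign \<pi>) * B (\<pi> \<circ> transpose p (Suc p)))"
proof -
  have t: "transpose p (Suc p) permutes {..<n}"
    using assms by (intro permutes_swap_id) auto
  have sg: "sign (\<pi> \<circ> transpose p (Suc p)) = - sign \<pi>" if "\<pi> permutes {..<n}" for \<pi>
    using that t permutation_permutes[of \<pi>] permutation_permutes[of "transpose p (Suc p)"]
    by (subst sign_compose) (auto simp: sign_swap_id)
  show ?thesis
    by (subst sum_permutations_compose_right[OF t]) (simp add: sg sum_negf[symmetric])
qed

lemma vandermonde_swap_covariant:
  fixes \<phi> :: "('v \<times> nat) list \<Rightarrow> rat"
  assumes "swap_covariant \<beta> \<phi>"
  shows "swap_covariant (\<lambda>i j. - \<beta> i j) (vandermonde \<phi>)"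
  unfolding swap_covariant_def
proof (intro allI)
  fix u v :: "('v \<times> nat) list" and x y
  let ?t = "transpose (length u) (Suc (length u))"
  let ?A = "\<lambda>w \<pi>. if lowerable \<pi> 0 w then \<phi> (lower \<pi> 0 w) else 0"
  \<comment> \<open>The transposed permutation subtracts from \<open>x\<close> and from
    \<open>y\<close> the same amounts as \<open>\<pi>\<close> does once the two letters are
    exchanged, so covariance of \<open>\<phi>\<close> applies to the lowered words.\<close>
  have A: "?A (u @ [x, y] @ v) (\<pi> \<circ> ?t) = \<beta> (fst x) (fst y) * ?A (u @ [y, x] @ v) \<pi>" for \<pi>
  proof -
    have "\<phi> (lower \<pi> 0 u @ [(fst x, snd x - \<pi> (Suc (length u))), (fst y, snd y - \<pi> (length u))]
       @ lower \<pi> (Suc (Suc (length u))) v) = \<beta> (fst x) (fst y) * 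
       \<phi> (lower \<pi> 0 u @ [(fst y, snd y - \<pi> (length u)), (fst x, snd x - \<pi> (Suc (length u)))]
       @ lower \<pi> (Suc (Suc (length u))) v)"
      by (rule swap_covariantD[OF assms, of _ "(fst x, _)" "(fst y, _)", unfolded fst_conv])
    then show ?thesis
      unfolding lower_append_pair lower_transpose by auto
  qed
  have len: "length (u @ [y, x] @ v) = length (u @ [x, y] @ v)" by simp
  have "vandermonde \<phi> (u @ [x, y] @ v) =
      - (\<Sum>\<pi> | \<pi> permutes {..<length (u @ [x, y] @ v)}. of_int (sign \<pi>) * ?A (u @ [x, y] @ v) (\<pi> \<circ> ?t))"
    unfolding vandermonde_def by (rule sum_sign_transpose) simp
  also have "\<dots> = - \<beta> (fst x) (fst y) * vandermonde \<phi> (u @ [y, x] @ v)"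
    unfolding A vandermonde_def len sum_distrib_left sum_negf[symmetric]
    by (rule sum.cong) auto
  finally show "vandermonde \<phi> (u @ [x, y] @ v) = - \<beta> (fst x) (fst y) * vandermonde \<phi> (u @ [y, x] @ v)" .
qed

text \<open>By Pascal's rule each unit of the shift changes the sum by a sum for
  \<open>q - 1\<close>, which is killed since \<open>q - 1 < M i j\<close>. The bound includes
  \<open>q = M i j\<close>, one beyond the orders that vanish themselves; this yields the extra
  order after multiplication by the Vandermonde determinant.\<close>

lemma kills_binomial_sums_shift:
  assumes "kills_binomial_sums M \<phi>" "q \<le> M i j"
  shows "(\<Sum>k\<le>K. of_nat (k + b choose q) * \<phi> (u @ [(i, K - k), (j, k)] @ v)) =
    (\<Sum>k\<le>K. of_nat (k choose q) * \<phi> (u @ [(i, K - k), (j, k)] @ v))"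
  using assms(2)
proof (induct b arbitrary: q)
  case (Suc b)
  show ?case
  proof (cases q)
    case (Suc q')
    have "(\<Sum>k\<le>K. of_nat (k + b choose q') * \<phi> (u @ [(i, K - k), (j, k)] @ v)) = 0"
      using Suc.hyps[of q'] Suc.prems assms(1) Suc unfolding kills_binomial_sums_def by simp
    then show ?thesis
      using Suc.hyps[OF Suc.prems] unfolding Suc
      by (simp add: distrib_right sum.distrib)
  qed simp
qed simp

lemma vandermonde_kills_binomial_sums:
  fixes \<phi> :: "('v \<times> nat) list \<Rightarrow> rat"
  assumes "kills_binomial_sums M \<phi>"
  shows "kills_binomial_sums (\<lambda>i j. Suc (M i j)) (vandermonde \<phi>)"
  unfolding kills_binomial_sums_def
proof (intro allI impI)
  fix u v :: "('v \<times> nat) list" and i j K q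
  assume q: "q < Suc (M i j)"
  let ?t = "transpose (length u) (Suc (length u))"
  let ?p = "length u"
  let ?n = "length u + 2 + length v"
  let ?W = "\<lambda>k. u @ [(i, K - k), (j, k)] @ v"
  define B where "B \<pi> = (\<Sum>k\<le>K. of_nat (k choose q) *
    (if lowerable \<pi> 0 (?W k) then \<phi> (lower \<pi> 0 (?W k)) else 0))" for \<pi>
  have B: "B \<pi> = (if lowerable \<pi> 0 u \<and> lowerable \<pi> (Suc (Suc ?p)) v \<and> \<pi> ?p + \<pi> (Suc ?p) \<le> K then
      (\<Sum>l\<le>K - \<pi> ?p - \<pi> (Suc ?p). of_nat (l choose q) *
        \<phi> (lower \<pi> 0 u @ [(i, K - \<pi> ?p - \<pi> (Suc ?p) - l), (j, l)] @ lower \<pi> (Suc (Suc ?p)) v)) else 0)" for \<pi>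
  proof (cases "lowerable \<pi> 0 u \<and> lowerable \<pi> (Suc (Suc ?p)) v \<and> \<pi> ?p + \<pi> (Suc ?p) \<le> K")
    case True
    let ?a = "\<pi> ?p" and ?b = "\<pi> (Suc ?p)"
    have "B \<pi> = (\<Sum>k\<in>{?b..K - ?a}. of_nat (k choose q) *
        \<phi> (lower \<pi> 0 u @ [(i, K - k - ?a), (j, k - ?b)] @ lower \<pi> (Suc (Suc ?p)) v))"
      unfolding B_def lower_append_pair
      by (rule sum.mono_neutral_cong_right) (use True in auto)
    also have "\<dots> = (\<Sum>l\<le>K - ?a - ?b. of_nat (l + ?b choose q) *
        \<phi> (lower \<pi> 0 u @ [(i, K - ?a - ?b - l), (j, l)] @ lower \<pi> (Suc (Suc ?p)) v))"
      by (rule sum.reindex_bij_witness[of _ "\<lambda>l. l + ?b" "\<lambda>k. k - ?b"]) (use True in \<open>auto simp: diff_diff_left add.commute add.left_commute\<close>)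
    also have "\<dots> = (\<Sum>l\<le>K - ?a - ?b. of_nat (l choose q) *
        \<phi> (lower \<pi> 0 u @ [(i, K - ?a - ?b - l), (j, l)] @ lower \<pi> (Suc (Suc ?p)) v))"
      using q by (intro kills_binomial_sums_shift[OF assms]) simp
    finally show ?thesis using True by simp
  next
    case False
    then show ?thesis unfolding B_def lower_append_pair by (intro trans[OF sum.neutral]) auto
  qed
  have Bt: "B (\<pi> \<circ> ?t) = B \<pi>" for \<pi>
    unfolding B lower_transpose by (simp add: add.commute diff_right_commute)
  have "(\<Sum>k\<le>K. of_nat (k choose q) * vandermonde \<phi> (?W k)) =
      (\<Sum>\<pi> | \<pi> permutes {..<?n}. of_int (sign \<pi>) * B \<pi>)"
    unfolding vandermonde_def B_def sum_distrib_left
    by (subst sum.swap) (simp add: mult.left_commute)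
  moreover have "\<dots> = - \<dots>"
    using sum_sign_transpose[of ?p ?n B] by (simp add: Bt)
  ultimately show "(\<Sum>k\<le>K. of_nat (k choose q) * vandermonde \<phi> (?W k)) = 0" by simp
qed

text \<open>As long as \<open>\<pi>\<close> has fixed all earlier positions, it subtracts at least
  \<open>s\<close> at position \<open>s\<close>. The first position where it subtracts more, or
  where \<open>w\<close> is already smaller, decides the comparison, because
  \<open>gen_order\<close> looks at exponents before labels.\<close>

lemma raise_word_le:
  assumes "length v = length w" "lowerable \<pi> n v"
    and "w = lower \<pi> n v \<or> (w, lower \<pi> n v) \<in> lenlex (gen_order r)"
    and "\<And>s. n \<le> s \<Longrightarrow> s < n + length v \<Longrightarrow> (\<And>t. n \<le> t \<Longrightarrow> t < s \<Longrightarrow> \<pi> t = t) \<Longrightarrow> s \<le> \<pi> s"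
  shows "(raise_word (\<lambda>s. s) n w = v \<and> (\<forall>s. n \<le> s \<and> s < n + length v \<longrightarrow> \<pi> s = s)) \<or>
    (raise_word (\<lambda>s. s) n w, v) \<in> lenlex (gen_order r)"
  using assms
proof (induct w arbitrary: v n)
  case (Cons x w v n)
  then obtain y v' where v: "v = y # v'" by (cases v) auto
  obtain i k j l where xy: "x = (i, k)" "y = (j, l)" by fastforce
  have len: "length v' = length w" using Cons.prems(1) v by simp
  have \<pi>: "\<pi> n \<le> l" "n \<le> \<pi> n" "lowerable \<pi> (Suc n) v'"
    using Cons.prems(2) Cons.prems(4)[of n] v xy by auto
  show ?case
  proof (cases "(x, (j, l - \<pi> n)) \<in> gen_order r \<or> n < \<pi> n")
    case True
    have "x = (j, l - \<pi> n) \<or> (x, (j, l - \<pi> n)) \<in> gen_order r"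
      using Cons.prems(3) v xy len by (auto simp: Cons_lenlex_iff)
    then have "((i, k + n), (j, l)) \<in> gen_order r"
      using True \<pi> xy by (auto simp: gen_order_def)
    then show ?thesis using v xy len by (simp add: Cons_lenlex_iff)
  next
    case False
    then have \<pi>n: "\<pi> n = n" using \<pi> by simp
    have x: "x = (j, l - n)" and "w = lower \<pi> (Suc n) v' \<or> (w, lower \<pi> (Suc n) v') \<in> lenlex (gen_order r)"
      using Cons.prems(3) v xy False \<pi>n by (auto simp: Cons_lenlex_iff len)
    then have "(raise_word (\<lambda>s. s) (Suc n) w = v' \<and> (\<forall>s. Suc n \<le> s \<and> s < Suc n + length v' \<longrightarrow> \<pi> s = s)) \<or>
      (raise_word (\<lambda>s. s) (Suc n) w, v') \<in> lenlex (gen_order r)"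
    proof (intro Cons.hyps[OF len \<pi>(3)])
      fix s assume s: "Suc n \<le> s" "s < Suc n + length v'" "\<And>t. Suc n \<le> t \<Longrightarrow> t < s \<Longrightarrow> \<pi> t = t"
      have "\<pi> t = t" if "n \<le> t" "t < s" for t using s(3)[of t] that \<pi>n by (cases "t = n") auto
      then show "s \<le> \<pi> s" using s(1,2) v by (intro Cons.prems(4)) auto
    qed
    then show ?thesis
    proof (elim disjE conjE)
      assume *: "raise_word (\<lambda>s. s) (Suc n) w = v'" "\<forall>s. Suc n \<le> s \<and> s < Suc n + length v' \<longrightarrow> \<pi> s = s"
      have "\<pi> s = s" if "n \<le> s" "s < n + length v" for s
        using that * \<pi>n v by (cases "s = n") auto
      then show ?thesis using v x xy \<pi> \<pi>n * by auto
    next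
      assume "(raise_word (\<lambda>s. s) (Suc n) w, v') \<in> lenlex (gen_order r)"
      then show ?thesis using v x xy \<pi> \<pi>n by (auto simp: Cons_lenlex_iff)
    qed
  qed
qed simp

lemma gen_order_irrefl: "(x, x) \<notin> gen_order r"
  by (auto simp: gen_order_def)

lemma permutes_fix_le:
  assumes "\<pi> permutes {..<n::nat}" "\<And>t. t < s \<Longrightarrow> \<pi> t = t"
  shows "s \<le> \<pi> s"
proof (rule ccontr)
  assume "\<not> s \<le> \<pi> s"
  then have "\<pi> (\<pi> s) = \<pi> s" using assms(2) by simp
  then have "\<pi> s = s" using permutes_inj[OF assms(1)] by (simp add: inj_eq)
  then show False using \<open>\<not> s \<le> \<pi> s\<close> by simp
qed

text \<open>The lexicographically lowest monomial of the Vandermonde determinant has exponents 0, 1,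
  2, ... and comes from the identity alone. Hence lowest words add up and the coefficient
  \<open>\<phi> w\<close> survives unchanged.\<close>

lemma vandermonde_least_in_support:
  assumes "least_in_support (gen_order r) \<phi> w"
  shows "least_in_support (gen_order r) (vandermonde \<phi>) (raise_word (\<lambda>s. s) 0 w)"
proof -
  have key: "length v = length w \<and> ((raise_word (\<lambda>s. s) 0 w = v \<and> \<pi> = id) \<or>
      (raise_word (\<lambda>s. s) 0 w, v) \<in> lenlex (gen_order r))"
    if \<pi>: "\<pi> permutes {..<length v}" and ok: "lowerable \<pi> 0 v" "\<phi> (lower \<pi> 0 v) \<noteq> 0" for v \<pi>
  proof -
    have l: "length v = length w" "w = lower \<pi> 0 v \<or> (w, lower \<pi> 0 v) \<in> lenlex (gen_order r)"
      using least_in_supportD[OF assms ok(2)] by auto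
    have "(raise_word (\<lambda>s. s) 0 w = v \<and> (\<forall>s. 0 \<le> s \<and> s < 0 + length v \<longrightarrow> \<pi> s = s)) \<or>
      (raise_word (\<lambda>s. s) 0 w, v) \<in> lenlex (gen_order r)"
      by (rule raise_word_le[OF l(1) ok(1) l(2)]) (use permutes_fix_le[OF \<pi>] in auto)
    moreover have "\<pi> = id" if "\<forall>s. 0 \<le> s \<and> s < 0 + length v \<longrightarrow> \<pi> s = s"
    proof
      fix s
      show "\<pi> s = id s" using that permutes_not_in[OF \<pi>, of s] by (cases "s < length v") auto
    qed
    ultimately show ?thesis using l by blast
  qed
  let ?w = "raise_word (\<lambda>s. s) 0 w"
  have irr: "(?w, ?w) \<notin> lenlex (gen_order r)"
    by (rule lenlex_irreflexive) (rule gen_order_irrefl)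
  have "vandermonde \<phi> ?w = (\<Sum>\<pi>\<in>{id}. of_int (sign \<pi>) * (if lowerable \<pi> 0 ?w then \<phi> (lower \<pi> 0 ?w) else 0))"
    unfolding vandermonde_def
  proof (rule sum.mono_neutral_right)
    show "\<forall>\<pi>\<in>{\<pi>. \<pi> permutes {..<length ?w}} - {id}.
        of_int (sign \<pi>) * (if lowerable \<pi> 0 ?w then \<phi> (lower \<pi> 0 ?w) else 0) = 0"
      using key[of _ ?w] irr by auto
  qed (auto simp: finite_permutations permutes_id)
  also have "\<dots> = \<phi> w"
    using lower_raise_word[of "\<lambda>s. s" 0 w] by (simp add: id_def)
  finally have "vandermonde \<phi> ?w = \<phi> w" .
  moreover have "\<phi> w \<noteq> 0" using assms unfolding least_in_support_def by blast
  ultimately have "vandermonde \<phi> ?w \<noteq> 0" by simp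
  moreover have "length v = length ?w \<and> (v = ?w \<or> (?w, v) \<in> lenlex (gen_order r))" if nz: "vandermonde \<phi> v \<noteq> 0" for v
  proof -
    have "\<exists>\<pi>. \<pi> permutes {..<length v} \<and> lowerable \<pi> 0 v \<and> \<phi> (lower \<pi> 0 v) \<noteq> 0"
    proof (rule ccontr)
      assume "\<nexists>\<pi>. \<pi> permutes {..<length v} \<and> lowerable \<pi> 0 v \<and> \<phi> (lower \<pi> 0 v) \<noteq> 0"
      then have "vandermonde \<phi> v = 0" unfolding vandermonde_def by (intro sum.neutral) auto
      then show False using nz by blast
    qed
    then obtain \<pi> where "\<pi> permutes {..<length v}" "lowerable \<pi> 0 v" "\<phi> (lower \<pi> 0 v) \<noteq> 0"
      by blast
    from key[OF this] show ?thesis unfolding length_raise_word by blast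
  qed
  ultimately show ?thesis unfolding least_in_support_def by simp
qed

section \<open>Signed orbit sums of monomials\<close>

primrec word_sign :: "('v \<Rightarrow> 'v \<Rightarrow> rat) \<Rightarrow> (('v \<times> nat) \<times> ('v \<times> nat)) set \<Rightarrow> ('v \<times> nat) list \<Rightarrow> rat" where
  "word_sign \<beta> ord [] = 1"
| "word_sign \<beta> ord (x # v) = (\<Prod>y\<leftarrow>v. if (y, x) \<in> ord then \<beta> (fst x) (fst y) else 1) * word_sign \<beta> ord v"

lemma word_sign_swap:
  assumes "\<beta> (fst x) (fst y) = \<beta> (fst y) (fst x)" "\<beta> (fst x) (fst y) * \<beta> (fst x) (fst y) = 1"
    and "x = y \<Longrightarrow> \<beta> (fst x) (fst x) = 1"
    and "x \<noteq> y \<Longrightarrow> (x, y) \<in> ord \<longleftrightarrow> (y, x) \<notin> ord"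
  shows "word_sign \<beta> ord (u @ [x, y] @ v) = \<beta> (fst x) (fst y) * word_sign \<beta> ord (u @ [y, x] @ v)"
proof (induct u)
  case Nil
  have "\<beta> (fst x) (fst y) * (\<beta> (fst x) (fst y) * a) = a" for a
    using assms(2) by (simp add: mult.assoc[symmetric])
  then show ?case using assms by (auto simp: mult_ac)
qed (simp add: mult_ac)

lemma word_sign_nonzero: "(\<And>i j. \<beta> i j \<noteq> 0) \<Longrightarrow> word_sign \<beta> ord v \<noteq> 0"
  by (induct v) (auto simp: prod_list_zero_iff)

text \<open>The orbit sum of the monomial \<open>w\<close> when variables and labels are permuted
  together; each term carries one factor \<open>\<beta>\<close> per inversion.\<close>

definition rearrangement :: "('v \<Rightarrow> 'v \<Rightarrow> rat) \<Rightarrow> (('v \<times> nat) \<times> ('v \<times> nat)) set \<Rightarrow> ('v \<times> nat) list \<Rightarrow> ('v \<times> nat) list \<Rightarrow> rat" where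
  "rearrangement \<beta> ord w v = (if mset v = mset w then word_sign \<beta> ord v else 0)"

lemma sorted_lenlex_min:
  assumes "sorted_wrt (\<lambda>x y. x = y \<or> (x, y) \<in> ord) w" "mset v = mset w"
  shows "v = w \<or> (w, v) \<in> lenlex ord"
  using assms
proof (induct w arbitrary: v)
  case (Cons a w)
  then obtain b v' where v: "v = b # v'" by (cases v) auto
  have len: "length v' = length w" using mset_eq_length[OF Cons.prems(2)] v by simp
  show ?case
  proof (cases "b = a")
    case True
    then have "v' = w \<or> (w, v') \<in> lenlex ord" using Cons v by auto
    then show ?thesis using True v by (auto simp: Cons_lenlex_iff)
  next
    case False
    then have "b \<in> set w" using Cons.prems(2) v by (metis list.set_intros(1) mset_eq_setD set_ConsD)
    then have "(a, b) \<in> ord" using Cons.prems(1) False by auto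
    then show ?thesis using v len by (simp add: Cons_lenlex_iff)
  qed
qed simp

lemma sorted_wrt_twice:
  assumes "sorted_wrt R w" "{#x, x#} \<subseteq># mset w"
  shows "R x x"
  using assms
proof (induct w)
  case (Cons a w)
  show ?case
  proof (cases "a = x")
    case True
    then have "{#x#} \<subseteq># mset w" using Cons.prems(2) by simp
    then show ?thesis using Cons.prems(1) True by simp
  next
    case False
    then have "{#x, x#} \<subseteq># mset w" using Cons.prems(2) by (simp add: insert_subset_eq_iff)
    then show ?thesis using Cons by simp
  qed
qed simp

text \<open>Exchanging equal letters does not change the word, so covariance forces
  \<open>\<beta>\<close> to be 1 at a repeated letter. Exchanging distinct neighbours changes the
  set of inversions by exactly one, which gives the factor \<open>\<beta>\<close> in either
  direction because its square is 1.\<close>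

lemma rearrangement_swap_covariant:
  assumes "\<And>i j. \<beta> i j = \<beta> j i" "\<And>i j. \<beta> i j * \<beta> i j = 1"
    and "\<And>x. {#x, x#} \<subseteq># mset w \<Longrightarrow> \<beta> (fst x) (fst x) = 1"
    and "\<And>x y. x \<in> set w \<Longrightarrow> y \<in> set w \<Longrightarrow> x \<noteq> y \<Longrightarrow> (x, y) \<in> ord \<longleftrightarrow> (y, x) \<notin> ord"
  shows "swap_covariant \<beta> (rearrangement \<beta> ord w)"
  unfolding swap_covariant_def
proof (intro allI)
  fix u v :: "('a \<times> nat) list" and x y
  show "rearrangement \<beta> ord w (u @ [x, y] @ v) = \<beta> (fst x) (fst y) * rearrangement \<beta> ord w (u @ [y, x] @ v)"
  proof (cases "mset (u @ [x, y] @ v) = mset w")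
    case True
    have xy: "{#x, y#} \<subseteq># mset w" unfolding True[symmetric] by simp
    have "set w = set (u @ [x, y] @ v)" using True by (metis set_mset_mset)
    then have "x \<in> set w" "y \<in> set w" by auto
    then have "word_sign \<beta> ord (u @ [x, y] @ v) = \<beta> (fst x) (fst y) * word_sign \<beta> ord (u @ [y, x] @ v)"
      using xy by (intro word_sign_swap assms(1) assms(2) assms(4)) (auto intro: assms(3))
    moreover have "mset (u @ [y, x] @ v) = mset w" unfolding True[symmetric] by simp
    ultimately show ?thesis unfolding rearrangement_def using True by simp
  next
    case False
    moreover have "mset (u @ [y, x] @ v) \<noteq> mset w" using False by (simp add: add_mset_commute)
    ultimately show ?thesis unfolding rearrangement_def by (simp only: if_False mult_zero_right)
  qed
qed

text \<open>On the labels of \<open>w\<close>, at most a zero of order one is required, and only for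
  two equal labels with sign -1. There the substitution of \<open>K - k\<close> for \<open>k\<close>
  turns the sum into its negative. If no word of the sum rearranges \<open>w\<close>, every term is
  zero.\<close>

lemma rearrangement_kills_binomial_sums:
  assumes swap_covariant: "swap_covariant \<beta> (rearrangement \<beta> ord w)"
    and "\<And>i j. {#i, j#} \<subseteq># image_mset fst (mset w) \<Longrightarrow> M i j = 0 \<or> i = j \<and> M i i = 1 \<and> \<beta> i i = -1"
  shows "kills_binomial_sums M (rearrangement \<beta> ord w)"
  unfolding kills_binomial_sums_def
proof (intro allI impI)
  fix u v :: "('a \<times> nat) list" and i j K q
  assume q: "q < M i j"
  show "(\<Sum>k\<le>K. of_nat (k choose q) * rearrangement \<beta> ord w (u @ [(i, K - k), (j, k)] @ v)) = 0"
  proof (cases "\<exists>k. mset (u @ [(i, K - k), (j, k)] @ v) = mset w")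
    case True
    then obtain k where k: "mset (u @ [(i, K - k), (j, k)] @ v) = mset w" by blast
    have "{#i, j#} \<subseteq># image_mset fst (mset w)" unfolding k[symmetric] by simp
    then have ij: "i = j" "q = 0" "\<beta> i i = -1" using assms(2) q by fastforce+
    have c: "rearrangement \<beta> ord w (u @ [(i, K - k), (i, k)] @ v) = - rearrangement \<beta> ord w (u @ [(i, k), (i, K - k)] @ v)" for k
      using swap_covariantD[OF swap_covariant, of u "(i, K - k)" "(i, k)" v] ij(3) by simp
    have "(\<Sum>k\<le>K. rearrangement \<beta> ord w (u @ [(i, K - k), (i, k)] @ v)) =
      (\<Sum>k\<le>K. - rearrangement \<beta> ord w (u @ [(i, k), (i, K - k)] @ v))"
      by (intro sum.cong refl c)
    also have "\<dots> = (\<Sum>k\<le>K. - rearrangement \<beta> ord w (u @ [(i, K - k), (i, k)] @ v))"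
      by (rule sum.reindex_bij_witness[of _ "\<lambda>k. K - k" "\<lambda>k. K - k"]) auto
    finally show ?thesis unfolding ij(1)[symmetric] ij(2) by (simp add: sum_negf)
  qed (auto simp: rearrangement_def intro!: sum.neutral)
qed

definition normal_pair :: "('v \<Rightarrow> 'v \<Rightarrow> nat) \<Rightarrow> ('v \<times> 'v) set \<Rightarrow> 'v \<times> nat \<Rightarrow> 'v \<times> nat \<Rightarrow> bool" where
  "normal_pair m r x y \<longleftrightarrow> snd x + m (fst x) (fst y) +
     (if fst x \<noteq> fst y \<and> (fst y, fst x) \<in> r then 1 else 0) \<le> snd y"

lemma gen_order_trans: "linear_order_on V r \<Longrightarrow> trans (gen_order r)"
  unfolding order_on_defs trans_def antisym_def gen_order_def by simp (metis order.strict_trans)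

lemma gen_order_total:
  "linear_order_on V r \<Longrightarrow> x \<in> V \<times> UNIV \<Longrightarrow> y \<in> V \<times> UNIV \<Longrightarrow> x \<noteq> y \<Longrightarrow> (x, y) \<in> gen_order r \<longleftrightarrow> (y, x) \<notin> gen_order r"
  unfolding order_on_defs total_on_def antisym_def gen_order_def by (cases x; cases y) auto

text \<open>
  The functional is the \<open>N\<close>-th power of the Vandermonde determinant times the signed symmetrization of
  a monomial. Lowering position \<open>s\<close> of \<open>w\<close> by \<open>N * s\<close> removes the lowest monomial of that power and
  leaves a sorted word.
\<close>

theorem functional_exists:
  assumes r: "linear_order_on V r" and w: "set w \<subseteq> V \<times> UNIV"
    and ok: "successively (normal_pair m r) w"
    and N: "\<And>i j. {#i, j#} \<subseteq># image_mset fst (mset w) \<Longrightarrow> m i j = N \<or> i = j \<and> m i i = Suc N"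
  shows "\<exists>\<phi>. least_in_support (gen_order r) \<phi> w \<and> swap_covariant (\<lambda>i j. (-1) ^ (m i i * m j j)) \<phi> \<and> kills_binomial_sums m \<phi>"
proof -
  define \<rho> where "\<rho> = (\<lambda>s. N * s)"
  define w' where "w' = lower \<rho> 0 w"
  define R where "R = (\<lambda>x y :: 'a \<times> nat. (x, y) \<in> gen_order r \<or> x = y \<and> m (fst x) (fst x) = N)"
  \<comment> \<open>Each of the \<open>N\<close> Vandermonde factors will contribute -1; the
    exponent \<open>N\<close> compensates this in advance.\<close>
  define \<beta> :: "'a \<Rightarrow> 'a \<Rightarrow> rat" where "\<beta> = (\<lambda>i j. (-1) ^ (m i i * m j j + N))"
  \<comment> \<open>A normal step gains at least \<open>N\<close>, so position \<open>n\<close>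
    carries at least \<open>N * n\<close>. After lowering, neighbours can have equal exponents only
    if their multiplicity is \<open>N\<close> and the order of the labels does not require the extra
    unit.\<close>
  have *: "lowerable \<rho> n w \<and> successively R (lower \<rho> n w)"
    if "w \<noteq> [] \<Longrightarrow> \<rho> n \<le> snd (hd w)" "successively (normal_pair m r) w" "set w \<subseteq> V \<times> UNIV"
      "\<And>i j. {#i, j#} \<subseteq># image_mset fst (mset w) \<Longrightarrow> m i j = N \<or> i = j \<and> m i i = Suc N" for n w
    using that
  proof (induct w arbitrary: n)
    case (Cons x w)
    show ?case
    proof (cases w)
      case Nil
      then show ?thesis using Cons.prems(1) by simp
    next
      case w: (Cons y w')
      have m: "m (fst x) (fst y) = N \<or> fst x = fst y \<and> m (fst x) (fst x) = Suc N"
        by (rule Cons.prems(4)) (simp add: w)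
      have ok: "normal_pair m r x y" and n: "\<rho> n \<le> snd x" using Cons.prems(1,2) w by auto
      have "\<rho> (Suc n) \<le> snd y" using ok n m by (auto simp: normal_pair_def \<rho>_def split: if_splits)
      moreover have "m i j = N \<or> i = j \<and> m i i = Suc N" if "{#i, j#} \<subseteq># image_mset fst (mset w)" for i j
        by (rule Cons.prems(4)) (use subset_mset.order_trans[OF that, of "image_mset fst (mset (x # w))"] in simp)
      ultimately have "lowerable \<rho> (Suc n) w \<and> successively R (lower \<rho> (Suc n) w)"
        using Cons.prems w by (intro Cons.hyps) auto
      moreover have "R (fst x, snd x - \<rho> n) (fst y, snd y - \<rho> (Suc n))"
      proof (cases "snd x - \<rho> n < snd y - \<rho> (Suc n)")
        case False
        then have eq: "snd x - \<rho> n = snd y - \<rho> (Suc n)" "m (fst x) (fst y) = N" "\<not> (fst x \<noteq> fst y \<and> (fst y, fst x) \<in> r)"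
          using ok n m by (auto simp: normal_pair_def \<rho>_def split: if_splits)
        moreover have "fst x \<in> V" "fst y \<in> V" using Cons.prems(3) w by auto
        ultimately show ?thesis
          using r unfolding R_def gen_order_def order_on_defs total_on_def by (cases "fst x = fst y") auto
      qed (simp add: R_def gen_order_def)
      ultimately show ?thesis using n w by simp
    qed
  qed simp
  have w'ok: "lowerable \<rho> 0 w" and "successively R w'"
    using *[of w 0] w ok N unfolding w'_def \<rho>_def by auto
  moreover have "transp R"
    using gen_order_trans[OF r] unfolding R_def transp_def trans_def by blast
  ultimately have R: "sorted_wrt R w'" by (simp add: successively_conv_sorted_wrt)
  have labels: "map fst (lower \<rho> n w) = map fst w" for n and w :: "('a \<times> nat) list" by (induct w arbitrary: n) auto
  have lab: "image_mset fst (mset w') = image_mset fst (mset w)"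
    by (simp add: w'_def labels flip: mset_map)
  have "set (map fst w') = set (map fst w)" unfolding w'_def labels ..
  then have "fst ` set w' = fst ` set w" by simp
  then have w'V: "set w' \<subseteq> V \<times> UNIV" using w by (force simp: mem_Times_iff)
  have swap_covariant: "swap_covariant \<beta> (rearrangement \<beta> (gen_order r) w')"
  proof (rule rearrangement_swap_covariant)
    show "\<beta> (fst x) (fst x) = 1" if "{#x, x#} \<subseteq># mset w'" for x
    proof -
      have "m (fst x) (fst x) = N"
        using sorted_wrt_twice[OF R that] gen_order_irrefl[of x r] by (auto simp: R_def)
      then show ?thesis by (simp add: \<beta>_def)
    qed
    show "(x, y) \<in> gen_order r \<longleftrightarrow> (y, x) \<notin> gen_order r" if "x \<in> set w'" "y \<in> set w'" "x \<noteq> y" for x y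
      using gen_order_total[OF r _ _ that(3)] that w'V by blast
  qed (auto simp: \<beta>_def mult.commute simp flip: power_mult_distrib)
  \<comment> \<open>On the labels of \<open>w\<close> the truncated difference is 0 or 1: the order
    of vanishing that the \<open>N\<close> Vandermonde factors leave to be supplied.\<close>
  have kills_binomial_sums: "kills_binomial_sums (\<lambda>i j. m i j - N) (rearrangement \<beta> (gen_order r) w')"
  proof (rule rearrangement_kills_binomial_sums[OF swap_covariant])
    fix i j assume "{#i, j#} \<subseteq># image_mset fst (mset w')"
    then have "m i j = N \<or> i = j \<and> m i i = Suc N" using N lab by simp
    then show "m i j - N = 0 \<or> i = j \<and> m i i - N = 1 \<and> \<beta> i i = -1" by (auto simp: \<beta>_def)
  qed
  have "sorted_wrt (\<lambda>x y. x = y \<or> (x, y) \<in> gen_order r) w'"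
    by (rule sorted_wrt_mono_rel[OF _ R]) (auto simp: R_def)
  then have least_in_support: "least_in_support (gen_order r) (rearrangement \<beta> (gen_order r) w') w'"
    unfolding least_in_support_def using word_sign_nonzero[of \<beta> "gen_order r" w'] sorted_lenlex_min
    by (auto simp: rearrangement_def \<beta>_def dest: mset_eq_length)
  have "least_in_support (gen_order r) ((vandermonde ^^ n) (rearrangement \<beta> (gen_order r) w')) ((raise_word (\<lambda>s. s) 0 ^^ n) w') \<and>
    swap_covariant (\<lambda>i j. (-1) ^ n * \<beta> i j) ((vandermonde ^^ n) (rearrangement \<beta> (gen_order r) w')) \<and>
    kills_binomial_sums (\<lambda>i j. m i j - N + n) ((vandermonde ^^ n) (rearrangement \<beta> (gen_order r) w'))" for n
  proof (induct n)
    case (Suc n)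
    then show ?case using vandermonde_least_in_support vandermonde_swap_covariant vandermonde_kills_binomial_sums by fastforce
  qed (use least_in_support swap_covariant kills_binomial_sums in simp)
  \<comment> \<open>Whatever the truncation does, \<open>m i j - N + N\<close> is at least
    \<open>m i j\<close>, and vanishing of all orders below the larger number includes those below
    the smaller.\<close>
  from this[of N] have "least_in_support (gen_order r) ((vandermonde ^^ N) (rearrangement \<beta> (gen_order r) w')) w"
    "swap_covariant (\<lambda>i j. (-1) ^ (m i i * m j j)) ((vandermonde ^^ N) (rearrangement \<beta> (gen_order r) w'))"
    "kills_binomial_sums m ((vandermonde ^^ N) (rearrangement \<beta> (gen_order r) w'))"
    using w'ok unfolding raise_word_funpow w'_def \<rho>_def
    by (auto simp: raise_word_lower \<beta>_def power_add kills_binomial_sums_def algebra_simps simp flip: power_mult_distrib)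
  then show ?thesis by blast
qed

section \<open>Relations of a quiver algebra\<close>

text \<open>One more linear factor raises the top binomial coefficient by one: \<open>(b - a) * (b
  choose q) = (q + 1) * (b choose (q + 1)) + (q - a) * (b choose q)\<close>. This turns the binomial
  relations into relations whose coefficients are polynomials with prescribed zeros.\<close>

lemma prod_binomial_comb:
  assumes "finite A"
  shows "\<exists>\<gamma>. \<forall>b. (\<Prod>a\<in>A. rat_of_nat b - rat_of_nat a) = (\<Sum>q\<le>card A. \<gamma> q * of_nat (b choose q))"
  using assms
proof (induct A rule: finite_induct)
  case empty
  show ?case by (auto intro: exI[of _ "\<lambda>_. 1"])
next
  case (insert a A)
  then obtain \<gamma> where \<gamma>: "\<And>b. (\<Prod>a\<in>A. rat_of_nat b - rat_of_nat a) = (\<Sum>q\<le>card A. \<gamma> q * of_nat (b choose q))"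
    by blast
  define \<gamma>' where "\<gamma>' q = (case q of 0 \<Rightarrow> 0 | Suc p \<Rightarrow> \<gamma> p * of_nat (Suc p)) +
    (if q \<le> card A then \<gamma> q * (of_nat q - of_nat a) else 0)" for q
  have mul: "(rat_of_nat b - of_nat a) * of_nat (b choose q) =
      of_nat (Suc q) * of_nat (b choose Suc q) + (of_nat q - of_nat a) * of_nat (b choose q)" for b q
  proof -
    have "Suc q * (b choose Suc q) + q * (b choose q) = b * (b choose q)"
    proof (cases "q \<le> b")
      case True
      have "Suc q * (b choose Suc q) = (b - q) * (b choose q)"
        by (metis binomial_absorb_comp binomial_absorption mult.commute)
      then show ?thesis using True by (simp add: diff_mult_distrib)
    qed (simp add: binomial_eq_0)
    then have "rat_of_nat (Suc q * (b choose Suc q) + q * (b choose q)) = of_nat (b * (b choose q))" by simp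
    then show ?thesis by (simp add: algebra_simps)
  qed
  have "(\<Prod>c\<in>insert a A. rat_of_nat b - rat_of_nat c) = (\<Sum>q\<le>card (insert a A). \<gamma>' q * of_nat (b choose q))" for b
  proof -
    have "(\<Prod>c\<in>insert a A. rat_of_nat b - rat_of_nat c) =
        (\<Sum>q\<le>card A. \<gamma> q * ((rat_of_nat b - of_nat a) * of_nat (b choose q)))"
      using insert.hyps by (simp add: \<gamma> sum_distrib_left mult.left_commute)
    also have "\<dots> = (\<Sum>q\<le>card A. \<gamma> q * of_nat (Suc q) * of_nat (b choose Suc q)) +
        (\<Sum>q\<le>card A. \<gamma> q * (of_nat q - of_nat a) * of_nat (b choose q))"
      unfolding mul sum.distrib[symmetric] by (rule sum.cong) (simp_all add: algebra_simps)
    also have "\<dots> = (\<Sum>q\<le>Suc (card A). \<gamma>' q * of_nat (b choose q))"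
    proof -
      have "(\<Sum>q\<le>Suc (card A). (case q of 0 \<Rightarrow> 0 | Suc p \<Rightarrow> \<gamma> p * of_nat (Suc p)) * of_nat (b choose q)) =
         (\<Sum>q\<le>card A. \<gamma> q * of_nat (Suc q) * of_nat (b choose Suc q))"
        by (subst sum.atMost_Suc_shift) simp
      then show ?thesis
        by (simp add: \<gamma>'_def distrib_right sum.distrib)
    qed
    finally show ?thesis using insert.hyps by simp
  qed
  then show ?case by blast
qed

text \<open>
  Interpolation: some polynomial of degree less than \<open>m\<close> vanishes at all but one of the points where
  \<open>g\<close> is not known to lie in \<open>S\<close>.
\<close>

lemma binomial_line:
  assumes S: "pm.subspace S"
    and rel: "\<And>q. q < m \<Longrightarrow> (\<Sum>b\<le>M. scale_pm (of_nat (b choose q)) (g b)) \<in> S"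
    and card: "card {b. b \<le> M \<and> g b \<notin> S} \<le> m" and b: "b \<le> M"
  shows "g b \<in> S"
proof (rule ccontr)
  assume gb: "g b \<notin> S"
  \<comment> \<open>The roots omit \<open>b\<close> itself: this brings the degree below
    \<open>m\<close> and keeps the coefficient at \<open>b\<close> nonzero.\<close>
  define A where "A = {b. b \<le> M \<and> g b \<notin> S} - {b}"
  have A: "finite A" by (simp add: A_def)
  have "card A < m"
    using card gb b card_Diff1_less[of "{b. b \<le> M \<and> g b \<notin> S}" b] by (simp add: A_def)
  obtain \<gamma> where \<gamma>: "\<And>b. (\<Prod>a\<in>A. rat_of_nat b - rat_of_nat a) = (\<Sum>q\<le>card A. \<gamma> q * of_nat (b choose q))"
    using prod_binomial_comb[OF A] by blast
  let ?f = "\<lambda>c. \<Prod>a\<in>A. rat_of_nat c - rat_of_nat a"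
  have "(\<Sum>q\<le>card A. scale_pm (\<gamma> q) (\<Sum>b\<le>M. scale_pm (of_nat (b choose q)) (g b))) \<in> S"
    using \<open>card A < m\<close> by (intro pm.subspace_sum[OF S] pm.subspace_scale[OF S] rel) simp
  also have "(\<Sum>q\<le>card A. scale_pm (\<gamma> q) (\<Sum>b\<le>M. scale_pm (of_nat (b choose q)) (g b))) = (\<Sum>c\<le>M. scale_pm (?f c) (g c))"
    unfolding \<gamma> pm.scale_sum_right pm.scale_sum_left by (subst sum.swap) simp
  also have "\<dots> = scale_pm (?f b) (g b) + (\<Sum>c\<in>{..M} - {b}. scale_pm (?f c) (g c))"
    using b by (intro sum.remove) auto
  finally have 1: "scale_pm (?f b) (g b) + (\<Sum>c\<in>{..M} - {b}. scale_pm (?f c) (g c)) \<in> S" .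
  have "scale_pm (?f c) (g c) \<in> S" if "c \<in> {..M} - {b}" for c
  proof (cases "g c \<in> S")
    case False
    then have "c \<in> A" using that by (simp add: A_def)
    then have "?f c = 0" using A by (auto simp: prod_zero_iff)
    then show ?thesis using pm.subspace_0[OF S] by simp
  qed (rule pm.subspace_scale[OF S])
  then have 2: "(\<Sum>c\<in>{..M} - {b}. scale_pm (?f c) (g c)) \<in> S" by (rule pm.subspace_sum[OF S])
  have "scale_pm (?f b) (g b) \<in> S" using pm.subspace_diff[OF S 1 2] by simp
  then have "scale_pm (inverse (?f b)) (scale_pm (?f b) (g b)) \<in> S" by (rule pm.subspace_scale[OF S])
  moreover have "?f b \<noteq> 0" using A by (auto simp: prod_zero_iff A_def)
  ultimately show False using gb by simp
qed

section \<open>The defining relations and their multiples by words\<close>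

lemma neg_one_power_mult: "(-1) ^ n * (f :: 'x list \<Rightarrow>\<^sub>0 rat) = scale_pm ((-1) ^ n) f"
  by (cases "even n") (auto simp: poly_mapping_eqI)

lemma of_nat_mult_scale_pm: "of_nat n * (f :: 'x list \<Rightarrow>\<^sub>0 rat) = scale_pm (of_nat n) f"
  by (simp add: scale_pm_conv_mult)

lemma sum_pairs: "(\<Sum>(k1, k2) | k1 + k2 = (K::nat). g k1 k2) = (\<Sum>k\<le>K. g (K - k) k)"
  by (rule sum.reindex_bij_witness[of _ "\<lambda>k. (K - k, k)" snd]) auto

lemma quiver_rels_eq:
  "quiver_rels Q =
    {mon [x, y] - scale_pm ((-1) ^ (arrows Q (fst x) (fst x) * arrows Q (fst y) (fst y))) (mon [y, x])
      | x y. x \<in> quiver_gens Q \<and> y \<in> quiver_gens Q} \<union>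
    {(\<Sum>k\<le>K. scale_pm (of_nat (k choose q)) (mon [(i, K - k), (j, k)]))
      | i j K q. i \<in> verts Q \<and> j \<in> verts Q \<and> q < arrows Q i j}"
  unfolding quiver_rels_def letter_def quiver_gens_def sum_pairs neg_one_power_mult of_nat_mult_scale_pm mon_mult_mon
  by fastforce

lemma quiver_rels_cases:
  assumes "f \<in> quiver_rels Q"
  obtains x y where "x \<in> quiver_gens Q" "y \<in> quiver_gens Q"
    "f = mon [x, y] - scale_pm ((-1) ^ (arrows Q (fst x) (fst x) * arrows Q (fst y) (fst y))) (mon [y, x])"
  | i j K q where "i \<in> verts Q" "j \<in> verts Q" "q < arrows Q i j"
    "f = (\<Sum>k\<le>K. scale_pm (of_nat (k choose q)) (mon [(i, K - k), (j, k)]))"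
  using assms unfolding quiver_rels_eq by blast

lemma homogeneous_iff: "homogeneous d f \<longleftrightarrow> f \<in> {f. keys f \<subseteq> {w. length w = d}}"
  by (auto simp: homogeneous_def)

lemma subspace_homogeneous: "pm.subspace {f. homogeneous d f}"
  unfolding homogeneous_iff using subspace_keys by simp

lemma quiver_rels_homogeneous: "f \<in> quiver_rels Q \<Longrightarrow> homogeneous 2 f"
proof -
  assume f: "f \<in> quiver_rels Q"
  have m: "mon [x, y] \<in> {f. homogeneous 2 f}" for x y :: "'a \<times> nat" by (simp add: homogeneous_def)
  note sub = subspace_homogeneous[of 2, where 'a = "'a \<times> nat"]
  from f have "f \<in> {f. homogeneous 2 f}"
  proof (cases rule: quiver_rels_cases)
    case (1 x y)
    show ?thesis unfolding 1(3) by (intro pm.subspace_diff[OF sub] pm.subspace_scale[OF sub] m)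
  next
    case (2 i j K q)
    show ?thesis unfolding 2(4) by (intro pm.subspace_sum[OF sub] pm.subspace_scale[OF sub] m)
  qed
  then show ?thesis by simp
qed

lemma quiver_rels_carrier: "quiver_rels Q \<subseteq> carrier (free_alg (quiver_gens Q))"
proof
  fix f assume f: "f \<in> quiver_rels Q"
  have 1: "mon [x, y] \<in> carrier (free_alg (quiver_gens Q))" if "x \<in> quiver_gens Q" "y \<in> quiver_gens Q" for x y
    using that by simp
  have 2: "(i, k) \<in> quiver_gens Q" if "i \<in> verts Q" for i k using that by (simp add: quiver_gens_def)
  show "f \<in> carrier (free_alg (quiver_gens Q))"
    using f by (cases rule: quiver_rels_cases)
      (auto simp only: intro!: pm.subspace_diff[OF subspace_carrier] pm.subspace_sum[OF subspace_carrier]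
        pm.subspace_scale[OF subspace_carrier] 1 2)
qed

lemmas quiver_ideal = free_alg_Idl[OF quiver_rels_carrier, folded quiver_ideal_def]

lemma quiver_ideal_comm:
  assumes "set u \<subseteq> quiver_gens Q" "set v \<subseteq> quiver_gens Q" "x \<in> quiver_gens Q" "y \<in> quiver_gens Q"
  shows "mon (u @ [x, y] @ v) - scale_pm ((-1) ^ (arrows Q (fst x) (fst x) * arrows Q (fst y) (fst y))) (mon (u @ [y, x] @ v))
    \<in> quiver_ideal Q"
proof -
  let ?c = "(-1) ^ (arrows Q (fst x) (fst x) * arrows Q (fst y) (fst y)) :: rat"
  have "mon [x, y] - scale_pm ?c (mon [y, x]) \<in> quiver_ideal Q"
    using quiver_ideal(2)[of Q] assms unfolding quiver_rels_eq by blast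
  from ideal_mon_mult[OF quiver_ideal(1) this assms(1,2)]
  have "mon u * (mon [x, y] - scale_pm ?c (mon [y, x])) * mon v \<in> quiver_ideal Q" .
  also have "mon u * (mon [x, y] - scale_pm ?c (mon [y, x])) * mon v = mon (u @ [x, y] @ v) - scale_pm ?c (mon (u @ [y, x] @ v))"
    unfolding left_diff_distrib right_diff_distrib scale_pm_mult_left scale_pm_mult_right mon_mult_mon by simp
  finally show ?thesis .
qed

lemma quiver_ideal_line:
  assumes "set u \<subseteq> quiver_gens Q" "set v \<subseteq> quiver_gens Q" "i \<in> verts Q" "j \<in> verts Q" "q < arrows Q i j"
  shows "(\<Sum>k\<le>K. scale_pm (of_nat (k choose q)) (mon (u @ [(i, K - k), (j, k)] @ v))) \<in> quiver_ideal Q"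
proof -
  have "(\<Sum>k\<le>K. scale_pm (of_nat (k choose q)) (mon [(i, K - k), (j, k)])) \<in> quiver_ideal Q"
    using quiver_ideal(2)[of Q] assms unfolding quiver_rels_eq by blast
  from ideal_mon_mult[OF quiver_ideal(1) this assms(1,2)]
  have "mon u * (\<Sum>k\<le>K. scale_pm (of_nat (k choose q)) (mon [(i, K - k), (j, k)])) * mon v \<in> quiver_ideal Q" .
  also have "mon u * (\<Sum>k\<le>K. scale_pm (of_nat (k choose q)) (mon [(i, K - k), (j, k)])) * mon v =
     (\<Sum>k\<le>K. scale_pm (of_nat (k choose q)) (mon (u @ [(i, K - k), (j, k)] @ v)))"
    unfolding sum_distrib_left sum_distrib_right scale_pm_mult_left scale_pm_mult_right mon_mult_mon by simp
  finally show ?thesis .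
qed

lemma subspace_mon_swap:
  assumes "pm.subspace S" "quiver_ideal Q \<subseteq> S"
    and "set u \<subseteq> quiver_gens Q" "set v \<subseteq> quiver_gens Q" "x \<in> quiver_gens Q" "y \<in> quiver_gens Q"
    and "mon (u @ [y, x] @ v) \<in> S"
  shows "mon (u @ [x, y] @ v) \<in> S"
  using pm.subspace_add[OF assms(1) subsetD[OF assms(2) quiver_ideal_comm[OF assms(3-6)]]
    pm.subspace_scale[OF assms(1,7), of "(-1) ^ (arrows Q (fst x) (fst x) * arrows Q (fst y) (fst y))"]]
  by simp

section \<open>Words in graded lexicographic order\<close>

lemma lenlex_total_lists:
  assumes "\<And>x y. x \<in> X \<Longrightarrow> y \<in> X \<Longrightarrow> x \<noteq> y \<Longrightarrow> (x, y) \<in> ord \<or> (y, x) \<in> ord"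
    and "set v \<subseteq> X" "set w \<subseteq> X" "v \<noteq> w"
  shows "(v, w) \<in> lenlex ord \<or> (w, v) \<in> lenlex ord"
proof (cases "length v = length w")
  case True
  then show ?thesis using assms(2-)
  proof (induct v w rule: list_induct2)
    case (Cons x xs y ys)
    then show ?case using assms(1)[of x y] by (cases "x = y") (auto simp: Cons_lenlex_iff)
  qed simp
next
  case False
  then show ?thesis by (auto simp: lenlex_conv)
qed

lemma finite_has_lenlex_max:
  assumes "\<And>x y. x \<in> X \<Longrightarrow> y \<in> X \<Longrightarrow> x \<noteq> y \<Longrightarrow> (x, y) \<in> ord \<or> (y, x) \<in> ord" "trans ord"
    and "finite A" "A \<noteq> {}" "\<And>w. w \<in> A \<Longrightarrow> set w \<subseteq> X"
  shows "\<exists>w\<in>A. \<forall>v\<in>A - {w}. (v, w) \<in> lenlex ord"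
  using assms(3-)
proof (induct A rule: finite_ne_induct)
  case (insert a A)
  then obtain w where w: "w \<in> A" "\<forall>v\<in>A - {w}. (v, w) \<in> lenlex ord" by auto
  then have "(a, w) \<in> lenlex ord \<or> (w, a) \<in> lenlex ord"
    using insert by (intro lenlex_total_lists[OF assms(1)]) auto
  then show ?case
  proof
    assume "(w, a) \<in> lenlex ord"
    then have "\<forall>v\<in>A. (v, a) \<in> lenlex ord" using w lenlex_transI[OF assms(2)] by (metis Diff_iff singletonD transD)
    then show ?thesis by blast
  qed (use w in blast)
qed simp

lemma leading_monomial_exists:
  assumes "\<And>x y. x \<in> X \<Longrightarrow> y \<in> X \<Longrightarrow> x \<noteq> y \<Longrightarrow> (x, y) \<in> ord \<or> (y, x) \<in> ord" "trans ord"
    and "f \<in> carrier (free_alg X)" "f \<noteq> 0"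
  shows "\<exists>w. is_leading_monomial ord f w"
  using finite_has_lenlex_max[OF assms(1,2), where A = "keys f"] assms(3,4)
  unfolding is_leading_monomial_def by (force simp: free_alg_def keys_eq_empty)

text \<open>Equal lengths make \<open>lenlex\<close> purely lexicographic, and the comparison is
  decided within \<open>v\<close> and \<open>w\<close>; the tails may therefore differ, as they do
  when bars are compared block by block.\<close>

lemma lenlex_append_same_length:
  assumes "length v = length w" "(v, w) \<in> lenlex ord" "length v' = length w'"
  shows "(u @ v @ v', u @ w @ w') \<in> lenlex ord"
proof (induct u)
  case Nil
  from assms(1,2) show ?case
    by (induct v w rule: list_induct2) (use assms(3) in \<open>auto simp: Cons_lenlex_iff\<close>)
qed (simp add: Cons_lenlex_iff)

lemma not_successively_split: "\<not> successively P w \<Longrightarrow> \<exists>u x y v. w = u @ [x, y] @ v \<and> \<not> P x y"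
proof (induct P w rule: successively.induct)
  case (3 P x y xs)
  show ?case
  proof (cases "P x y")
    case True
    then obtain u a b v where "y # xs = u @ [a, b] @ v" "\<not> P a b" using 3 by auto
    then show ?thesis by (metis append_Cons)
  qed (metis append_Cons append_Nil)
qed auto

section \<open>Quadratic Groebner bases of quiver algebras\<close>

lemma functional_kills_ideal:
  assumes "swap_covariant (\<lambda>i j. (-1) ^ (arrows Q i i * arrows Q j j)) \<phi>" "kills_binomial_sums (arrows Q) \<phi>" "f \<in> quiver_ideal Q"
  shows "ev \<phi> f = 0"
proof -
  have "Idl\<^bsub>free_alg (quiver_gens Q)\<^esub> (quiver_rels Q) \<subseteq> {f. ev \<phi> f = 0}"
  proof (rule Idl_subset_subspace[OF quiver_rels_carrier subspace_ev])
    fix u v f assume "f \<in> quiver_rels Q"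
    then show "mon u * f * mon v \<in> {f. ev \<phi> f = 0}"
    proof (cases rule: quiver_rels_cases)
      case (1 x y)
      have "ev \<phi> (mon u * f * mon v) = 0"
        unfolding 1 left_diff_distrib right_diff_distrib scale_pm_mult_left scale_pm_mult_right mon_mult_mon ev_diff ev_scale_pm
        using swap_covariantD[OF assms(1), of u x y v] by simp
      then show ?thesis by simp
    next
      case (2 i j K q)
      have "ev \<phi> (mon u * f * mon v) = 0"
        unfolding 2 sum_distrib_left sum_distrib_right scale_pm_mult_left scale_pm_mult_right mon_mult_mon ev_sum ev_scale_pm
          ev_single append_assoc mult_1_left
        by (rule kills_binomial_sumsD[OF assms(2) 2(3)])
      then show ?thesis by simp
    qed
  qed
  then show ?thesis using assms(3) unfolding quiver_ideal_def by blast
qed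

lemma asym_gen_order: "linear_order_on V r \<Longrightarrow> asym (gen_order r)"
  using gen_order_trans[of V r] gen_order_irrefl[of _ r] by (auto intro!: asymI dest: transD)

lemma asym_lenlex_gen: "linear_order_on V r \<Longrightarrow> (v, w) \<in> lenlex (gen_order r) \<Longrightarrow> (w, v) \<notin> lenlex (gen_order r)"
  using asym_lenlex[OF asym_gen_order] by (blast dest: asymD)

text \<open>Pairing \<open>f\<close> with the functional whose least word is \<open>w\<close> would
  leave just the nonzero term at \<open>w\<close>. The condition on multiplicities concerns only
  pairs of labels that occur together in \<open>w\<close>, with a loop condition only for a repeated
  label; thus it can be met by two-letter words in an arbitrary symmetric quiver.\<close>

lemma normal_not_leading:
  assumes r: "linear_order_on (verts Q) r" and w: "set w \<subseteq> quiver_gens Q" "successively (normal_pair (arrows Q) r) w"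
    and N: "\<And>i j. {#i, j#} \<subseteq># image_mset fst (mset w) \<Longrightarrow> arrows Q i j = N \<or> i = j \<and> arrows Q i i = Suc N"
    and f: "f \<in> quiver_ideal Q"
  shows "\<not> is_leading_monomial (gen_order r) f w"
proof
  assume lead: "is_leading_monomial (gen_order r) f w"
  obtain \<phi> where \<phi>: "least_in_support (gen_order r) \<phi> w" "swap_covariant (\<lambda>i j. (-1) ^ (arrows Q i i * arrows Q j j)) \<phi>" "kills_binomial_sums (arrows Q) \<phi>"
    using functional_exists[OF r, of w "arrows Q" N] w N unfolding quiver_gens_def by auto
  have "ev \<phi> f = (\<Sum>v\<in>{w}. lkp f v * \<phi> v)"
    unfolding ev_def
  proof (rule sum.mono_neutral_right)
    show "\<forall>v\<in>keys f - {w}. lkp f v * \<phi> v = 0"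
    proof
      fix v assume v: "v \<in> keys f - {w}"
      then have "(v, w) \<in> lenlex (gen_order r)" using lead by (simp add: is_leading_monomial_def)
      then have "\<phi> v = 0" using \<phi>(1) v asym_lenlex_gen[OF r] unfolding least_in_support_def by blast
      then show "lkp f v * \<phi> v = 0" by simp
    qed
  qed (use lead in \<open>auto simp: is_leading_monomial_def\<close>)
  then have "lkp f w * \<phi> w = 0" using functional_kills_ideal[OF \<phi>(2,3) f] by simp
  then show False using lead \<phi>(1) by (auto simp: is_leading_monomial_def least_in_support_def in_keys_iff)
qed

text \<open>Among the words \<open>(i, k + l - b) (j, b)\<close>, those with \<open>b > l\<close>
  are smaller than \<open>[x, y]\<close>, and those with \<open>b < k + e\<close> become smaller
  after exchanging the letters, where \<open>e\<close> is the tie-breaking unit. The remaining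
  \<open>b\<close> lie in \<open>{k + e..l}\<close>; their number is at most the multiplicity
  precisely because the pair is not normal. Interpolation then expresses \<open>[x, y]\<close> by
  smaller words.\<close>

lemma quadratic_leading:
  assumes gens: "x \<in> quiver_gens Q" "y \<in> quiver_gens Q" and nok: "\<not> normal_pair (arrows Q) r x y"
  shows "\<exists>g \<in> quiver_ideal Q. homogeneous 2 g \<and> is_leading_monomial (gen_order r) g [x, y]"
proof -
  obtain i k j l where xy: "x = (i, k)" "y = (j, l)" by fastforce
  have ij: "i \<in> verts Q" "j \<in> verts Q" using gens xy by (auto simp: quiver_gens_def)
  define L where "L = {h :: ('a \<times> nat) list \<Rightarrow>\<^sub>0 rat. keys h \<subseteq> {v. length v = 2 \<and> (v, [x, y]) \<in> lenlex (gen_order r)}}"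
  define S where "S = {a + b | a b. a \<in> quiver_ideal Q \<inter> {f. homogeneous 2 f} \<and> b \<in> L}"
  have sub: "pm.subspace (quiver_ideal Q \<inter> {f. homogeneous 2 f})" "pm.subspace L"
    unfolding L_def by (intro pm.subspace_inter ideal_subspace[OF quiver_ideal(1)] subspace_homogeneous subspace_keys)+
  have S: "pm.subspace S" unfolding S_def by (rule pm.subspace_sums[OF sub])
  have rels: "f \<in> S" if "f \<in> quiver_rels Q" for f
  proof -
    have "f + 0 \<in> S" unfolding S_def
      using that quiver_ideal(2)[of Q] quiver_rels_homogeneous[OF that] pm.subspace_0[OF sub(2)] by blast
    then show ?thesis by simp
  qed
  have small: "mon v \<in> S" if "length v = 2" "(v, [x, y]) \<in> lenlex (gen_order r)" for v
  proof -
    have "mon v \<in> L" using that by (simp add: L_def)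
    then have "0 + mon v \<in> S" unfolding S_def using pm.subspace_0[OF sub(1)] by blast
    then show ?thesis by simp
  qed
  define e :: nat where "e = (if i \<noteq> j \<and> (j, i) \<in> r then 1 else 0)"
  let ?g = "\<lambda>b. mon [(i, k + l - b), (j, b)]"
  have "{b. b \<le> k + l \<and> ?g b \<notin> S} \<subseteq> {k + e..l}"
  proof
    fix b assume "b \<in> {b. b \<le> k + l \<and> ?g b \<notin> S}"
    then have b: "b \<le> k + l" "?g b \<notin> S" by auto
    have "b \<le> l"
    proof (rule ccontr)
      assume "\<not> b \<le> l"
      then have "([(i, k + l - b), (j, b)], [x, y]) \<in> lenlex (gen_order r)"
        using b(1) by (simp add: xy Cons_lenlex_iff gen_order_def)
      then show False using b(2) small by simp
    qed
    moreover have "k + e \<le> b"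
    proof (rule ccontr)
      assume "\<not> k + e \<le> b"
      then have "([(j, b), (i, k + l - b)], [x, y]) \<in> lenlex (gen_order r)"
        by (auto simp: xy Cons_lenlex_iff gen_order_def e_def split: if_splits)
      then have s: "mon [(j, b), (i, k + l - b)] \<in> S" using small by simp
      let ?c = "(-1) ^ (arrows Q i i * arrows Q j j) :: rat"
      have "mon [(i, k + l - b), (j, b)] - scale_pm ?c (mon [(j, b), (i, k + l - b)]) \<in> quiver_rels Q"
        unfolding quiver_rels_eq using ij by (fastforce simp: quiver_gens_def)
      from pm.subspace_add[OF S rels[OF this] pm.subspace_scale[OF S s, of ?c]]
      have "?g b \<in> S" by simp
      then show False using b(2) by simp
    qed
    ultimately show "b \<in> {k + e..l}" by simp
  qed
  then have "card {b. b \<le> k + l \<and> ?g b \<notin> S} \<le> card {k + e..l}" by (intro card_mono) auto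
  also have "\<dots> \<le> arrows Q i j" using nok by (auto simp: normal_pair_def xy e_def split: if_splits)
  finally have card: "card {b. b \<le> k + l \<and> ?g b \<notin> S} \<le> arrows Q i j" .
  have "?g l \<in> S"
  proof (rule binomial_line[OF S _ card])
    show "(\<Sum>b\<le>k + l. scale_pm (of_nat (b choose q)) (mon [(i, k + l - b), (j, b)])) \<in> S" if "q < arrows Q i j" for q
      using that ij by (intro rels) (unfold quiver_rels_eq, blast)
  qed simp
  then obtain a b where ab: "mon [x, y] = a + b" "a \<in> quiver_ideal Q" "homogeneous 2 a" "b \<in> L"
    by (auto simp: S_def xy)
  have bk: "v \<in> keys b \<Longrightarrow> (v, [x, y]) \<in> lenlex (gen_order r)" for v using ab(4) by (auto simp: L_def)
  have "[x, y] \<notin> keys b" using bk lenlex_irreflexive[of "gen_order r"] gen_order_irrefl by blast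
  moreover have a: "a = mon [x, y] - b" using ab(1) by simp
  ultimately have "[x, y] \<in> keys a" by (simp add: in_keys_iff lookup_minus)
  moreover have "(v, [x, y]) \<in> lenlex (gen_order r)" if "v \<in> keys a - {[x, y]}" for v
    using that bk by (auto simp: a in_keys_iff lookup_minus lookup_single when_def split: if_splits)
  ultimately have "is_leading_monomial (gen_order r) a [x, y]" by (simp add: is_leading_monomial_def)
  then show ?thesis using ab by blast
qed

lemma quiver_leading_exists:
  assumes "linear_order_on (verts Q) r" "f \<in> quiver_ideal Q" "f \<noteq> 0"
  shows "\<exists>w. is_leading_monomial (gen_order r) f w \<and> set w \<subseteq> quiver_gens Q"
proof -
  have f: "f \<in> carrier (free_alg (quiver_gens Q))" using quiver_ideal(3) assms(2) by blast
  have "\<exists>w. is_leading_monomial (gen_order r) f w"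
  proof (rule leading_monomial_exists[OF _ gen_order_trans[OF assms(1)] f assms(3)])
    fix x y assume "x \<in> quiver_gens Q" "y \<in> quiver_gens Q" "x \<noteq> y"
    then show "(x, y) \<in> gen_order r \<or> (y, x) \<in> gen_order r"
      using gen_order_total[OF assms(1), of x y] unfolding quiver_gens_def by blast
  qed
  then show ?thesis using f by (force simp: is_leading_monomial_def free_alg_def)
qed

lemma almost_regular_labels:
  assumes N: "almost_regular N Q" and w: "set w \<subseteq> quiver_gens Q" and ij: "{#i, j#} \<subseteq># image_mset fst (mset w)"
  shows "arrows Q i j = N \<or> i = j \<and> arrows Q i i = Suc N"
proof -
  have "i \<in># image_mset fst (mset w)" "j \<in># image_mset fst (mset w)" using ij by (auto dest: mset_subset_eqD)
  then have "i \<in> verts Q" "j \<in> verts Q" using w by (auto simp: quiver_gens_def)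
  then show ?thesis using N by (cases "i = j") (auto simp: almost_regular_def)
qed

text \<open>All weight 2 elements of the ideal serve as the basis. A leading word is not normal,
  hence contains a pair that is not normal, and such a pair is the leading monomial of one of
  them.\<close>

lemma almost_regular_quadratic_GB:
  assumes r: "linear_order_on (verts Q) r" and N: "almost_regular N Q"
  shows "has_quadratic_groebner_basis (gen_order r) (quiver_ideal Q)"
  unfolding has_quadratic_groebner_basis_def groebner_basis_def
proof (intro exI conjI ballI impI)
  let ?G = "{g \<in> quiver_ideal Q. homogeneous 2 g}"
  show "?G \<subseteq> quiver_ideal Q" by blast
  show "homogeneous 2 g" if "g \<in> ?G" for g using that by blast
  fix f assume f: "f \<in> quiver_ideal Q" "f \<noteq> 0"
  obtain w where w: "is_leading_monomial (gen_order r) f w" "set w \<subseteq> quiver_gens Q"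
    using quiver_leading_exists[OF r f] by blast
  have "\<not> successively (normal_pair (arrows Q) r) w"
    using normal_not_leading[OF r w(2) _ almost_regular_labels[OF N w(2)] f(1)] w(1) by blast
  then obtain u x y v where uv: "w = u @ [x, y] @ v" "\<not> normal_pair (arrows Q) r x y"
    using not_successively_split by blast
  then obtain g where "g \<in> ?G" "is_leading_monomial (gen_order r) g [x, y]"
    using quadratic_leading[of x Q y r] w(2) by auto
  moreover have "sublist [x, y] w" using uv by (auto simp: sublist_def)
  ultimately show "\<exists>g\<in>?G. \<exists>v w. is_leading_monomial (gen_order r) g v \<and> is_leading_monomial (gen_order r) f w \<and> sublist v w"
    using w(1) by blast
qed

text \<open>The leading pair of some basis element would occur inside \<open>w\<close> and hence be
  normal. This contradicts \<open>normal_not_leading\<close> with \<open>N\<close> the multiplicity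
  of the two labels of that pair; symmetry ensures that both orders of the labels give the same
  \<open>N\<close>.\<close>

lemma GB_normal_not_leading:
  assumes r: "linear_order_on (verts Q) r" and GB: "has_quadratic_groebner_basis (gen_order r) (quiver_ideal Q)"
    and sym: "symmetric_quiver Q" and w: "set w \<subseteq> quiver_gens Q" "successively (normal_pair (arrows Q) r) w"
    and f: "f \<in> quiver_ideal Q"
  shows "\<not> is_leading_monomial (gen_order r) f w"
proof
  assume lead: "is_leading_monomial (gen_order r) f w"
  then have "f \<noteq> 0" by (auto simp: is_leading_monomial_def)
  then obtain g v w' where g: "g \<in> quiver_ideal Q" "homogeneous 2 g" "is_leading_monomial (gen_order r) g v"
      "is_leading_monomial (gen_order r) f w'" "sublist v w'"
    using GB f unfolding has_quadratic_groebner_basis_def groebner_basis_def by blast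
  have "w' = w"
    using lead g(4) asym_lenlex_gen[OF r] unfolding is_leading_monomial_def by blast
  have "length v = 2" using g(2,3) by (auto simp: homogeneous_def is_leading_monomial_def)
  then obtain x y where v: "v = [x, y]" by (auto simp: numeral_2_eq_2 length_Suc_conv)
  obtain u t where "w = u @ v @ t" using g(5) \<open>w' = w\<close> by (auto simp: sublist_def)
  then have ok: "set [x, y] \<subseteq> quiver_gens Q" "successively (normal_pair (arrows Q) r) [x, y]"
    using w v by (auto simp: successively_append_iff)
  have "arrows Q (fst y) (fst x) = arrows Q (fst x) (fst y)"
    using sym ok(1) by (auto simp: symmetric_quiver_def quiver_gens_def)
  then have "arrows Q i j = arrows Q (fst x) (fst y)" if "{#i, j#} \<subseteq># image_mset fst (mset [x, y])" for i j
    using that by (auto simp: insert_subset_eq_iff split: if_splits)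
  then have "\<not> is_leading_monomial (gen_order r) g [x, y]"
    by (intro normal_not_leading[OF r ok _ g(1)]) blast
  then show False using g(3) v by simp
qed

text \<open>A linear relation modulo the ideal among normal words would have a normal leading
  monomial. So the words of \<open>W\<close> are independent modulo the ideal, and their
  representatives \<open>h w\<close> in the span of \<open>T\<close> are distinct and
  independent.\<close>

lemma GB_card_bound:
  assumes r: "linear_order_on (verts Q) r" and GB: "has_quadratic_groebner_basis (gen_order r) (quiver_ideal Q)"
    and sym: "symmetric_quiver Q" and W: "finite W" "\<And>w. w \<in> W \<Longrightarrow> set w \<subseteq> quiver_gens Q"
      "\<And>w. w \<in> W \<Longrightarrow> successively (normal_pair (arrows Q) r) w"
    and T: "finite T" "\<And>w. w \<in> W \<Longrightarrow> \<exists>a b. mon w = a + b \<and> a \<in> quiver_ideal Q \<and> keys b \<subseteq> T"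
  shows "card W \<le> card T"
proof -
  obtain h where h: "\<And>w. w \<in> W \<Longrightarrow> mon w - h w \<in> quiver_ideal Q" "\<And>w. w \<in> W \<Longrightarrow> keys (h w) \<subseteq> T"
    using T(2) by (metis add_diff_cancel_right')
  have zero: "f = 0" if "f \<in> quiver_ideal Q" "keys f \<subseteq> W" for f
    using quiver_leading_exists[OF r that(1)] GB_normal_not_leading[OF r GB sym _ _ that(1)] W that(2)
    by (metis is_leading_monomial_def subsetD)
  note Isub = ideal_subspace[OF quiver_ideal(1)[of Q]]
  have inj: "inj_on h W"
  proof (rule inj_onI)
    fix w w' assume w: "w \<in> W" "w' \<in> W" "h w = h w'"
    have "(mon w - h w) - (mon w' - h w') \<in> quiver_ideal Q"
      using w by (intro pm.subspace_diff[OF Isub] h)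
    then have "mon w - mon w' \<in> quiver_ideal Q" using w by simp
    moreover have "keys (mon w - mon w') \<subseteq> W"
      using w by (auto simp: in_keys_iff lookup_minus lookup_single when_def split: if_splits)
    ultimately have "mon w - mon w' = 0" using zero by blast
    then have "lkp (mon w) w = lkp (mon w') w" by simp
    then show "w = w'" by (auto simp: lookup_single when_def split: if_splits)
  qed
  have "pm.independent (h ` W)"
  proof (subst pm.dependent_finite)
    show "finite (h ` W)" using W(1) by simp
    show "\<not> (\<exists>u. (\<exists>v\<in>h ` W. u v \<noteq> 0) \<and> (\<Sum>v\<in>h ` W. scale_pm (u v) v) = 0)"
    proof (safe)
      fix u w assume w: "w \<in> W" "u (h w) \<noteq> 0" and 0: "(\<Sum>v\<in>h ` W. scale_pm (u v) v) = 0"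
      let ?f = "\<Sum>w\<in>W. scale_pm (u (h w)) (mon w)"
      have "(\<Sum>w\<in>W. scale_pm (u (h w)) (mon w - h w)) \<in> quiver_ideal Q"
        by (intro pm.subspace_sum[OF Isub] pm.subspace_scale[OF Isub] h)
      also have "(\<Sum>w\<in>W. scale_pm (u (h w)) (mon w - h w)) = ?f - (\<Sum>w\<in>W. scale_pm (u (h w)) (h w))"
        by (simp only: pm.scale_right_diff_distrib sum_subtractf)
      also have "(\<Sum>w\<in>W. scale_pm (u (h w)) (h w)) = 0"
        using 0 by (simp add: sum.reindex[OF inj])
      finally have "?f \<in> quiver_ideal Q" by simp
      moreover have lk: "lkp ?f v = (if v \<in> W then u (h v) else 0)" for v
        using W(1) by (simp add: lookup_sum lookup_single when_def)
      moreover have "keys ?f \<subseteq> W"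
        unfolding in_keys_iff[abs_def] by (auto simp: in_keys_iff lk simp del: scale_pm_single split: if_splits)
      ultimately have "?f = 0" using zero by blast
      then have "lkp ?f w = 0" by simp
      then show False using w unfolding lk by simp
    qed
  qed
  moreover have "h ` W \<subseteq> pm.span (mon ` T)"
  proof (safe, rule in_subspaceI[OF pm.subspace_span])
    fix w v assume "w \<in> W" "v \<in> keys (h w)"
    then show "mon v \<in> pm.span (mon ` T)" using h(2) by (intro pm.span_base) auto
  qed
  ultimately have "card (h ` W) \<le> card (mon ` T)"
    using pm.independent_span_bound[of "mon ` T"] T(1) by auto
  also have "\<dots> \<le> card T" by (rule card_image_le[OF T(1)])
  finally show ?thesis using card_image[OF inj] by simp
qed

text \<open>Adjacent exchanges cost only a sign modulo the ideal; \<open>move\<close> uses them to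
  carry one letter to its place, and the rest of the word follows by induction.\<close>

lemma subspace_mon_perm:
  assumes S: "pm.subspace S" "quiver_ideal Q \<subseteq> S"
    and "mset w = mset w'" "set w \<subseteq> quiver_gens Q" "set u \<subseteq> quiver_gens Q" "mon (u @ w') \<in> S"
  shows "mon (u @ w) \<in> S"
proof -
  have move: "mon (u @ a # s @ t) \<in> S" if "set u \<subseteq> quiver_gens Q" "set (a # s @ t) \<subseteq> quiver_gens Q"
    "mon (u @ s @ a # t) \<in> S" for u s t a
    using that
  proof (induct s arbitrary: u)
    case (Cons b s)
    have "mon ((u @ [b]) @ a # s @ t) \<in> S" using Cons.prems by (intro Cons.hyps) auto
    then have "mon (u @ [b, a] @ (s @ t)) \<in> S" by simp
    then have "mon (u @ [a, b] @ (s @ t)) \<in> S"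
      using Cons.prems by (intro subspace_mon_swap[OF S, of u "s @ t" a b]) auto
    then show ?case by simp
  qed simp
  show ?thesis using assms(3-)
  proof (induct w arbitrary: u w')
    case (Cons a w)
    then have "a \<in> set w'" by (metis list.set_intros(1) mset_eq_setD)
    then obtain s t where w': "w' = s @ a # t" by (meson split_list)
    have m: "mset w = mset (s @ t)" using Cons.prems(1) w' by simp
    have "set (s @ t) = set w" using m by (metis mset_eq_setD)
    then have "mon (u @ a # s @ t) \<in> S"
      using Cons.prems w' by (intro move) auto
    then have "mon ((u @ [a]) @ (s @ t)) \<in> S" by simp
    then have "mon ((u @ [a]) @ w) \<in> S" using Cons.prems by (intro Cons.hyps[OF m]) auto
    then show ?case by simp
  qed simp
qed

text \<open>
  Dually, for variables \<open>u, v, w\<close> labelled \<open>c1, c2, c3\<close> with mutual multiplicities \<open>x, y, z\<close>: the lowest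
  monomial (lexicographically in the exponents of \<open>u\<close>, then \<open>v\<close>) of a polynomial
  divisible by \<open>(u - v) ^ x * (u - w) ^ y * (v - w) ^ z\<close> is divisible by \<open>v ^ x * w ^ (y + z)\<close>.
\<close>

lemma triple_reduction:
  assumes S: "pm.subspace S" "quiver_ideal Q \<subseteq> S" and c: "c1 \<in> verts Q" "c2 \<in> verts Q" "c3 \<in> verts Q"
    and base: "\<And>p q r. p + q + r = K \<Longrightarrow> arrows Q c1 c2 \<le> q \<Longrightarrow> arrows Q c1 c3 + arrows Q c2 c3 \<le> r \<Longrightarrow>
      mon [(c1, p), (c2, q), (c3, r)] \<in> S"
    and "p + q + r = K"
  shows "mon [(c1, p), (c2, q), (c3, r)] \<in> S"
  using assms(7)
proof (induct p arbitrary: q r rule: less_induct)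
  case (less p)
  have g: "(c1, n) \<in> quiver_gens Q" "(c2, n) \<in> quiver_gens Q" "(c3, n) \<in> quiver_gens Q" for n
    using c by (auto simp: quiver_gens_def)
  have line: "(\<Sum>k\<le>M. scale_pm (of_nat (k choose n)) (mon (u @ [(i, M - k), (j, k)] @ v))) \<in> S"
    if "set u \<subseteq> quiver_gens Q" "set v \<subseteq> quiver_gens Q" "i \<in> verts Q" "j \<in> verts Q" "n < arrows Q i j" for u v i j n M
    using subsetD[OF S(2) quiver_ideal_line[OF that]] .
  \<comment> \<open>On the line through the first two letters, \<open>b > q\<close> lowers the
    exponent at \<open>c1\<close> and is settled by induction. The \<open>q + 1\<close> values up to
    \<open>q\<close> are no more than the multiplicity, so interpolation applies.\<close>
  have 1: "mon [(c1, p), (c2, q), (c3, r)] \<in> S" if "p + q + r = K" "q < arrows Q c1 c2" for q r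
  proof -
    let ?g = "\<lambda>b. mon [(c1, p + q - b), (c2, b), (c3, r)]"
    have "{b. b \<le> p + q \<and> ?g b \<notin> S} \<subseteq> {..q}"
    proof
      fix b assume b: "b \<in> {b. b \<le> p + q \<and> ?g b \<notin> S}"
      have "\<not> q < b"
      proof
        assume "q < b"
        then have "p + q - b < p" "p + q - b + b + r = K" using b that(1) by auto
        then show False using less.hyps[of "p + q - b" b r] b by simp
      qed
      then show "b \<in> {..q}" by simp
    qed
    then have "card {b. b \<le> p + q \<and> ?g b \<notin> S} \<le> card {..q}" by (intro card_mono) auto
    then have cd: "card {b. b \<le> p + q \<and> ?g b \<notin> S} \<le> arrows Q c1 c2" using that by simp
    have rel: "(\<Sum>b\<le>p + q. scale_pm (of_nat (b choose n)) (?g b)) \<in> S" if "n < arrows Q c1 c2" for n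
      using line[of "[]" "[(c3, r)]" c1 c2 n "p + q"] that c g by simp
    have "?g q \<in> S" by (rule binomial_line[OF S(1) rel cd]) simp_all
    then show ?thesis by simp
  qed
  \<comment> \<open>The same argument for \<open>c1\<close> and \<open>c3\<close>, made adjacent by
    exchanging the first two letters.\<close>
  have 2: "mon [(c1, p), (c2, q), (c3, r)] \<in> S" if "p + q + r = K" "r < arrows Q c1 c3" for q r
  proof -
    let ?g = "\<lambda>b. mon [(c2, q), (c1, p + r - b), (c3, b)]"
    have "{b. b \<le> p + r \<and> ?g b \<notin> S} \<subseteq> {..r}"
    proof
      fix b assume b: "b \<in> {b. b \<le> p + r \<and> ?g b \<notin> S}"
      have "\<not> r < b"
      proof
        assume "r < b"
        then have "mon [(c1, p + r - b), (c2, q), (c3, b)] \<in> S" using b that by (intro less.hyps) auto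
        then show False
          using subspace_mon_swap[OF S, of "[]" "[(c3, b)]" "(c2, q)" "(c1, p + r - b)"] g b by simp
      qed
      then show "b \<in> {..r}" by simp
    qed
    then have "card {b. b \<le> p + r \<and> ?g b \<notin> S} \<le> card {..r}" by (intro card_mono) auto
    then have cd: "card {b. b \<le> p + r \<and> ?g b \<notin> S} \<le> arrows Q c1 c3" using that by simp
    have rel: "(\<Sum>b\<le>p + r. scale_pm (of_nat (b choose n)) (?g b)) \<in> S" if "n < arrows Q c1 c3" for n
      using line[of "[(c2, q)]" "[]" c1 c3 n "p + r"] that c g by simp
    have "?g r \<in> S" by (rule binomial_line[OF S(1) rel cd]) simp_all
    then show ?thesis
      using subspace_mon_swap[OF S, of "[]" "[(c3, r)]" "(c1, p)" "(c2, q)"] g by simp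
  qed
  let ?g = "\<lambda>b. mon [(c1, p), (c2, q + r - b), (c3, b)]"
  \<comment> \<open>With \<open>p\<close> fixed, small exponents at \<open>c2\<close> or
    \<open>c3\<close> are settled by the two previous facts and the words allowed in
    \<open>base\<close> by assumption. At most \<open>arrows Q c2 c3\<close> values of
    \<open>b\<close> stay open.\<close>
  have "{b. b \<le> q + r \<and> ?g b \<notin> S} \<subseteq> {arrows Q c1 c3..<arrows Q c1 c3 + arrows Q c2 c3}"
  proof
    fix b assume b: "b \<in> {b. b \<le> q + r \<and> ?g b \<notin> S}"
    then have K: "p + (q + r - b) + b = K" and ns: "?g b \<notin> S" using less.prems by auto
    have "\<not> q + r - b < arrows Q c1 c2" "\<not> b < arrows Q c1 c3" using 1[OF K] 2[OF K] ns by blast+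
    moreover from this have "\<not> arrows Q c1 c3 + arrows Q c2 c3 \<le> b"
      using base[OF K] ns unfolding not_less by blast
    ultimately show "b \<in> {arrows Q c1 c3..<arrows Q c1 c3 + arrows Q c2 c3}" by simp
  qed
  then have "card {b. b \<le> q + r \<and> ?g b \<notin> S} \<le> card {arrows Q c1 c3..<arrows Q c1 c3 + arrows Q c2 c3}"
    by (intro card_mono) auto
  then have cd: "card {b. b \<le> q + r \<and> ?g b \<notin> S} \<le> arrows Q c2 c3" by simp
  have rel: "(\<Sum>b\<le>q + r. scale_pm (of_nat (b choose n)) (?g b)) \<in> S" if "n < arrows Q c2 c3" for n
    using line[of "[(c1, p)]" "[]" c2 c3 n "q + r"] that c g by simp
  have "?g r \<in> S" by (rule binomial_line[OF S(1) rel cd]) simp_all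
  then show ?case by simp
qed

lemma GB_triple_bound:
  assumes r: "linear_order_on (verts Q) r" and GB: "has_quadratic_groebner_basis (gen_order r) (quiver_ideal Q)"
    and sym: "symmetric_quiver Q" and c: "c1 \<in> verts Q" "c2 \<in> verts Q" "c3 \<in> verts Q"
    and W: "finite W" "\<And>w. w \<in> W \<Longrightarrow> successively (normal_pair (arrows Q) r) w"
      "\<And>w. w \<in> W \<Longrightarrow> image_mset fst (mset w) = {#c1, c2, c3#}" "\<And>w. w \<in> W \<Longrightarrow> sum_list (map snd w) = K"
  shows "card W \<le> card {(p, q, r). p + q + r = K \<and> arrows Q c1 c2 \<le> q \<and> arrows Q c1 c3 + arrows Q c2 c3 \<le> r}"
    (is "_ \<le> card ?A")
proof -
  have A: "finite ?A" by (rule finite_subset[of _ "{..K} \<times> {..K} \<times> {..K}"]) auto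
  define T where "T = (\<lambda>(p, q, r). [(c1, p), (c2, q), (c3, r)]) ` ?A"
  define S where "S = {a + b | a b. a \<in> quiver_ideal Q \<and> b \<in> {b. keys b \<subseteq> T}}"
  have S: "pm.subspace S" unfolding S_def
    by (rule pm.subspace_sums[OF ideal_subspace[OF quiver_ideal(1)] subspace_keys])
  have "f + 0 \<in> S" if "f \<in> quiver_ideal Q" for f unfolding S_def using that by fastforce
  then have IS: "quiver_ideal Q \<subseteq> S" by auto
  have TS: "mon w \<in> S" if "w \<in> T" for w
  proof -
    have "0 + mon w \<in> S" unfolding S_def using that pm.subspace_0[OF ideal_subspace[OF quiver_ideal(1)]] by fastforce
    then show ?thesis by simp
  qed
  have gens: "set w \<subseteq> quiver_gens Q" if "w \<in> W" for w
  proof -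
    have "set_mset (image_mset fst (mset w)) \<subseteq> verts Q" using W(3)[OF that] c by simp
    then show ?thesis by (auto simp: quiver_gens_def)
  qed
  have "card W \<le> card T"
  proof (rule GB_card_bound[OF r GB sym W(1) gens W(2)])
    show "finite T" unfolding T_def using A by simp
    fix w assume w: "w \<in> W"
    obtain x M where M: "mset w = add_mset x M" "fst x = c1" "image_mset fst M = {#c2, c3#}"
      using msed_map_invR[OF W(3)[OF w]] by blast
    obtain y M' where M': "M = add_mset y M'" "fst y = c2" "image_mset fst M' = {#c3#}"
      using msed_map_invR[OF M(3)] by blast
    obtain z M'' where M'': "M' = add_mset z M''" "fst z = c3" "image_mset fst M'' = {#}"
      using msed_map_invR[OF M'(3)] by blast
    have mw: "mset w = mset [(c1, snd x), (c2, snd y), (c3, snd z)]"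
      using M M' M'' by auto
    have "sum_mset (image_mset snd (mset w)) = K" using W(4)[OF w] by (metis mset_map sum_mset_sum_list)
    then have "snd x + snd y + snd z = K" unfolding mw by (simp add: add_ac)
    then have "mon [(c1, snd x), (c2, snd y), (c3, snd z)] \<in> S"
      by (rule triple_reduction[OF S IS c, rotated]) (rule TS, force simp: T_def)
    then have "mon ([] @ w) \<in> S"
      by (intro subspace_mon_perm[OF S IS mw gens[OF w]]) auto
    then show "\<exists>a b. mon w = a + b \<and> a \<in> quiver_ideal Q \<and> keys b \<subseteq> T" by (auto simp: S_def)
  qed auto
  also have "\<dots> \<le> card ?A" unfolding T_def by (rule card_image_le[OF A])
  finally show ?thesis .
qed

section \<open>Koszulness from normal words\<close>

lemma lin_fun_diff: "lin (\<lambda>w. g w - h w) f = lin g f - lin h f"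
  by (simp add: lin_def pm.scale_right_diff_distrib sum_subtractf)

lemma lin_fun_neg: "lin (\<lambda>w. - g w) f = - lin g f"
  by (simp add: lin_def sum_negf)

lemma lin_fun_mult_left:
  fixes g :: "'a \<Rightarrow> ('b::monoid_add \<Rightarrow>\<^sub>0 rat)"
  shows "lin (\<lambda>w. a * g w) f = a * lin g f"
  by (simp add: lin_def sum_distrib_left scale_pm_mult_right)

lemma lin_fun_mult_right:
  fixes g :: "'a \<Rightarrow> ('b::monoid_add \<Rightarrow>\<^sub>0 rat)"
  shows "lin (\<lambda>w. g w * a) f = lin g f * a"
  by (simp add: lin_def sum_distrib_right scale_pm_mult_left)

lemma lin_lin: "lin g (lin h f) = lin (\<lambda>w. lin g (h w)) f"
  by (simp add: lin_def[of h] lin_def[of "\<lambda>w. lin g (h w)"] lin.sum lin.scale)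

lemma lin_zero_fun [simp]: "lin (\<lambda>w. 0) f = 0"
  by (simp add: lin_def)

lemma ev_lin: "ev \<phi> (lin h f) = ev (\<lambda>w. ev \<phi> (h w)) f"
  by (simp add: lin_def ev_def[of "\<lambda>w. ev \<phi> (h w)"] ev_sum ev_scale_pm)

lemma ev_scale: "ev (\<lambda>w. c * \<phi> w) f = c * ev \<phi> f"
  by (simp add: ev_def sum_distrib_left mult.left_commute)

lemma mon_mult_eq_lin: "mon u * (f :: 'x list \<Rightarrow>\<^sub>0 rat) = lin (\<lambda>w. mon (u @ w)) f"
  using lin_fun_mult_left[of "mon u" mon f] by (simp add: lin_id)

lemma mult_mon_eq_lin: "(f :: 'x list \<Rightarrow>\<^sub>0 rat) * mon v = lin (\<lambda>w. mon (w @ v)) f"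
  using lin_fun_mult_right[of mon "mon v" f] by (simp add: lin_id)

lemma lin_mon_mult: "lin g (mon u * (f :: 'x list \<Rightarrow>\<^sub>0 rat)) = lin (\<lambda>w. g (u @ w)) f"
  unfolding mon_mult_eq_lin lin_lin by simp

lemma lin_mult_mon: "lin g ((f :: 'x list \<Rightarrow>\<^sub>0 rat) * mon v) = lin (\<lambda>w. g (w @ v)) f"
  unfolding mult_mon_eq_lin lin_lin by simp

lemma lin_keys:
  assumes "\<And>w. w \<in> keys f \<Longrightarrow> keys (g w) \<subseteq> A"
  shows "keys (lin g f) \<subseteq> A"
  using lin_in_subspace[OF subspace_keys, of f g A] assms by simp

lemma bar_single_eq: "bar_single f = lin (\<lambda>w. mon [w]) f"
  by (simp add: bar_single_def lin_def)

lemma bar_word_eq: "mon us * bar_single f * mon vs = lin (\<lambda>w. mon (us @ [w] @ vs)) f"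
  unfolding bar_single_eq lin_fun_mult_left[symmetric] lin_fun_mult_right[symmetric] mon_mult_mon by simp

section \<open>The reduced bar differential by recursion\<close>

primrec merge :: "'x list \<Rightarrow> 'x list list \<Rightarrow> ('x list list \<Rightarrow>\<^sub>0 rat)" where
  "merge a [] = 0"
| "merge a (b # ws) = mon ((a @ b) # ws)"

text \<open>Merging the first two blocks has sign -1. All merges behind the first block have their
  index shifted by one, whence the second minus sign.\<close>

primrec bar_d :: "'x list list \<Rightarrow> ('x list list \<Rightarrow>\<^sub>0 rat)" where
  "bar_d [] = 0"
| "bar_d (a # ws) = - merge a ws - mon [a] * bar_d ws"

lemma bar_d_eq_sum:
  "bar_d ws = (\<Sum>i | Suc i < length ws. scale_pm ((-1) ^ Suc i) (mon (take i ws @ [ws ! i @ ws ! Suc i] @ drop (i + 2) ws)))"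
proof (induct ws)
  case (Cons a ws)
  let ?f = "\<lambda>ws i. scale_pm ((-1) ^ Suc i) (mon (take i ws @ [ws ! i @ ws ! Suc i] @ drop (i + 2) ws))"
  show ?case
  proof (cases ws)
    case (Cons b r)
    have "{i. Suc i < length (a # ws)} = insert 0 (Suc ` {i. Suc i < length ws})"
      by (auto simp: Cons image_iff) (metis less_Suc_eq_0_disj)
    moreover have "finite {i. Suc i < length ws}" by (rule finite_subset[of _ "{..<length ws}"]) auto
    ultimately have "(\<Sum>i | Suc i < length (a # ws). ?f (a # ws) i) =
        ?f (a # ws) 0 + (\<Sum>i | Suc i < length ws. ?f (a # ws) (Suc i))"
      by (simp add: sum.reindex)
    also have "?f (a # ws) 0 = - merge a ws" by (simp add: Cons single_uminus)
    also have "(\<Sum>i | Suc i < length ws. ?f (a # ws) (Suc i)) = - (mon [a] * (\<Sum>i | Suc i < length ws. ?f ws i))"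
      unfolding sum_distrib_left sum_negf[symmetric]
      by (rule sum.cong) (auto simp: mult_single plus_list_def simp flip: single_uminus)
    finally show ?thesis using Cons.hyps by simp
  qed simp
qed simp

lemma bar_diff_eq: "bar_diff z = lin bar_d z"
  by (simp add: bar_diff_def lin_def bar_d_eq_sum pm.scale_sum_right mult.commute)

lemma lin_bar_d_Cons: "lin bar_d (mon [a] * z) = - lin (merge a) z - mon [a] * lin bar_d z"
  by (simp add: lin_mon_mult lin_fun_diff lin_fun_neg lin_fun_mult_left)

lemma lin_merge_Cons: "lin (merge a) (mon [b] * z) = mon [a @ b] * z"
  unfolding lin_mon_mult mon_mult_eq_lin[of "[a @ b]"] by simp

lemma lin_merge_merge: "lin (merge a) (merge b r) = merge (a @ b) r"
  by (cases r) simp_all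

lemma lin_bar_d_merge: "lin bar_d (merge a ws) = lin (merge a) (bar_d ws)"
proof (cases ws)
  case (Cons b r)
  then show ?thesis by (simp add: lin.diff lin.neg lin_merge_Cons lin_merge_merge)
qed simp

lemma bar_d_bar_d: "lin bar_d (bar_d ws) = 0"
proof (induct ws)
  case (Cons a ws)
  then show ?case by (simp add: lin.diff lin.neg lin_bar_d_Cons lin_bar_d_merge)
qed simp

lemma lin_bar_d_bar_d: "lin bar_d (lin bar_d z) = 0"
  by (simp add: lin_lin bar_d_bar_d)

lemma keys_Cons_mult: "keys (mon [a] * z) = (#) a ` keys z"
  using keys_mon_mult[of "[a]" z "[]"] by simp

text \<open>What Koszulness needs from the algebra: each bad pair can be rewritten by smaller pairs,
  and each word without bad pairs is separated from the ideal by a functional blind to smaller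
  words. So these words form a basis of the quotient. Well-foundedness carries the induction on
  concatenations, and \<open>no_Nil\<close> keeps empty blocks out of the bar complex.\<close>

locale quadratic_pbw =
  fixes X :: "'x set" and ord :: "('x \<times> 'x) set" and I :: "('x list \<Rightarrow>\<^sub>0 rat) set" and bad :: "'x \<Rightarrow> 'x \<Rightarrow> bool"
  assumes I: "ideal I (free_alg X)" and no_Nil: "\<And>f. f \<in> I \<Longrightarrow> lkp f [] = 0"
    and wf_ord: "wf ord" and trans_ord: "trans ord"
    and total_ord: "\<And>x y. x \<in> X \<Longrightarrow> y \<in> X \<Longrightarrow> x \<noteq> y \<Longrightarrow> (x, y) \<in> ord \<or> (y, x) \<in> ord"
    and bad_leading: "\<And>x y. x \<in> X \<Longrightarrow> y \<in> X \<Longrightarrow> bad x y \<Longrightarrow>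
      \<exists>g\<in>I. homogeneous 2 g \<and> is_leading_monomial ord g [x, y]"
    and good_functional: "\<And>w. set w \<subseteq> X \<Longrightarrow> successively (\<lambda>x y. \<not> bad x y) w \<Longrightarrow>
      \<exists>\<phi>. \<phi> w \<noteq> 0 \<and> (\<forall>v. \<phi> v \<noteq> 0 \<longrightarrow> length v = length w \<and> (v = w \<or> (w, v) \<in> lenlex ord)) \<and> (\<forall>f\<in>I. ev \<phi> f = 0)"
begin

abbreviation nrm :: "'x list \<Rightarrow> bool" where "nrm \<equiv> successively (\<lambda>x y. \<not> bad x y)"

abbreviation "Y \<equiv> lists X - {[]}"
abbreviation "J \<equiv> bar_ideal X I"

lemma wf_lex: "wf (lenlex ord)" using wf_ord by (rule wf_lenlex)

lemma lex_irrefl: "(w, w) \<notin> lenlex ord" using wf_lex by (rule wf_not_refl)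

lemma lex_asym: "(v, w) \<in> lenlex ord \<Longrightarrow> (w, v) \<notin> lenlex ord" using wf_lex by (rule wf_not_sym)

lemma I_carrier: "f \<in> I \<Longrightarrow> keys f \<subseteq> lists X"
  using ideal.Icarr[OF I] by (simp add: carrier_free_alg)

lemma bar_gens: "bar_single ` I \<subseteq> carrier (free_alg Y)"
proof (safe)
  fix f assume f: "f \<in> I"
  have "keys (bar_single f) \<subseteq> lists Y"
    unfolding bar_single_eq
  proof (rule lin_keys)
    fix w assume "w \<in> keys f"
    then show "keys (mon [w]) \<subseteq> lists Y" using I_carrier[OF f] no_Nil[OF f] by (auto simp: in_keys_iff)
  qed
  then show "bar_single f \<in> carrier (free_alg Y)" by (simp add: carrier_free_alg)
qed

lemmas J = free_alg_Idl[OF bar_gens, folded bar_ideal_def]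
lemmas J_subspace = ideal_subspace[OF J(1)]

lemma J_word:
  assumes "set us \<subseteq> Y" "set vs \<subseteq> Y" "f \<in> I"
  shows "lin (\<lambda>w. mon (us @ [w] @ vs)) f \<in> J"
  using ideal_mon_mult[OF J(1) _ assms(1,2), of "bar_single f"] J(2) assms(3) unfolding bar_word_eq by blast

lemma J_mult_left: "z \<in> J \<Longrightarrow> a \<in> Y \<Longrightarrow> mon [a] * z \<in> J"
  using ideal_mon_mult[OF J(1), of z "[a]" "[]"] by simp

lemma bar_d_keys:
  assumes "set ws \<subseteq> Y"
  shows "keys (bar_d ws) \<subseteq> {vs. set vs \<subseteq> Y \<and> length vs = length ws - 1 \<and> concat vs = concat ws}"
  using assms
proof (induct ws)
  case (Cons a ws)
  let ?A = "{vs. set vs \<subseteq> Y \<and> length vs = length ws \<and> concat vs = a @ concat ws}"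
  have "merge a ws \<in> {f. keys f \<subseteq> ?A}" using Cons.prems by (cases ws) auto
  moreover have "keys (mon [a] * bar_d ws) \<subseteq> ?A"
    unfolding keys_Cons_mult
  proof (rule subsetI)
    fix vs assume "vs \<in> (#) a ` keys (bar_d ws)"
    then obtain k where k: "vs = a # k" "k \<in> keys (bar_d ws)" by blast
    then have "ws \<noteq> []" by auto
    moreover have "set k \<subseteq> Y \<and> length k = length ws - 1 \<and> concat k = concat ws"
      using Cons.hyps Cons.prems k(2) by auto
    ultimately show "vs \<in> ?A" using Cons.prems k(1) by simp
  qed
  then have "mon [a] * bar_d ws \<in> {f. keys f \<subseteq> ?A}" by simp
  ultimately have "- merge a ws - mon [a] * bar_d ws \<in> {f. keys f \<subseteq> ?A}"
    by (intro pm.subspace_diff[OF subspace_keys] pm.subspace_neg[OF subspace_keys])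
  then show ?case by simp
qed simp

text \<open>Merging the block that carries \<open>f\<close> with a neighbour multiplies
  \<open>f\<close> by a word, which stays in \<open>I\<close>; all other merges leave that block
  alone.\<close>

lemma J_bar_d_word:
  assumes "set us \<subseteq> Y" "set vs \<subseteq> Y" "f \<in> I"
  shows "lin (\<lambda>w. bar_d (us @ w # vs)) f \<in> J"
  using assms(1)
proof (induct us)
  case Nil
  have "lin (\<lambda>w. mon [w] * bar_d vs) f \<in> J"
  proof -
    interpret ideal J "free_alg Y" by (rule J(1))
    have "bar_d vs \<in> carrier (free_alg Y)" using bar_d_keys[OF assms(2)] by (auto simp: carrier_free_alg)
    moreover have "lin (\<lambda>w. mon [w]) f \<in> J" using J_word[of "[]" "[]" f] assms(3) by simp
    ultimately show ?thesis unfolding lin_fun_mult_right using I_r_closed by auto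
  qed
  moreover have "lin (\<lambda>w. merge w vs) f \<in> J"
  proof (cases vs)
    case Nil
    then show ?thesis using pm.subspace_0[OF J_subspace] by simp
  next
    case (Cons b r)
    then have "f * mon b \<in> I" using ideal_mon_mult[OF I assms(3), of "[]" b] assms(2) by auto
    from J_word[OF _ _ this, of "[]" r] show ?thesis
      using Cons assms(2) by (simp add: lin_mult_mon)
  qed
  ultimately have "- lin (\<lambda>w. merge w vs) f - lin (\<lambda>w. mon [w] * bar_d vs) f \<in> J"
    by (intro pm.subspace_diff[OF J_subspace] pm.subspace_neg[OF J_subspace])
  then show ?case by (simp add: lin_fun_diff lin_fun_neg)
next
  case (Cons a us)
  have "mon [a] * lin (\<lambda>w. bar_d (us @ w # vs)) f \<in> J"
    using Cons by (intro J_mult_left) auto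
  moreover have "lin (\<lambda>w. merge a (us @ w # vs)) f \<in> J"
  proof (cases us)
    case Nil
    have "mon a * f \<in> I" using ideal_mon_mult[OF I assms(3), of a "[]"] Cons.prems by auto
    from J_word[OF _ _ this, of "[]" vs] show ?thesis
      using Nil assms(2) by (simp add: lin_mon_mult)
  next
    case us: (Cons b us')
    show ?thesis using J_word[of "(a @ b) # us'" vs f] Cons.prems us assms by auto
  qed
  ultimately have "- lin (\<lambda>w. merge a (us @ w # vs)) f - mon [a] * lin (\<lambda>w. bar_d (us @ w # vs)) f \<in> J"
    by (intro pm.subspace_diff[OF J_subspace] pm.subspace_neg[OF J_subspace])
  then show ?case by (simp add: lin_fun_diff lin_fun_neg lin_fun_mult_left)
qed

lemma J_bar_d: "z \<in> J \<Longrightarrow> lin bar_d z \<in> J"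
proof -
  have "pm.subspace {z. lin bar_d z \<in> J}"
    by (rule lin.subspace_linear_preimage[OF J_subspace])
  then have "Idl\<^bsub>free_alg Y\<^esub> (bar_single ` I) \<subseteq> {z. lin bar_d z \<in> J}"
  proof (rule Idl_subset_subspace[OF bar_gens])
    fix us vs g assume "set us \<subseteq> Y" "set vs \<subseteq> Y" "g \<in> bar_single ` I"
    then show "mon us * g * mon vs \<in> {z. lin bar_d z \<in> J}"
      using J_bar_d_word by (auto simp: bar_word_eq lin_lin)
  qed
  then show "z \<in> J \<Longrightarrow> lin bar_d z \<in> J" unfolding bar_ideal_def by blast
qed

section \<open>Filtration by concatenation, and functionals on bars\<close>

definition smaller :: "'x list \<Rightarrow> nat \<Rightarrow> ('x list list \<Rightarrow>\<^sub>0 rat) set" where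
  "smaller t n = {b. keys b \<subseteq> {vs. set vs \<subseteq> Y \<and> length vs = n \<and> length (concat vs) = length t \<and> (concat vs, t) \<in> lenlex ord}}"

definition filtration :: "'x list \<Rightarrow> nat \<Rightarrow> ('x list list \<Rightarrow>\<^sub>0 rat) set" where
  "filtration t n = {a + b | a b. a \<in> J \<and> b \<in> smaller t n}"

lemma smaller_subspace: "pm.subspace (smaller t n)" unfolding smaller_def by (rule subspace_keys)

lemma filtration_subspace: "pm.subspace (filtration t n)"
  unfolding filtration_def by (rule pm.subspace_sums[OF J_subspace smaller_subspace])

lemma J_filtration: "z \<in> J \<Longrightarrow> z \<in> filtration t n"
  unfolding filtration_def mem_Collect_eq
  by (intro exI[of _ z] exI[of _ 0]) (simp add: pm.subspace_0[OF smaller_subspace])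

lemma smaller_filtration: "z \<in> smaller t n \<Longrightarrow> z \<in> filtration t n"
  unfolding filtration_def mem_Collect_eq
  by (intro exI[of _ 0] exI[of _ z]) (simp add: pm.subspace_0[OF J_subspace])

text \<open>The quadratic element for a bad pair inside a block rewrites that pair by smaller ones.
  The number and the lengths of the blocks are preserved, while the concatenation drops.\<close>

lemma nonnormal_filtration:
  assumes "set ws \<subseteq> Y" "\<exists>w\<in>set ws. \<not> nrm w"
  shows "mon ws \<in> filtration (concat ws) (length ws)"
proof -
  obtain us w vs where ws: "ws = us @ w # vs" "\<not> nrm w" using assms(2) by (metis split_list)
  obtain u x y v where w: "w = u @ [x, y] @ v" "bad x y" using not_successively_split[OF ws(2)] by blast
  have X: "set u \<subseteq> X" "set v \<subseteq> X" "x \<in> X" "y \<in> X" "set us \<subseteq> Y" "set vs \<subseteq> Y" using assms(1) ws w by auto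
  obtain g where g: "g \<in> I" "homogeneous 2 g" "is_leading_monomial ord g [x, y]"
    using bad_leading X w by blast
  let ?m = "\<lambda>p. mon (us @ [u @ p @ v] @ vs)"
  have "mon u * g * mon v \<in> I" by (rule ideal_mon_mult[OF I g(1) X(1,2)])
  from J_word[OF X(5,6) this] have A: "lin ?m g \<in> J" by (simp add: lin_mult_mon lin_mon_mult)
  have B: "lin ?m g = scale_pm (lkp g [x, y]) (mon ws) + (\<Sum>p\<in>keys g - {[x, y]}. scale_pm (lkp g p) (?m p))"
    unfolding lin_def using g(3) ws(1) w(1)
    by (subst sum.remove[of _ "[x, y]"]) (auto simp: is_leading_monomial_def)
  have C: "(\<Sum>p\<in>keys g - {[x, y]}. scale_pm (lkp g p) (?m p)) \<in> smaller (concat ws) (length ws)"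
  proof (intro pm.subspace_sum[OF smaller_subspace] pm.subspace_scale[OF smaller_subspace])
    fix p assume p: "p \<in> keys g - {[x, y]}"
    have len: "length p = 2" using g(2) p by (simp add: homogeneous_def)
    have "(p, [x, y]) \<in> lenlex ord" using g(3) p by (simp add: is_leading_monomial_def)
    then have "((concat us @ u) @ p @ v @ concat vs, (concat us @ u) @ [x, y] @ v @ concat vs) \<in> lenlex ord"
      using len by (intro lenlex_append_same_length) auto
    moreover have "set p \<subseteq> X" "p \<noteq> []" using I_carrier[OF g(1)] p len by auto
    ultimately show "?m p \<in> smaller (concat ws) (length ws)"
      using ws w X len unfolding smaller_def by auto
  qed
  have "scale_pm (lkp g [x, y]) (mon ws) \<in> filtration (concat ws) (length ws)"
    using pm.subspace_diff[OF filtration_subspace J_filtration[OF A] smaller_filtration[OF C]] unfolding B by simp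
  then have "scale_pm (inverse (lkp g [x, y])) (scale_pm (lkp g [x, y]) (mon ws)) \<in> filtration (concat ws) (length ws)"
    by (rule pm.subspace_scale[OF filtration_subspace])
  moreover have "lkp g [x, y] \<noteq> 0" using g(3) by (simp add: is_leading_monomial_def in_keys_iff)
  ultimately show ?thesis by simp
qed

definition least_functional :: "'x list \<Rightarrow> 'x list \<Rightarrow> rat" where
  "least_functional w = (SOME \<phi>. \<phi> w \<noteq> 0 \<and> (\<forall>v. \<phi> v \<noteq> 0 \<longrightarrow> length v = length w \<and> (v = w \<or> (w, v) \<in> lenlex ord)) \<and> (\<forall>f\<in>I. ev \<phi> f = 0))"

lemma least_functional:
  assumes "set w \<subseteq> X" "nrm w"
  shows "least_functional w w \<noteq> 0" "least_functional w v \<noteq> 0 \<Longrightarrow> length v = length w \<and> (v = w \<or> (w, v) \<in> lenlex ord)"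
    "f \<in> I \<Longrightarrow> ev (least_functional w) f = 0"
proof -
  have "least_functional w w \<noteq> 0 \<and> (\<forall>v. least_functional w v \<noteq> 0 \<longrightarrow> length v = length w \<and> (v = w \<or> (w, v) \<in> lenlex ord)) \<and> (\<forall>f\<in>I. ev (least_functional w) f = 0)"
    unfolding least_functional_def by (rule someI_ex[OF good_functional[OF assms]])
  then show "least_functional w w \<noteq> 0" "least_functional w v \<noteq> 0 \<Longrightarrow> length v = length w \<and> (v = w \<or> (w, v) \<in> lenlex ord)"
    "f \<in> I \<Longrightarrow> ev (least_functional w) f = 0" by blast+
qed

fun tensor_functional :: "'x list list \<Rightarrow> 'x list list \<Rightarrow> rat" where
  "tensor_functional [] [] = 1"
| "tensor_functional (w # ws) (v # vs) = least_functional w v * tensor_functional ws vs"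
| "tensor_functional _ _ = 0"

lemma tensor_functional_self: "(\<And>w. w \<in> set ws \<Longrightarrow> set w \<subseteq> X \<and> nrm w) \<Longrightarrow> tensor_functional ws ws \<noteq> 0"
  by (induct ws) (auto simp: least_functional)

text \<open>Corresponding blocks have equal lengths, so the first differing block decides how the
  concatenations compare. In particular the functional vanishes at every other bar with the same
  concatenation.\<close>

lemma tensor_functional_support:
  assumes "\<And>w. w \<in> set ws \<Longrightarrow> set w \<subseteq> X \<and> nrm w" "tensor_functional ws vs \<noteq> 0"
  shows "length (concat vs) = length (concat ws) \<and> (vs = ws \<or> (concat ws, concat vs) \<in> lenlex ord)"
  using assms
proof (induct ws vs rule: tensor_functional.induct)
  case (2 w ws v vs)
  have IH: "length (concat vs) = length (concat ws) \<and> (vs = ws \<or> (concat ws, concat vs) \<in> lenlex ord)"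
    using 2 by auto
  have v: "length v = length w \<and> (v = w \<or> (w, v) \<in> lenlex ord)"
    using 2(2)[of w] 2(3) by (intro least_functional) auto
  have "(w @ concat ws, v @ concat vs) \<in> lenlex ord" if "(w, v) \<in> lenlex ord"
    using lenlex_append_same_length[of w v ord "concat ws" "concat vs" "[]"] that v IH by simp
  moreover have "(w @ concat ws, w @ concat vs) \<in> lenlex ord" if "(concat ws, concat vs) \<in> lenlex ord"
    using lenlex_append_same_length[of "concat ws" "concat vs" ord "[]" "[]" w] that IH by simp
  ultimately show ?case using IH v by auto
qed auto

text \<open>With all blocks but one fixed, only one factor of the product varies. This makes the
  tensor functional vanish on the generators of \<open>J\<close>; the case \<open>c = 0\<close>
  absorbs a mismatch in the number of blocks.\<close>

lemma tensor_functional_tensor: "\<exists>c w0. (c = 0 \<or> w0 \<in> set ws) \<and> (\<forall>w. tensor_functional ws (us @ w # vs) = c * least_functional w0 w)"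
proof (induct us arbitrary: ws)
  case Nil
  show ?case
  proof (cases ws)
    case Nil
    then show ?thesis by (auto intro: exI[of _ 0])
  next
    case (Cons w0 r)
    then show ?thesis by (intro exI[of _ "tensor_functional r vs"] exI[of _ w0]) auto
  qed
next
  case (Cons u us)
  show ?case
  proof (cases ws)
    case Nil
    then show ?thesis by (auto intro: exI[of _ 0])
  next
    case ws: (Cons w1 r)
    obtain c w0 where c: "c = 0 \<or> w0 \<in> set r" "\<And>w. tensor_functional r (us @ w # vs) = c * least_functional w0 w"
      using Cons[of r] by blast
    then show ?thesis using ws by (intro exI[of _ "least_functional w1 u * c"] exI[of _ w0]) auto
  qed
qed

lemma tensor_functional_J:
  assumes "\<And>w. w \<in> set ws \<Longrightarrow> set w \<subseteq> X \<and> nrm w" "z \<in> J"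
  shows "ev (tensor_functional ws) z = 0"
proof -
  have "Idl\<^bsub>free_alg Y\<^esub> (bar_single ` I) \<subseteq> {z. ev (tensor_functional ws) z = 0}"
  proof (rule Idl_subset_subspace[OF bar_gens subspace_ev])
    fix us vs g assume "g \<in> bar_single ` I"
    then obtain f where f: "g = bar_single f" "f \<in> I" by blast
    obtain c w0 where c: "c = 0 \<or> w0 \<in> set ws" "\<And>w. tensor_functional ws (us @ w # vs) = c * least_functional w0 w"
      using tensor_functional_tensor by blast
    have "ev (tensor_functional ws) (mon us * g * mon vs) = c * ev (least_functional w0) f"
      by (simp add: f(1) bar_word_eq ev_lin c(2) ev_scale)
    also have "\<dots> = 0" using c(1) assms(1) least_functional(3) f(2) by auto
    finally show "mon us * g * mon vs \<in> {z. ev (tensor_functional ws) z = 0}" by simp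
  qed
  then show ?thesis using assms(2) unfolding bar_ideal_def by blast
qed

section \<open>The associated graded complex and its contraction\<close>

definition normal_bars :: "'x list \<Rightarrow> nat \<Rightarrow> 'x list list set" where
  "normal_bars t n = {ws. set ws \<subseteq> Y \<and> (\<forall>w\<in>set ws. nrm w) \<and> concat ws = t \<and> length ws = n}"

text \<open>The tensor functional of a bar of \<open>z\<close> isolates its coefficient: it vanishes
  at the other bars of \<open>z\<close>, which have the same concatenation, at bars with smaller
  concatenation, and on \<open>J\<close>.\<close>

lemma normal_independent:
  assumes "keys z \<subseteq> normal_bars t n" "z \<in> filtration t n'"
  shows "z = 0"
proof (rule ccontr)
  assume "z \<noteq> 0"
  then obtain ws where ws: "ws \<in> keys z" by (metis all_not_in_conv keys_eq_empty)
  then have *: "set ws \<subseteq> Y \<and> (\<forall>w\<in>set ws. nrm w) \<and> concat ws = t"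
    using assms(1) unfolding normal_bars_def by blast
  then have n: "\<And>w. w \<in> set ws \<Longrightarrow> set w \<subseteq> X \<and> nrm w" and t: "concat ws = t"
    by (blast dest: in_listsD)+
  have "ev (tensor_functional ws) z = (\<Sum>v\<in>{ws}. lkp z v * tensor_functional ws v)"
    unfolding ev_def
  proof (rule sum.mono_neutral_right)
    show "\<forall>v\<in>keys z - {ws}. lkp z v * tensor_functional ws v = 0"
    proof
      fix v assume v: "v \<in> keys z - {ws}"
      then have "concat v = t" using assms(1) by (auto simp: normal_bars_def)
      then have "tensor_functional ws v = 0" using tensor_functional_support[of ws v, OF n] v t lex_irrefl by auto
      then show "lkp z v * tensor_functional ws v = 0" by simp
    qed
  qed (use ws in auto)
  then have "ev (tensor_functional ws) z \<noteq> 0" using ws tensor_functional_self[OF n] by (simp add: in_keys_iff)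
  moreover obtain a b where ab: "z = a + b" "a \<in> J" "b \<in> smaller t n'" using assms(2) by (auto simp: filtration_def)
  have "ev (tensor_functional ws) b = 0"
    unfolding ev_def
  proof (rule sum.neutral, safe)
    fix v assume "v \<in> keys b"
    then have "(concat v, t) \<in> lenlex ord" using ab(3) by (auto simp: smaller_def)
    then have "tensor_functional ws v = 0" using tensor_functional_support[of ws v, OF n] t lex_irrefl lex_asym by auto
    then show "lkp b v * tensor_functional ws v = 0" by simp
  qed
  then have "ev (tensor_functional ws) z = 0" using ab tensor_functional_J[OF n ab(2)] by (simp add: ev_add)
  ultimately show False by simp
qed

text \<open>
  The part of the bar differential that preserves the concatenation modulo lower terms: merging two
  blocks across a bad pair gives a word that is congruent to smaller ones.
\<close>

primrec merge_normal :: "'x list \<Rightarrow> 'x list list \<Rightarrow> ('x list list \<Rightarrow>\<^sub>0 rat)" where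
  "merge_normal a [] = 0"
| "merge_normal a (b # ws) = (if bad (last a) (hd b) then 0 else mon ((a @ b) # ws))"

primrec bar_d_normal :: "'x list list \<Rightarrow> ('x list list \<Rightarrow>\<^sub>0 rat)" where
  "bar_d_normal [] = 0"
| "bar_d_normal (a # ws) = - merge_normal a ws - mon [a] * bar_d_normal ws"

text \<open>
  Splits at the first pair that is not bad. All blocks before that pair are single letters, because
  blocks are normal words.
\<close>

primrec split_first :: "'x list list \<Rightarrow> ('x list list \<Rightarrow>\<^sub>0 rat)" where
  "split_first [] = 0"
| "split_first (a # ws) = (if tl a \<noteq> [] then - mon ([hd a] # tl a # ws)
     else if ws \<noteq> [] \<and> bad (hd a) (hd (hd ws)) then - (mon [a] * split_first ws) else 0)"

lemma normal_bars_Cons: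
  "a # ws \<in> normal_bars t n \<longleftrightarrow> (\<exists>t' n'. t = a @ t' \<and> n = Suc n' \<and> set a \<subseteq> X \<and> a \<noteq> [] \<and> nrm a \<and> ws \<in> normal_bars t' n')"
  by (auto simp: normal_bars_def)

lemma normal_bars_merge: "a # b # ws \<in> normal_bars t n \<Longrightarrow> \<not> bad (last a) (hd b) \<Longrightarrow> (a @ b) # ws \<in> normal_bars t (n - 1)"
  by (auto simp: normal_bars_Cons successively_append_iff)

lemma bar_d_normal_keys: "ws \<in> normal_bars t n \<Longrightarrow> keys (bar_d_normal ws) \<subseteq> normal_bars t (n - 1)"
proof (induct ws arbitrary: t n)
  case (Cons a ws)
  then obtain t' n' where t: "t = a @ t'" "n = Suc n'" "set a \<subseteq> X" "a \<noteq> []" "nrm a" "ws \<in> normal_bars t' n'"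
    by (auto simp: normal_bars_Cons)
  have "merge_normal a ws \<in> {f. keys f \<subseteq> normal_bars t (n - 1)}"
    using Cons.prems normal_bars_merge by (cases ws) auto
  moreover have "mon [a] * bar_d_normal ws \<in> {f. keys f \<subseteq> normal_bars t (n - 1)}"
  proof (cases ws)
    case (Cons b r)
    then obtain m where "n' = Suc m" using t by (auto simp: normal_bars_Cons)
    then show ?thesis using Cons.hyps[OF t(6)] t by (auto simp: keys_Cons_mult normal_bars_Cons)
  qed simp
  ultimately have "- merge_normal a ws - mon [a] * bar_d_normal ws \<in> {f. keys f \<subseteq> normal_bars t (n - 1)}"
    by (intro pm.subspace_diff[OF subspace_keys] pm.subspace_neg[OF subspace_keys])
  then show ?case by simp
qed simp

lemma split_first_keys: "ws \<in> normal_bars t n \<Longrightarrow> keys (split_first ws) \<subseteq> normal_bars t (Suc n)"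
proof (induct ws arbitrary: t n)
  case (Cons a ws)
  then obtain t' n' where t: "t = a @ t'" "n = Suc n'" "set a \<subseteq> X" "a \<noteq> []" "nrm a" "ws \<in> normal_bars t' n'"
    by (auto simp: normal_bars_Cons)
  then obtain x a' where a: "a = x # a'" by (cases a) auto
  have "nrm a'" using t(5) a by (cases a') auto
  then have A: "a' \<noteq> [] \<Longrightarrow> [x] # a' # ws \<in> normal_bars t (Suc n)" using t a by (auto simp: normal_bars_Cons)
  have B: "mon [a] * split_first ws \<in> {f. keys f \<subseteq> normal_bars t (Suc n)}"
    using Cons.hyps[OF t(6)] t by (auto simp: keys_Cons_mult normal_bars_Cons)
  have "split_first (a # ws) \<in> {f. keys f \<subseteq> normal_bars t (Suc n)}"
  proof (cases "a' = []")
    case True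
    then consider "split_first (a # ws) = - (mon [a] * split_first ws)" | "split_first (a # ws) = 0"
      using a by (cases "ws \<noteq> [] \<and> bad x (hd (hd ws))") auto
    then show ?thesis
    proof cases
      case 1
      show ?thesis unfolding 1 by (rule pm.subspace_neg[OF subspace_keys B])
    qed simp
  next
    case False
    have "mon ([x] # a' # ws) \<in> {f. keys f \<subseteq> normal_bars t (Suc n)}" using A[OF False] by simp
    from pm.subspace_neg[OF subspace_keys this] show ?thesis using a False by simp
  qed
  then show ?case by simp
qed simp

text \<open>A fixed concatenation fixes the first letter, and this letter is all that
  \<open>split_first\<close> and \<open>merge_normal\<close> inspect behind the first block when
  they decide between their cases.\<close>

lemma normal_bars_keys_hd:
  assumes "keys z \<subseteq> normal_bars t n" "t \<noteq> []" "k \<in> keys z"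
  shows "\<exists>b r. k = b # r \<and> b \<noteq> [] \<and> hd b = hd t"
  using assms by (cases k) (force simp: normal_bars_def)+

lemma lin_bar_d_normal_Cons: "lin bar_d_normal (mon [a] * z) = - lin (merge_normal a) z - mon [a] * lin bar_d_normal z"
  by (simp add: lin_mon_mult lin_fun_diff lin_fun_neg lin_fun_mult_left)

text \<open>A first block of several letters is split and merged back, and the other terms cancel. A
  single letter followed by a good pair is merged and split back. A single letter followed by a bad
  pair lets both maps pass to the tail, with cancelling signs. The condition
  \<open>n < length t\<close> says that not all blocks are single letters, so the recursion meets
  one of the first two cases.\<close>

lemma homotopy:
  assumes "ws \<in> normal_bars t n" "n < length t"
  shows "lin bar_d_normal (split_first ws) + lin split_first (bar_d_normal ws) = mon ws"
  using assms
proof (induct ws arbitrary: t n)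
  case Nil
  then show ?case by (simp add: normal_bars_def)
next
  case (Cons a ws)
  then obtain t' n' where t: "t = a @ t'" "n = Suc n'" "set a \<subseteq> X" "a \<noteq> []" "nrm a" "ws \<in> normal_bars t' n'"
    by (auto simp: normal_bars_Cons)
  then obtain x a' where a: "a = x # a'" by (cases a) auto
  show ?case
  proof (cases "a' = []")
    case False
    have ok: "\<not> bad x (hd a')" using t(5) a False by (cases a') auto
    have 1: "lin split_first (merge_normal a ws) = - (mon [[x]] * merge_normal a' ws)"
      using a False by (cases ws) simp_all
    have 2: "lin split_first (mon [a] * bar_d_normal ws) = - (mon [[x]] * (mon [a'] * bar_d_normal ws))"
    proof -
      have "lin split_first (mon [a] * bar_d_normal ws) = lin (\<lambda>w. - mon ([[x], a'] @ w)) (bar_d_normal ws)"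
        unfolding lin_mon_mult using a False by (intro lin_cong) simp
      also have "\<dots> = - (mon [[x], a'] * bar_d_normal ws)" by (simp add: lin_fun_neg mon_mult_eq_lin)
      finally show ?thesis by (simp add: mult.assoc[symmetric])
    qed
    have "lin bar_d_normal (split_first (a # ws)) = - bar_d_normal ([x] # a' # ws)"
      using a False by (simp add: lin.neg)
    also have "\<dots> = mon (a # ws) + mon [[x]] * (- merge_normal a' ws - mon [a'] * bar_d_normal ws)"
      using a ok by simp
    finally show ?thesis
      by (simp add: lin.diff lin.neg 1 2 right_diff_distrib)
  next
    case True
    then have "t' \<noteq> []" using Cons.prems(2) t a by (auto simp: normal_bars_def)
    then obtain b r where ws: "ws = b # r" "b \<noteq> []" "hd b = hd t'"
      using normal_bars_keys_hd[of "mon ws" t' n' ws] t(6) by auto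
    show ?thesis
    proof (cases "bad x (hd b)")
      case good: False
      have "lin split_first (mon [a] * bar_d_normal ws) = lin (\<lambda>w. 0) (bar_d_normal ws)"
        unfolding lin_mon_mult
      proof (rule lin_cong)
        fix k assume "k \<in> keys (bar_d_normal ws)"
        from normal_bars_keys_hd[OF bar_d_normal_keys[OF t(6)] \<open>t' \<noteq> []\<close> this]
        show "split_first ([a] @ k) = 0" using a True good ws by auto
      qed
      then show ?thesis using a True good ws by (simp add: lin.diff lin.neg)
    next
      case bad: True
      have 1: "lin (merge_normal a) (split_first ws) = 0"
      proof -
        have "lin (merge_normal a) (split_first ws) = lin (\<lambda>w. 0) (split_first ws)"
        proof (rule lin_cong)
          fix k assume "k \<in> keys (split_first ws)"
          from normal_bars_keys_hd[OF split_first_keys[OF t(6)] \<open>t' \<noteq> []\<close> this]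
          show "merge_normal a k = 0" using a True bad ws by auto
        qed
        then show ?thesis by simp
      qed
      have 2: "lin split_first (mon [a] * bar_d_normal ws) = - (mon [a] * lin split_first (bar_d_normal ws))"
      proof -
        have "lin split_first (mon [a] * bar_d_normal ws) = lin (\<lambda>w. - (mon [a] * split_first w)) (bar_d_normal ws)"
          unfolding lin_mon_mult
        proof (rule lin_cong)
          fix k assume "k \<in> keys (bar_d_normal ws)"
          from normal_bars_keys_hd[OF bar_d_normal_keys[OF t(6)] \<open>t' \<noteq> []\<close> this]
          show "split_first ([a] @ k) = - (mon [a] * split_first k)" using a True bad ws by auto
        qed
        then show ?thesis by (simp add: lin_fun_neg lin_fun_mult_left)
      qed
      have IH: "lin bar_d_normal (split_first ws) + lin split_first (bar_d_normal ws) = mon ws"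
        using Cons.prems(2) t a True by (intro Cons.hyps[OF t(6)]) simp
      have "split_first (a # ws) = - (mon [a] * split_first ws)" using a True bad ws by simp
      moreover have "bar_d_normal (a # ws) = - (mon [a] * bar_d_normal ws)" using a True bad ws by simp
      ultimately have "lin bar_d_normal (split_first (a # ws)) + lin split_first (bar_d_normal (a # ws)) =
          mon [a] * (lin bar_d_normal (split_first ws) + lin split_first (bar_d_normal ws))"
        by (simp only: lin.neg lin_bar_d_normal_Cons 1 2) (simp add: distrib_left)
      then show ?thesis unfolding IH by simp
    qed
  qed
qed

text \<open>The two differentials differ only by merges across a bad pair, and each of these creates
  a block that is not normal.\<close>

lemma bar_d_diff_keys:
  "ws \<in> normal_bars t n \<Longrightarrow> keys (bar_d ws - bar_d_normal ws) \<subseteq> {vs. set vs \<subseteq> Y \<and> (\<exists>w\<in>set vs. \<not> nrm w) \<and> concat vs = t \<and> length vs = n - 1}"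
proof (induct ws arbitrary: t n)
  case (Cons a ws)
  let ?A = "{vs. set vs \<subseteq> Y \<and> (\<exists>w\<in>set vs. \<not> nrm w) \<and> concat vs = t \<and> length vs = n - 1}"
  from Cons obtain t' n' where t: "t = a @ t'" "n = Suc n'" "set a \<subseteq> X" "a \<noteq> []" "nrm a" "ws \<in> normal_bars t' n'"
    by (auto simp: normal_bars_Cons)
  have Y: "set (a # ws) \<subseteq> Y" and tn: "concat (a # ws) = t" "length (a # ws) = n"
    using Cons.prems unfolding normal_bars_def by blast+
  have A: "merge a ws - merge_normal a ws \<in> {f. keys f \<subseteq> ?A}"
  proof (cases ws)
    case (Cons b r)
    have "(a @ b) # r \<in> ?A" if bad: "bad (last a) (hd b)"
    proof -
      have *: "a \<in> Y" "b \<in> Y" "set r \<subseteq> Y" using Y Cons by simp_all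
      then have "a @ b \<in> Y" by simp
      moreover have "\<not> nrm (a @ b)" using * bad by (simp add: successively_append_iff)
      ultimately show ?thesis using *(3) tn Cons by simp
    qed
    then show ?thesis using Cons by (cases "bad (last a) (hd b)") simp_all
  qed simp
  have "keys (mon [a] * (bar_d ws - bar_d_normal ws)) \<subseteq> ?A"
    unfolding keys_Cons_mult
  proof (rule subsetI)
    fix vs assume "vs \<in> (#) a ` keys (bar_d ws - bar_d_normal ws)"
    then obtain k where k: "vs = a # k" "k \<in> keys (bar_d ws - bar_d_normal ws)" by blast
    then have "ws \<noteq> []" by auto
    then have "0 < n'" using tn t by auto
    moreover have "set k \<subseteq> Y \<and> (\<exists>w\<in>set k. \<not> nrm w) \<and> concat k = t' \<and> length k = n' - 1"
      using Cons.hyps[OF t(6)] k(2) by blast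
    moreover have "a \<in> Y" using Y by simp
    ultimately show "vs \<in> ?A" using k(1) t(1,2) by simp
  qed
  then have "mon [a] * (bar_d ws - bar_d_normal ws) \<in> {f. keys f \<subseteq> ?A}" by simp
  from pm.subspace_diff[OF subspace_keys pm.subspace_neg[OF subspace_keys A] this]
  have "- (merge a ws - merge_normal a ws) - mon [a] * (bar_d ws - bar_d_normal ws) \<in> {f. keys f \<subseteq> ?A}" .
  then have sub: "keys (- (merge a ws - merge_normal a ws) - mon [a] * (bar_d ws - bar_d_normal ws)) \<subseteq> ?A" by blast
  have eq: "bar_d (a # ws) - bar_d_normal (a # ws) = - (merge a ws - merge_normal a ws) - mon [a] * (bar_d ws - bar_d_normal ws)"
    by (simp add: right_diff_distrib)
  show ?case unfolding eq by (rule sub)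
qed simp

lemma lin_bar_d_diff:
  assumes "keys z \<subseteq> normal_bars t n"
  shows "lin bar_d z - lin bar_d_normal z \<in> filtration t (n - 1)"
  unfolding lin_fun_diff[symmetric]
proof (rule lin_in_subspace[OF filtration_subspace], rule in_subspaceI[OF filtration_subspace])
  fix ws vs assume *: "ws \<in> keys z" "vs \<in> keys (bar_d ws - bar_d_normal ws)"
  then have "ws \<in> normal_bars t n" using assms by blast
  from subsetD[OF bar_d_diff_keys[OF this] *(2)]
  have "set vs \<subseteq> Y" "\<exists>w\<in>set vs. \<not> nrm w" "concat vs = t" "length vs = n - 1"
    by blast+
  then show "mon vs \<in> filtration t (n - 1)" using nonnormal_filtration[of vs] by simp
qed

lemma filtration_bar_d:
  assumes "z \<in> filtration t n"
  shows "lin bar_d z \<in> filtration t (n - 1)"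
proof -
  obtain a b where ab: "z = a + b" "a \<in> J" "b \<in> smaller t n" using assms by (auto simp: filtration_def)
  have "keys (lin bar_d b) \<subseteq> {vs. set vs \<subseteq> Y \<and> length vs = n - 1 \<and> length (concat vs) = length t \<and> (concat vs, t) \<in> lenlex ord}"
  proof (rule lin_keys)
    fix ws assume "ws \<in> keys b"
    then have "set ws \<subseteq> Y" "length ws = n" "length (concat ws) = length t" "(concat ws, t) \<in> lenlex ord"
      using ab(3) by (auto simp: smaller_def)
    then show "keys (bar_d ws) \<subseteq> {vs. set vs \<subseteq> Y \<and> length vs = n - 1 \<and> length (concat vs) = length t \<and> (concat vs, t) \<in> lenlex ord}"
      using bar_d_keys[of ws] by auto
  qed
  then have "lin bar_d b \<in> smaller t (n - 1)" by (simp add: smaller_def)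
  then show ?thesis
    using pm.subspace_add[OF filtration_subspace J_filtration[OF J_bar_d[OF ab(2)]] smaller_filtration] by (simp add: ab(1) lin.add)
qed

section \<open>Exactness of the bar complex off the diagonal\<close>

lemma bar_chains_iff:
  "z \<in> bar_chains X n j \<longleftrightarrow> z \<in> {z. keys z \<subseteq> {ws. set ws \<subseteq> Y \<and> length ws = n \<and> length (concat ws) = j}}"
  by (auto simp: bar_chains_def carrier_free_alg in_lists_conv_set)

lemma bar_chains_subspace: "pm.subspace (bar_chains X n j)"
proof -
  have eq: "bar_chains X n j = {z. keys z \<subseteq> {ws. set ws \<subseteq> Y \<and> length ws = n \<and> length (concat ws) = j}}"
    by (rule Set.set_eqI) (rule bar_chains_iff)
  show ?thesis unfolding eq by (rule subspace_keys)
qed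

lemma bar_max:
  assumes "z \<in> bar_chains X n j" "z \<noteq> 0"
  obtains ws where "ws \<in> keys z" "\<And>vs. vs \<in> keys z \<Longrightarrow> concat vs = concat ws \<or> (concat vs, concat ws) \<in> lenlex ord"
proof -
  have "\<exists>w\<in>concat ` keys z. \<forall>v\<in>concat ` keys z - {w}. (v, w) \<in> lenlex ord"
  proof (rule finite_has_lenlex_max[OF total_ord trans_ord])
    show "finite (concat ` keys z)" "concat ` keys z \<noteq> {}" using assms(2) by simp_all
    fix w assume "w \<in> concat ` keys z"
    then obtain ws where "w = concat ws" "set ws \<subseteq> Y" using assms(1) by (auto simp: bar_chains_iff)
    then show "set w \<subseteq> X" by auto
  qed
  then show thesis using that by blast
qed

text \<open>Induction on a bound \<open>t\<close> for the concatenations in \<open>z\<close>. Modulo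
  the filtration \<open>z\<close> is its normal part \<open>z1\<close>, and independence turns "the
  graded differential of \<open>z1\<close> lies in the filtration" into an exact zero. The
  contraction then gives \<open>y\<close> whose graded differential is \<open>z1\<close>, and what
  is left of \<open>z\<close> is, modulo \<open>J\<close>, a cycle \<open>b\<close> with smaller
  concatenations.\<close>

lemma exact_below:
  assumes "n < j"
  shows "length t = j \<Longrightarrow> z \<in> bar_chains X n j \<Longrightarrow>
    (\<And>ws. ws \<in> keys z \<Longrightarrow> concat ws = t \<or> (concat ws, t) \<in> lenlex ord) \<Longrightarrow> lin bar_d z \<in> J \<Longrightarrow>
    \<exists>y\<in>bar_chains X (Suc n) j. z - lin bar_d y \<in> J"
proof (induct t arbitrary: z rule: wf_induct_rule[OF wf_lex])
  case (1 t z)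
  have z: "set ws \<subseteq> Y" "length ws = n" "length (concat ws) = j" if "ws \<in> keys z" for ws
    using 1(3) that by (auto simp: bar_chains_iff)
  define z1 where "z1 = lin (\<lambda>ws. if ws \<in> normal_bars t n then mon ws else 0) z"
  have z1_keys: "keys z1 \<subseteq> normal_bars t n"
    unfolding z1_def by (rule lin_keys) auto
  have "z - z1 = lin (\<lambda>ws. mon ws - (if ws \<in> normal_bars t n then mon ws else 0)) z"
    by (simp only: z1_def lin_fun_diff lin_id)
  also have "\<dots> \<in> filtration t n"
  proof (rule lin_in_subspace[OF filtration_subspace])
    fix ws assume ws: "ws \<in> keys z"
    show "mon ws - (if ws \<in> normal_bars t n then mon ws else 0) \<in> filtration t n"
    proof (cases "concat ws = t")
      case True
      show ?thesis
      proof (cases "ws \<in> normal_bars t n")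
        case False
        then have "\<exists>w\<in>set ws. \<not> nrm w" using z[OF ws] True by (auto simp: normal_bars_def)
        then show ?thesis using nonnormal_filtration[of ws] z[OF ws] True False by simp
      qed (simp add: pm.subspace_0[OF filtration_subspace])
    next
      case False
      then have "mon ws \<in> smaller t n"
        using 1(4)[OF ws] z[OF ws] 1(2) by (simp add: smaller_def)
      moreover have "ws \<notin> normal_bars t n" using False by (simp add: normal_bars_def)
      ultimately show ?thesis using smaller_filtration by simp
    qed
  qed
  finally have rest: "z - z1 \<in> filtration t n" .
  have "lin bar_d z1 = lin bar_d z - lin bar_d (z - z1)" by (simp add: lin.diff)
  then have "lin bar_d z1 \<in> filtration t (n - 1)"
    using pm.subspace_diff[OF filtration_subspace J_filtration[OF 1(5)] filtration_bar_d[OF rest]] by simp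
  from pm.subspace_diff[OF filtration_subspace this lin_bar_d_diff[OF z1_keys]]
  have "lin bar_d_normal z1 \<in> filtration t (n - 1)" by simp
  moreover have "keys (lin bar_d_normal z1) \<subseteq> normal_bars t (n - 1)"
    using z1_keys bar_d_normal_keys by (intro lin_keys) blast
  ultimately have bdn0: "lin bar_d_normal z1 = 0" by (rule normal_independent[rotated])
  define y where "y = lin split_first z1"
  have y_keys: "keys y \<subseteq> normal_bars t (Suc n)"
    unfolding y_def using z1_keys split_first_keys by (intro lin_keys) blast
  moreover have "normal_bars t (Suc n) \<subseteq> {ws. set ws \<subseteq> Y \<and> length ws = Suc n \<and> length (concat ws) = j}"
    using 1(2) unfolding normal_bars_def by blast
  ultimately have y: "y \<in> bar_chains X (Suc n) j" unfolding bar_chains_iff mem_Collect_eq by (rule order_trans)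
  have "lin bar_d_normal y + lin split_first (lin bar_d_normal z1) = lin (\<lambda>ws. lin bar_d_normal (split_first ws) + lin split_first (bar_d_normal ws)) z1"
    by (simp add: y_def lin_lin lin_def[of "\<lambda>ws. lin bar_d_normal (split_first ws) + lin split_first (bar_d_normal ws)"]
        lin_def[of "\<lambda>ws. lin bar_d_normal (split_first ws)"] lin_def[of "\<lambda>ws. lin split_first (bar_d_normal ws)"] pm.scale_right_distrib sum.distrib)
  also have "\<dots> = lin mon z1"
    using homotopy z1_keys 1(2) assms by (intro lin_cong) blast
  finally have bdn_y: "lin bar_d_normal y = z1" by (simp add: bdn0 lin_id)
  have "lin bar_d y - lin bar_d_normal y \<in> filtration t n" using lin_bar_d_diff[OF y_keys] by simp
  from pm.subspace_diff[OF filtration_subspace rest this]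
  have "z - lin bar_d y \<in> filtration t n" by (simp add: bdn_y)
  then obtain a b where ab: "z - lin bar_d y = a + b" "a \<in> J" "b \<in> smaller t n" by (auto simp: filtration_def)
  have b: "b \<in> bar_chains X n j" using ab(3) 1(2) by (auto simp: bar_chains_iff smaller_def)
  have "b = z - lin bar_d y - a" using ab(1) by simp
  then have "lin bar_d b = lin bar_d z - lin bar_d a" by (simp add: lin.diff lin_bar_d_bar_d)
  then have bd_b: "lin bar_d b \<in> J" using pm.subspace_diff[OF J_subspace 1(5) J_bar_d[OF ab(2)]] by simp
  have "\<exists>y'\<in>bar_chains X (Suc n) j. b - lin bar_d y' \<in> J"
  proof (cases "b = 0")
    case True
    then show ?thesis using pm.subspace_0[OF bar_chains_subspace] pm.subspace_0[OF J_subspace] by force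
  next
    case False
    obtain ws where ws: "ws \<in> keys b" "\<And>vs. vs \<in> keys b \<Longrightarrow> concat vs = concat ws \<or> (concat vs, concat ws) \<in> lenlex ord"
      using bar_max[OF b False] by blast
    then have "(concat ws, t) \<in> lenlex ord" "length (concat ws) = j"
      using ab(3) 1(2) by (auto simp: smaller_def)
    then show ?thesis using 1(1)[of "concat ws" b] b ws(2) bd_b by blast
  qed
  then obtain y' where y': "y' \<in> bar_chains X (Suc n) j" "b - lin bar_d y' \<in> J" by blast
  have "z - lin bar_d (y + y') = a + (b - lin bar_d y')" using ab(1) by (simp add: lin.add algebra_simps)
  then have "z - lin bar_d (y + y') \<in> J" using pm.subspace_add[OF J_subspace ab(2) y'(2)] by simp
  then show ?case using pm.subspace_add[OF bar_chains_subspace y y'(1)] by blast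
qed

theorem Tor_vanishes_offdiagonal:
  assumes "n \<noteq> j"
  shows "Tor_vanishes X I n j"
  unfolding Tor_vanishes_def bar_diff_eq
proof (intro ballI impI)
  fix z assume z: "z \<in> bar_chains X n j" "lin bar_d z \<in> J"
  show "\<exists>y\<in>bar_chains X (Suc n) j. z - lin bar_d y \<in> J"
  proof (cases "z = 0")
    case True
    then show ?thesis using pm.subspace_0[OF bar_chains_subspace] pm.subspace_0[OF J_subspace] by force
  next
    case False
    obtain ws where ws: "ws \<in> keys z" "\<And>vs. vs \<in> keys z \<Longrightarrow> concat vs = concat ws \<or> (concat vs, concat ws) \<in> lenlex ord"
      using bar_max[OF z(1) False] by blast
    have w: "set ws \<subseteq> Y" "length ws = n" "length (concat ws) = j" using z(1) ws(1) by (auto simp: bar_chains_iff)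
    \<comment> \<open>Blocks are nonempty, so a nonzero chain has \<open>n \<le> j\<close>; off the
      diagonal only \<open>n < j\<close> remains.\<close>
    have "length vs \<le> length (concat vs)" if "set vs \<subseteq> Y" for vs :: "'x list list"
      using that
    proof (induct vs)
      case (Cons v vs)
      then have "0 < length v" by auto
      then show ?case using Cons by (simp del: length_greater_0_conv)
    qed simp
    from this[OF w(1)] have "n < j" using w(2,3) assms by simp
    then show ?thesis by (rule exact_below[OF _ w(3) z(1) ws(2) z(2)])
  qed
qed

end

section \<open>Quivers with a quadratic Groebner basis\<close>

text \<open>Subtracting the lower bounds leaves the exponents of monomials in three variables of
  negative degree, degree 0 and degree 1.\<close>

lemma triples_card:
  fixes x t :: nat
  shows "K < x + t \<Longrightarrow> card {(p, q, r). p + q + r = K \<and> x \<le> q \<and> t \<le> r} = 0"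
    "K = x + t \<Longrightarrow> card {(p, q, r). p + q + r = K \<and> x \<le> q \<and> t \<le> r} \<le> 1"
    "K = Suc (x + t) \<Longrightarrow> card {(p, q, r). p + q + r = K \<and> x \<le> q \<and> t \<le> r} \<le> 3"
proof -
  assume "K < x + t"
  then have e: "{(p, q, r). p + q + r = K \<and> x \<le> q \<and> t \<le> r} = {}" by auto
  show "card {(p, q, r). p + q + r = K \<and> x \<le> q \<and> t \<le> r} = 0" unfolding e by simp
next
  assume "K = x + t"
  then have "{(p, q, r). p + q + r = K \<and> x \<le> q \<and> t \<le> r} \<subseteq> {(0, x, t)}" by auto
  then have "card {(p, q, r). p + q + r = K \<and> x \<le> q \<and> t \<le> r} \<le> card {(0::nat, x, t)}"
    by (intro card_mono) auto
  then show "card {(p, q, r). p + q + r = K \<and> x \<le> q \<and> t \<le> r} \<le> 1" by simp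
next
  assume "K = Suc (x + t)"
  then have "{(p, q, r). p + q + r = K \<and> x \<le> q \<and> t \<le> r} \<subseteq> {(1, x, t), (0, Suc x, t), (0, x, Suc t)}" by auto
  then have "card {(p, q, r). p + q + r = K \<and> x \<le> q \<and> t \<le> r} \<le> card {(1::nat, x, t), (0, Suc x, t), (0, x, Suc t)}"
    by (intro card_mono) auto
  then show "card {(p, q, r). p + q + r = K \<and> x \<le> q \<and> t \<le> r} \<le> 3" by simp
qed

definition normal_word :: "('v, 'e) pre_digraph \<Rightarrow> ('v \<times> 'v) set \<Rightarrow> 'v multiset \<Rightarrow> nat \<Rightarrow> ('v \<times> nat) list \<Rightarrow> bool" where
  "normal_word Q r M K w \<longleftrightarrow> successively (normal_pair (arrows Q) r) w \<and> image_mset fst (mset w) = M \<and> sum_list (map snd w) = K"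

section \<open>Constraints on multiplicities from a quadratic Groebner basis\<close>

context
  fixes Q :: "('v, 'e) pre_digraph" and r
  assumes r: "linear_order_on (verts Q) r" and GB: "has_quadratic_groebner_basis (gen_order r) (quiver_ideal Q)"
    and sym: "symmetric_quiver Q"
begin

lemma normal_words_bound:
  assumes "c1 \<in> verts Q" "c2 \<in> verts Q" "c3 \<in> verts Q" "finite W"
    "\<And>w. w \<in> W \<Longrightarrow> normal_word Q r {#c1, c2, c3#} K w"
  shows "card W \<le> card {(p, q, r). p + q + r = K \<and> arrows Q c1 c2 \<le> q \<and> arrows Q c1 c3 + arrows Q c2 c3 \<le> r}"
  using assms(5) unfolding normal_word_def by (intro GB_triple_bound[OF r GB sym assms(1-4)]) blast+

lemma normal_word_degree:
  assumes "c1 \<in> verts Q" "c2 \<in> verts Q" "c3 \<in> verts Q" "normal_word Q r {#c1, c2, c3#} K w"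
  shows "arrows Q c1 c2 + (arrows Q c1 c3 + arrows Q c2 c3) \<le> K"
proof (rule ccontr)
  assume "\<not> ?thesis"
  then show False using normal_words_bound[OF assms(1-3), of "{w}" K] assms(4) by (simp add: triples_card(1))
qed

lemma normal_word_unique:
  assumes "c1 \<in> verts Q" "c2 \<in> verts Q" "c3 \<in> verts Q" "K = arrows Q c1 c2 + (arrows Q c1 c3 + arrows Q c2 c3)"
    "normal_word Q r {#c1, c2, c3#} K v" "normal_word Q r {#c1, c2, c3#} K w"
  shows "v = w"
proof (rule ccontr)
  assume "v \<noteq> w"
  then have "card {v, w} = 2" by simp
  then show False
    using normal_words_bound[OF assms(1-3), of "{v, w}" K] triples_card(2)[OF assms(4)] assms(5,6) by auto
qed

lemma normal_word_not_four:
  assumes "c1 \<in> verts Q" "c2 \<in> verts Q" "c3 \<in> verts Q" "K = Suc (arrows Q c1 c2 + (arrows Q c1 c3 + arrows Q c2 c3))"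
    "card W = 4" "\<And>w. w \<in> W \<Longrightarrow> normal_word Q r {#c1, c2, c3#} K w"
  shows False
proof -
  have "finite W" using assms(5) by (simp add: card_ge_0_finite)
  then show False
    using normal_words_bound[OF assms(1-3), of W K] triples_card(3)[OF assms(4)] assms(5,6) by auto
qed

lemma arrows_sym: "i \<in> verts Q \<Longrightarrow> j \<in> verts Q \<Longrightarrow> arrows Q i j = arrows Q j i"
  using sym by (auto simp: symmetric_quiver_def)

lemma order_cases: "i \<in> verts Q \<Longrightarrow> j \<in> verts Q \<Longrightarrow> i \<noteq> j \<Longrightarrow> (i, j) \<in> r \<and> (j, i) \<notin> r \<or> (j, i) \<in> r \<and> (i, j) \<notin> r"
  using r unfolding order_on_defs total_on_def antisym_def by blast

text \<open>The critical degree for the labels \<open>i, i, j\<close> is \<open>a + 2 * b\<close>.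
  If \<open>i\<close> precedes \<open>j\<close>, the least words with label orders
  \<open>i i j\<close> and \<open>i j i\<close> have degrees \<open>2 * a + b\<close> and
  \<open>3 * b + 1\<close>, which suffices. Otherwise both degrees are larger by one; the two
  additional values of \<open>a\<close> are excluded because the word with label order
  \<open>j i i\<close> already has the critical degree, where normal words are unique.\<close>

lemma GB_loops:
  assumes ij: "i \<in> verts Q" "j \<in> verts Q" "i \<noteq> j"
  shows "arrows Q i i = arrows Q i j \<or> arrows Q i i = Suc (arrows Q i j)"
proof -
  define a b where "a = arrows Q i i" and "b = arrows Q i j"
  have ji: "arrows Q j i = b" using arrows_sym[OF ij(1,2)] by (simp add: b_def)
  note defs = normal_word_def normal_pair_def ji a_def[symmetric] b_def[symmetric]
  note deg = normal_word_degree[OF ij(1) ij(1) ij(2), folded a_def b_def]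
  note uniq = normal_word_unique[OF ij(1) ij(1) ij(2), folded a_def b_def]
  from order_cases[OF ij] have "a = b \<or> a = Suc b"
  proof (elim disjE conjE)
    assume o: "(i, j) \<in> r" "(j, i) \<notin> r"
    have "normal_word Q r {#i, i, j#} (2 * a + b) [(i, 0), (i, a), (j, a + b)]"
      "normal_word Q r {#i, i, j#} (3 * b + 1) [(i, 0), (j, b), (i, 2 * b + 1)]"
      using o ij by (auto simp: defs)
    from this[THEN deg] show ?thesis by linarith
  next
    assume o: "(j, i) \<in> r" "(i, j) \<notin> r"
    have w: "normal_word Q r {#i, i, j#} (2 * a + b + 1) [(i, 0), (i, a), (j, a + b + 1)]"
      "normal_word Q r {#i, i, j#} (3 * b + 2) [(i, 0), (j, b + 1), (i, 2 * b + 1)]"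
      "normal_word Q r {#i, i, j#} (a + (b + b)) [(j, 0), (i, b), (i, a + b)]"
      using o ij by (auto simp: defs)
    have "2 * a + b + 1 \<noteq> a + (b + b)"
    proof
      assume e: "2 * a + b + 1 = a + (b + b)"
      show False using uniq[OF refl w(3) w(1)[unfolded e]] ij(3) by simp
    qed
    moreover have "3 * b + 2 \<noteq> a + (b + b)"
    proof
      assume e: "3 * b + 2 = a + (b + b)"
      show False using uniq[OF refl w(3) w(2)[unfolded e]] ij(3) by simp
    qed
    ultimately show ?thesis using w[THEN deg] by linarith
  qed
  then show ?thesis by (simp add: a_def b_def)
qed

text \<open>The words \<open>w1\<close> to \<open>w5\<close> are the least ones for five orders of
  the labels; \<open>v1\<close> and \<open>v2\<close> raise the last exponent of \<open>w1\<close>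
  and \<open>w2\<close> by one. Degrees leave \<open>x = y\<close> or \<open>x = y + 1\<close>. In
  the first case \<open>w1\<close>, in the second \<open>w2\<close> has the critical degree, and its
  uniqueness excludes the extreme values of \<open>z\<close>. There remain \<open>z = x\<close> or
  \<open>z = x + 1\<close> in the first case and \<open>z = x\<close> in the second; four words one
  degree higher rule out all but \<open>x = y = z\<close>.\<close>

lemma GB_three_sorted:
  assumes V: "i \<in> verts Q" "j \<in> verts Q" "k \<in> verts Q" and ne: "i \<noteq> j" "i \<noteq> k" "j \<noteq> k"
    and o: "(i, j) \<in> r" "(i, k) \<in> r" "(j, k) \<in> r"
  shows "arrows Q i j = arrows Q i k \<and> arrows Q j k = arrows Q i k"
proof -
  define x y z where "x = arrows Q i j" and "y = arrows Q i k" and "z = arrows Q j k"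
  have sw: "arrows Q j i = x" "arrows Q k i = y" "arrows Q k j = z"
    using arrows_sym V by (auto simp: x_def y_def z_def)
  have no: "(j, i) \<notin> r" "(k, i) \<notin> r" "(k, j) \<notin> r" using order_cases V ne o by blast+
  note defs = normal_word_def normal_pair_def sw x_def[symmetric] y_def[symmetric] z_def[symmetric]
  note deg = normal_word_degree[OF V, folded x_def y_def z_def]
  note uniq = normal_word_unique[OF V, folded x_def y_def z_def]
  note four = normal_word_not_four[OF V, folded x_def y_def z_def]
  let ?N = "normal_word Q r {#i, j, k#}"
  have w1: "?N (2 * x + z) [(i, 0), (j, x), (k, x + z)]"
    and w2: "?N (2 * y + z + 1) [(i, 0), (k, y), (j, y + z + 1)]"
    and w3: "?N (2 * x + y + 2) [(j, 0), (i, x + 1), (k, x + y + 1)]"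
    and w4: "?N (2 * z + y + 1) [(j, 0), (k, z), (i, y + z + 1)]"
    and w5: "?N (2 * y + x + 2) [(k, 0), (i, y + 1), (j, x + y + 1)]"
    and v1: "?N (2 * x + z + 1) [(i, 0), (j, x), (k, x + z + 1)]"
    and v2: "?N (2 * y + z + 2) [(i, 0), (k, y), (j, y + z + 2)]"
    using no o ne by (auto simp: defs add_mset_commute)
  note d = w1[THEN deg] w2[THEN deg] w3[THEN deg] w4[THEN deg] w5[THEN deg]
  have "x = y \<or> x = Suc y" using d by linarith
  then have "x = y \<and> z = y"
  proof
    assume xy: "x = y"
    have "2 * z + y + 1 \<noteq> 2 * x + z"
    proof
      assume e: "2 * z + y + 1 = 2 * x + z"
      show False using uniq[OF _ w1 w4[unfolded e]] xy ne by simp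
    qed
    moreover have "2 * x + y + 2 \<noteq> 2 * x + z"
    proof
      assume e: "2 * x + y + 2 = 2 * x + z"
      show False using uniq[OF _ w1 w3[unfolded e]] xy ne by simp
    qed
    moreover have "z \<noteq> Suc x"
    proof
      assume z: "z = Suc x"
      have "card {[(i, 0), (j, x), (k, x + z + 1)], [(i, 0), (k, y), (j, y + z + 1)],
          [(j, 0), (i, x + 1), (k, x + y + 1)], [(k, 0), (i, y + 1), (j, x + y + 1)]} = 4"
        using ne by auto
      moreover have k: "2 * x + z + 1 = Suc (x + (y + z))" "2 * y + z + 1 = Suc (x + (y + z))"
        "2 * x + y + 2 = Suc (x + (y + z))" "2 * y + x + 2 = Suc (x + (y + z))"
        using xy z by simp_all
      ultimately show False
        by (intro four[OF refl]) (use v1[unfolded k(1)] w2[unfolded k(2)] w3[unfolded k(3)] w5[unfolded k(4)] in blast)+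
    qed
    ultimately show ?thesis using d xy by linarith
  next
    assume xy: "x = Suc y"
    have "2 * z + y + 1 \<noteq> 2 * y + z + 1"
    proof
      assume e: "2 * z + y + 1 = 2 * y + z + 1"
      show False using uniq[OF _ w2 w4[unfolded e]] xy ne by simp
    qed
    moreover have "2 * y + x + 2 \<noteq> 2 * y + z + 1"
    proof
      assume e: "2 * y + x + 2 = 2 * y + z + 1"
      show False using uniq[OF _ w2 w5[unfolded e]] xy ne by simp
    qed
    moreover have "2 * x + y + 2 \<noteq> 2 * y + z + 1"
    proof
      assume e: "2 * x + y + 2 = 2 * y + z + 1"
      show False using uniq[OF _ w2 w3[unfolded e]] xy ne by simp
    qed
    moreover have "z \<noteq> x"
    proof
      assume z: "z = x"
      have "card {[(i, 0), (j, x), (k, x + z)], [(i, 0), (k, y), (j, y + z + 2)],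
          [(j, 0), (k, z), (i, y + z + 1)], [(k, 0), (i, y + 1), (j, x + y + 1)]} = 4"
        using ne by auto
      moreover have k: "2 * x + z = Suc (x + (y + z))" "2 * y + z + 2 = Suc (x + (y + z))"
        "2 * z + y + 1 = Suc (x + (y + z))" "2 * y + x + 2 = Suc (x + (y + z))"
        using xy z by simp_all
      ultimately show False
        by (intro four[OF refl]) (use w1[unfolded k(1)] v2[unfolded k(2)] w4[unfolded k(3)] w5[unfolded k(4)] in blast)+
    qed
    ultimately show ?thesis using d xy by linarith
  qed
  then show ?thesis by (simp add: x_def y_def z_def)
qed

lemma GB_three:
  assumes V: "i \<in> verts Q" "j \<in> verts Q" "k \<in> verts Q" and ne: "i \<noteq> j" "i \<noteq> k" "j \<noteq> k"
  shows "arrows Q i j = arrows Q i k"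
proof -
  note s = arrows_sym[OF V(1,2)] arrows_sym[OF V(1,3)] arrows_sym[OF V(2,3)]
  show ?thesis
    using order_cases[OF V(1,2) ne(1)] order_cases[OF V(1,3) ne(2)] order_cases[OF V(2,3) ne(3)]
      GB_three_sorted[of i j k] GB_three_sorted[of i k j] GB_three_sorted[of j i k]
      GB_three_sorted[of j k i] GB_three_sorted[of k i j] GB_three_sorted[of k j i] V ne s
      transD[of r] r[unfolded order_on_defs]
    by smt
qed

lemma GB_almost_regular: "\<exists>N. almost_regular N Q"
proof (cases "\<exists>i\<in>verts Q. \<exists>j\<in>verts Q. i \<noteq> j")
  case False
  show ?thesis
  proof (cases "verts Q = {}")
    case True
    then show ?thesis by (simp add: almost_regular_def)
  next
    case nonempty: False
    then obtain i where "verts Q = {i}" using False by blast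
    then show ?thesis by (auto simp: almost_regular_def)
  qed
next
  case True
  then obtain i0 j0 where 0: "i0 \<in> verts Q" "j0 \<in> verts Q" "i0 \<noteq> j0" by blast
  have share: "arrows Q i j = arrows Q i k" if "i \<in> verts Q" "j \<in> verts Q" "k \<in> verts Q" "i \<noteq> j" "i \<noteq> k" for i j k
    using GB_three[OF that(1-5)] by (cases "j = k") auto
  \<comment> \<open>Pairs of vertices with different first entries are compared through the pair
    formed by \<open>i\<close> and \<open>i0\<close>.\<close>
  have N: "arrows Q i j = arrows Q i0 j0" if "i \<in> verts Q" "j \<in> verts Q" "i \<noteq> j" for i j
  proof (cases "i = i0")
    case True
    then show ?thesis using share[of i0 j j0] that 0 by auto
  next
    case False
    then have "arrows Q i j = arrows Q i i0" using share[of i j i0] that 0 by auto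
    also have "\<dots> = arrows Q i0 i" using arrows_sym that 0 by auto
    also have "\<dots> = arrows Q i0 j0" using share[of i0 i j0] that 0 False by auto
    finally show ?thesis .
  qed
  have "arrows Q i i = arrows Q i0 j0 \<or> arrows Q i i = arrows Q i0 j0 + 1" if i: "i \<in> verts Q" for i
  proof -
    obtain j where j: "j \<in> verts Q" "i \<noteq> j" using 0 by blast
    show ?thesis using GB_loops[OF i j] N[OF i j] by simp
  qed
  then show ?thesis using N unfolding almost_regular_def by blast
qed

end

section \<open>Koszulness of almost regular quivers, and the conclusion\<close>

lemma quiver_ideal_no_Nil:
  assumes "f \<in> quiver_ideal Q"
  shows "lkp f [] = 0"
proof -
  have "Idl\<^bsub>free_alg (quiver_gens Q)\<^esub> (quiver_rels Q) \<subseteq> {f. keys f \<subseteq> {w. w \<noteq> []}}"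
  proof (rule Idl_subset_subspace[OF quiver_rels_carrier subspace_keys])
    fix u v f assume "f \<in> quiver_rels Q"
    then have "homogeneous 2 f" by (rule quiver_rels_homogeneous)
    then show "mon u * f * mon v \<in> {f. keys f \<subseteq> {w. w \<noteq> []}}"
      by (auto simp: keys_mon_mult homogeneous_def)
  qed
  then have "keys f \<subseteq> {w. w \<noteq> []}" using assms unfolding quiver_ideal_def by blast
  then show ?thesis by (auto simp: in_keys_iff)
qed

lemma wf_gen_order:
  assumes "finite V" "linear_order_on V r"
  shows "wf (gen_order r)"
proof -
  have "r \<subseteq> V \<times> V" "trans r" "antisym r" using assms(2) by (auto simp: order_on_defs refl_on_def)
  have "finite (r - Id)" using \<open>r \<subseteq> V \<times> V\<close> assms(1) by (meson finite_Diff finite_SigmaI finite_subset)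
  moreover have "acyclic (r - Id)"
    using trancl_id[OF trans_diff_Id[OF \<open>trans r\<close> \<open>antisym r\<close>]] by (simp add: acyclic_def)
  ultimately have "wf (r - Id)" by (rule finite_acyclic_wf)
  then have "wf (inv_image (less_than <*lex*> (r - Id)) (\<lambda>(i, k). (k, i)))" by blast
  then show ?thesis by (rule wf_subset) (auto simp: gen_order_def)
qed

lemma almost_regular_koszul:
  assumes fin: "finite (verts Q)" and r: "linear_order_on (verts Q) r" and N: "almost_regular N Q"
  shows "koszul (quiver_gens Q) (quiver_rels Q)"
proof -
  interpret quadratic_pbw "quiver_gens Q" "gen_order r" "quiver_ideal Q" "\<lambda>x y. \<not> normal_pair (arrows Q) r x y"
  proof (rule quadratic_pbw.intro)
    show "ideal (quiver_ideal Q) (free_alg (quiver_gens Q))" by (rule quiver_ideal(1))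
    show "wf (gen_order r)" by (rule wf_gen_order[OF fin r])
    show "trans (gen_order r)" by (rule gen_order_trans[OF r])
    show "lkp f [] = 0" if "f \<in> quiver_ideal Q" for f using quiver_ideal_no_Nil[OF that] .
    show "(x, y) \<in> gen_order r \<or> (y, x) \<in> gen_order r"
      if "x \<in> quiver_gens Q" "y \<in> quiver_gens Q" "x \<noteq> y" for x y
      using gen_order_total[OF r, of x y] that unfolding quiver_gens_def by blast
    show "\<exists>g\<in>quiver_ideal Q. homogeneous 2 g \<and> is_leading_monomial (gen_order r) g [x, y]"
      if "x \<in> quiver_gens Q" "y \<in> quiver_gens Q" "\<not> normal_pair (arrows Q) r x y" for x y
      using quadratic_leading[OF that] .
    fix w assume w: "set w \<subseteq> quiver_gens Q" "successively (\<lambda>x y. \<not> \<not> normal_pair (arrows Q) r x y) w"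
    then obtain \<phi> where \<phi>: "least_in_support (gen_order r) \<phi> w" "swap_covariant (\<lambda>i j. (-1) ^ (arrows Q i i * arrows Q j j)) \<phi>" "kills_binomial_sums (arrows Q) \<phi>"
      using functional_exists[OF r, of w "arrows Q" N] almost_regular_labels[OF N w(1)] unfolding quiver_gens_def by auto
    have "ev \<phi> f = 0" if "f \<in> quiver_ideal Q" for f
      by (rule functional_kills_ideal[OF \<phi>(2,3) that])
    then show "\<exists>\<phi>. \<phi> w \<noteq> 0 \<and> (\<forall>v. \<phi> v \<noteq> 0 \<longrightarrow> length v = length w \<and> (v = w \<or> (w, v) \<in> lenlex (gen_order r))) \<and>
        (\<forall>f\<in>quiver_ideal Q. ev \<phi> f = 0)"
      using \<phi>(1) unfolding least_in_support_def by blast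
  qed
  show ?thesis
    unfolding koszul_def quiver_ideal_def[symmetric]
    using quiver_rels_carrier quiver_rels_homogeneous Tor_vanishes_offdiagonal by blast
qed

theorem theorem6p4:
  fixes Q :: "('v, 'e) pre_digraph" and r :: "('v \<times> 'v) set"
  assumes "fin_digraph Q"
    and "symmetric_quiver Q"
    and "linear_order_on (verts Q) r"
  shows "(has_quadratic_groebner_basis (gen_order r) (quiver_ideal Q)
            \<longleftrightarrow> (\<exists>N. almost_regular N Q))
       \<and> (\<forall>N. almost_regular N Q \<longrightarrow> koszul (quiver_gens Q) (quiver_rels Q))"
  using GB_almost_regular[OF assms(3) _ assms(2)] almost_regular_quadratic_GB[OF assms(3)]
    almost_regular_koszul[OF fin_digraph.finite_verts[OF assms(1)] assms(3)] by blast

end
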